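(* Let $\varepsilon>0$, $\sigma>\frac14$, and let $P_\varepsilon = 1-\varepsilon^2\Delta$ on $\mathbb{R}^2$. Then for any $\boldsymbol{\delta}\in\mathbb{R}^2$ and any $u_0\in H^1(\mathbb{R}^2)$, there exists a unique global-in-time solution $u\in C(\mathbb{R}_t;H^1(\mathbb{R}^2_x))$ to $$i\partial_t u + P_\varepsilon^{-1}\Delta u + P_\varepsilon^{-1}(1+i\boldsymbol{\delta}\cdot\nabla)\big(|u|^{2\sigma}u\big)=0,\qquad u|_{t=0}=u_0,$$ depending continuously on the initial data. Moreover, there is a constant $C(\varepsilon,\|u_0\|_{H^1})$, depending only on $\varepsilon$ and $\|u_0\|_{H^1}$, such that $$\|u(t,\cdot)\|_{H^1(\mathbb{R}^2)}\le C(\varepsilon,\|u_0\|_{H^1})\quad\text{for all } t\in\mathbb{R}.$$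
   Context: Here $u=u(t,x)\in\mathbb{C}$ with $t\in\mathbb{R}$ and $x=(x_1,x_2)\in\mathbb{R}^2$. The operator $P_\varepsilon^{s}$, $s\in\mathbb{R}$, is the Fourier multiplier with symbol $(1+\varepsilon^2|\xi|^2)^s$, $\xi=(\xi_1,\xi_2)\in\mathbb{R}^2$. Let $S_\varepsilon(t)=e^{itP_\varepsilon^{-1}\Delta}$ be the linear propagator, i.e. the Fourier multiplier with symbol $\exp\big(-it|\xi|^2/(1+\varepsilon^2|\xi|^2)\big)$. A solution is understood in the sense of Duhamel's formula: $$u(t)=S_\varepsilon(t)u_0+i\int_0^t S_\varepsilon(t-s)P_\varepsilon^{-1}(1+i\boldsymbol{\delta}\cdot\nabla)\big(|u|^{2\sigma}u\big)(s)\,ds .$$ Continuous dependence is meant in the usual sense of well-posedness in $H^1$: the map $u_0\mapsto u$ is continuous from $H^1(\mathbb{R}^2)$ into $C(I;H^1(\mathbb{R}^2))$ for each compact time interval $I\ni 0$. *)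

theory Defs
  imports "HOL-Analysis.Analysis"
begin

section \<open>The space \<open>L\<^sup>2(\<real>\<^sup>2; \<complex>)\<close>\<close>

definition square_integrable :: "(real^2 \<Rightarrow> complex) \<Rightarrow> bool" where
  "square_integrable f \<longleftrightarrow>
     f \<in> borel_measurable lborel \<and> integrable lborel (\<lambda>x. (cmod (f x))\<^sup>2)"

definition l2_eq :: "(real^2 \<Rightarrow> complex) \<Rightarrow> (real^2 \<Rightarrow> complex) \<Rightarrow> bool" where
  "l2_eq f g \<longleftrightarrow> square_integrable f \<and> square_integrable g \<and> (AE x in lborel. f x = g x)"

lemma cmod_add_sq_le: "(cmod (a + b))\<^sup>2 \<le> 2 * (cmod a)\<^sup>2 + 2 * (cmod b)\<^sup>2"
proof -
  have "(cmod (a + b))\<^sup>2 \<le> (cmod a + cmod b)\<^sup>2"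
    by (intro power_mono norm_triangle_ineq) auto
  also have "\<dots> \<le> 2 * (cmod a)\<^sup>2 + 2 * (cmod b)\<^sup>2"
    using zero_le_power2[of "cmod a - cmod b"] by (simp add: power2_eq_square algebra_simps)
  finally show ?thesis .
qed

lemma square_integrable_add:
  assumes "square_integrable f" "square_integrable g"
  shows "square_integrable (\<lambda>x. f x + g x)"
  unfolding square_integrable_def
proof (intro conjI)
  show m: "(\<lambda>x. f x + g x) \<in> borel_measurable lborel"
    using assms unfolding square_integrable_def by auto
  show "integrable lborel (\<lambda>x. (cmod (f x + g x))\<^sup>2)"
  proof (rule Bochner_Integration.integrable_bound)
    show "integrable lborel (\<lambda>x. 2 * (cmod (f x))\<^sup>2 + 2 * (cmod (g x))\<^sup>2)"
      using assms unfolding square_integrable_def by auto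
    show "(\<lambda>x. (cmod (f x + g x))\<^sup>2) \<in> borel_measurable lborel" using m by measurable
    have "(cmod (f x + g x))\<^sup>2 \<le> 2 * (cmod (f x))\<^sup>2 + 2 * (cmod (g x))\<^sup>2" for x
      by (rule cmod_add_sq_le)
    then show "AE x in lborel. norm ((cmod (f x + g x))\<^sup>2) \<le>
        norm (2 * (cmod (f x))\<^sup>2 + 2 * (cmod (g x))\<^sup>2)"
      by (intro always_eventually allI) (auto intro: order_trans[OF _ abs_ge_self])
  qed
qed

lemma square_integrable_cmult:
  assumes "square_integrable f"
  shows "square_integrable (\<lambda>x. c * f x)"
  using assms unfolding square_integrable_def by (auto simp: norm_mult power_mult_distrib)

lemma square_integrable_0: "square_integrable (\<lambda>_. 0)"
  unfolding square_integrable_def by simp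

lemma square_integrable_inner:
  assumes "square_integrable f" "square_integrable g"
  shows "integrable lborel (\<lambda>x. f x \<bullet> g x)"
proof (rule Bochner_Integration.integrable_bound)
  show "integrable lborel (\<lambda>x. (cmod (f x))\<^sup>2 + (cmod (g x))\<^sup>2)"
    using assms unfolding square_integrable_def by auto
  show "(\<lambda>x. f x \<bullet> g x) \<in> borel_measurable lborel"
    using assms unfolding square_integrable_def by auto
  have "\<bar>f x \<bullet> g x\<bar> \<le> (cmod (f x))\<^sup>2 + (cmod (g x))\<^sup>2" for x
  proof -
    have "\<bar>f x \<bullet> g x\<bar> \<le> cmod (f x) * cmod (g x)" by (rule Cauchy_Schwarz_ineq2)
    also have "\<dots> \<le> (cmod (f x))\<^sup>2 + (cmod (g x))\<^sup>2"
      using sum_squares_bound[of "cmod (f x)" "cmod (g x)"]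
        mult_nonneg_nonneg[OF norm_ge_zero[of "f x"] norm_ge_zero[of "g x"]] by linarith
    finally show ?thesis .
  qed
  then show "AE x in lborel. norm (f x \<bullet> g x) \<le> norm ((cmod (f x))\<^sup>2 + (cmod (g x))\<^sup>2)"
    by (intro always_eventually allI) (auto intro: order_trans[OF _ abs_ge_self])
qed

lemma l2_eq_part_equivp: "part_equivp l2_eq"
proof (rule part_equivpI)
  show "\<exists>x. l2_eq x x"
    by (rule exI[of _ "\<lambda>_. 0"]) (simp add: l2_eq_def square_integrable_0)
  show "symp l2_eq" by (auto simp: symp_def l2_eq_def eq_commute)
  show "transp l2_eq"
  proof (rule transpI)
    fix f g h assume "l2_eq f g" "l2_eq g h"
    then show "l2_eq f h" unfolding l2_eq_def by (auto elim: eventually_elim2)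
  qed
qed

quotient_type l2 = "real^2 \<Rightarrow> complex" / partial: l2_eq
  by (rule l2_eq_part_equivp)

instantiation l2 :: real_inner
begin

lift_definition zero_l2 :: l2 is "\<lambda>_. 0"
  by (simp add: l2_eq_def square_integrable_0)

lift_definition plus_l2 :: "l2 \<Rightarrow> l2 \<Rightarrow> l2" is "\<lambda>f g x. f x + g x"
  unfolding l2_eq_def by (auto simp: square_integrable_add elim: eventually_elim2)

lift_definition scaleR_l2 :: "real \<Rightarrow> l2 \<Rightarrow> l2" is "\<lambda>c f x. complex_of_real c * f x"
  unfolding l2_eq_def by (auto simp: square_integrable_cmult elim: eventually_mono)

definition uminus_l2 :: "l2 \<Rightarrow> l2" where "uminus_l2 f = (-1) *\<^sub>R f"

definition minus_l2 :: "l2 \<Rightarrow> l2 \<Rightarrow> l2" where "minus_l2 f g = f + - g"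

lift_definition inner_l2 :: "l2 \<Rightarrow> l2 \<Rightarrow> real" is "\<lambda>f g. LINT x|lborel. f x \<bullet> g x"
proof -
  fix f f' g g' assume "l2_eq f f'" "l2_eq g g'"
  then have m: "f \<in> borel_measurable lborel" "f' \<in> borel_measurable lborel"
      "g \<in> borel_measurable lborel" "g' \<in> borel_measurable lborel"
    and ae: "AE x in lborel. f x = f' x" "AE x in lborel. g x = g' x"
    unfolding l2_eq_def square_integrable_def by auto
  show "(LINT x|lborel. f x \<bullet> g x) = (LINT x|lborel. f' x \<bullet> g' x)"
    using ae by (intro integral_cong_AE borel_measurable_inner m) (auto elim: eventually_elim2)
qed

lift_definition norm_l2 :: "l2 \<Rightarrow> real" is "\<lambda>f. sqrt (LINT x|lborel. (cmod (f x))\<^sup>2)"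
proof -
  fix f f' assume "l2_eq f f'"
  then have m: "f \<in> borel_measurable lborel" "f' \<in> borel_measurable lborel"
    and ae: "AE x in lborel. f x = f' x"
    unfolding l2_eq_def square_integrable_def by auto
  have "(LINT x|lborel. (cmod (f x))\<^sup>2) = (LINT x|lborel. (cmod (f' x))\<^sup>2)"
    using m ae by (intro integral_cong_AE) (auto elim: eventually_mono)
  then show "sqrt (LINT x|lborel. (cmod (f x))\<^sup>2) = sqrt (LINT x|lborel. (cmod (f' x))\<^sup>2)"
    by simp
qed

definition dist_l2 :: "l2 \<Rightarrow> l2 \<Rightarrow> real" where "dist_l2 f g = norm (f - g)"

definition sgn_l2 :: "l2 \<Rightarrow> l2" where "sgn_l2 f = inverse (norm f) *\<^sub>R f"

definition uniformity_l2 :: "(l2 \<times> l2) filter" where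
  "uniformity_l2 = (INF e\<in>{0<..}. principal {(f, g). dist f g < e})"

definition open_l2 :: "l2 set \<Rightarrow> bool" where
  "open_l2 U \<longleftrightarrow> (\<forall>f\<in>U. \<forall>\<^sub>F (f', g) in uniformity. f' = f \<longrightarrow> g \<in> U)"

instance
proof
  fix f g h :: l2 and a b :: real and U :: "l2 set"
  note l2e = l2_eq_def square_integrable_add square_integrable_cmult square_integrable_0
  show "f + g + h = f + (g + h)"
    by transfer (auto simp: l2e add.assoc)
  show "f + g = g + f"
    by transfer (auto simp: l2e add.commute)
  show "0 + f = f"
    by transfer (auto simp: l2e)
  show "- f + f = 0"
    unfolding uminus_l2_def by transfer (auto simp: l2e intro!: square_integrable_add
      square_integrable_cmult[of _ "-1", simplified])
  show "f - g = f + - g" by (simp add: minus_l2_def)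
  show "a *\<^sub>R (f + g) = a *\<^sub>R f + a *\<^sub>R g"
    by transfer (auto simp: l2e distrib_left)
  show "(a + b) *\<^sub>R f = a *\<^sub>R f + b *\<^sub>R f"
  proof transfer
    fix a b f assume "l2_eq f f"
    then show "l2_eq (\<lambda>x. complex_of_real (a + b) * f x)
        (\<lambda>x. complex_of_real a * f x + complex_of_real b * f x)"
      unfolding l2_eq_def
      by (intro conjI square_integrable_add square_integrable_cmult) (auto simp: algebra_simps)
  qed
  show "a *\<^sub>R b *\<^sub>R f = (a * b) *\<^sub>R f"
  proof transfer
    fix a b f assume "l2_eq f f"
    then show "l2_eq (\<lambda>x. complex_of_real a * (complex_of_real b * f x))
        (\<lambda>x. complex_of_real (a * b) * f x)"
      unfolding l2_eq_def
      by (intro conjI square_integrable_cmult) (auto simp: algebra_simps)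
  qed
  show "1 *\<^sub>R f = f"
    by transfer (auto simp: l2e)
  show "dist f g = norm (f - g)" by (simp add: dist_l2_def)
  show "sgn f = inverse (norm f) *\<^sub>R f" by (simp add: sgn_l2_def)
  show "uniformity = (INF e\<in>{0<..}. principal {(f, g :: l2). dist f g < e})"
    by (simp add: uniformity_l2_def)
  show "open U \<longleftrightarrow> (\<forall>f\<in>U. \<forall>\<^sub>F (f', g) in uniformity. f' = f \<longrightarrow> g \<in> U)"
    by (simp add: open_l2_def)
  show "f \<bullet> g = g \<bullet> f"
    by transfer (simp add: inner_commute)
  show "(f + g) \<bullet> h = f \<bullet> h + g \<bullet> h"
    by transfer (simp add: inner_add_left l2_eq_def square_integrable_inner)
  show "(a *\<^sub>R f) \<bullet> g = a * (f \<bullet> g)"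
    by transfer (simp flip: scaleR_conv_of_real)
  show "0 \<le> f \<bullet> f"
    by transfer (simp add: integral_nonneg_AE)
  show "f \<bullet> f = 0 \<longleftrightarrow> f = 0"
  proof transfer
    fix f :: "real^2 \<Rightarrow> complex" assume "l2_eq f f"
    then have sq: "square_integrable f" by (simp add: l2_eq_def)
    have "(LINT x|lborel. f x \<bullet> f x) = 0 \<longleftrightarrow> (AE x in lborel. f x \<bullet> f x = 0)"
      by (rule integral_nonneg_eq_0_iff_AE) (auto intro: square_integrable_inner sq)
    then show "(LINT x|lborel. f x \<bullet> f x) = 0 \<longleftrightarrow> l2_eq f (\<lambda>_. 0)"
      by (simp add: l2_eq_def sq square_integrable_0)
  qed
  show "norm f = sqrt (f \<bullet> f)"
    by transfer (simp add: power2_norm_eq_inner)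
qed

end

lift_definition scaleC_l2 :: "complex \<Rightarrow> l2 \<Rightarrow> l2" is "\<lambda>c f x. c * f x"
  unfolding l2_eq_def by (auto simp: square_integrable_cmult elim: eventually_mono)

definition l2_of :: "(real^2 \<Rightarrow> complex) \<Rightarrow> l2" where
  "l2_of f = (if square_integrable f then abs_l2 f else 0)"

lemma square_integrable_rep_l2: "square_integrable (rep_l2 f)"
  using Quotient3_rep_reflp[OF Quotient3_l2, of f] by (simp add: l2_eq_def)

lemma rep_l2_measurable [measurable]: "rep_l2 f \<in> borel_measurable lborel"
  using square_integrable_rep_l2 by (auto simp: square_integrable_def)

lemma l2_of_eqI:
  assumes "square_integrable f" "square_integrable g" "AE x in lborel. f x = g x"
  shows "l2_of f = l2_of g"
proof -
  have "l2_eq f g" using assms by (simp add: l2_eq_def)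
  then have "abs_l2 f = abs_l2 g" by (rule Quotient3_rel_abs[OF Quotient3_l2])
  then show ?thesis using assms by (simp add: l2_of_def)
qed

lemma l2_of_rep_l2: "l2_of (rep_l2 f) = f"
  by (simp add: l2_of_def square_integrable_rep_l2 Quotient3_abs_rep[OF Quotient3_l2])

lemma rep_l2_of: "square_integrable f \<Longrightarrow> AE x in lborel. rep_l2 (l2_of f) x = f x"
  using rep_abs_rsp_left[OF Quotient3_l2, of f f] by (simp add: l2_of_def l2_eq_def)

lemma l2_eqI: "AE x in lborel. rep_l2 f x = rep_l2 g x \<Longrightarrow> f = g"
  by (metis l2_of_eqI l2_of_rep_l2 square_integrable_rep_l2)

lemma l2_of_add:
  assumes "square_integrable f" "square_integrable g"
  shows "l2_of (\<lambda>x. f x + g x) = l2_of f + l2_of g"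
  using assms by (simp add: l2_of_def square_integrable_add plus_l2.abs_eq l2_eq_def)

lemma l2_of_scaleR:
  assumes "square_integrable f"
  shows "l2_of (\<lambda>x. complex_of_real c * f x) = c *\<^sub>R l2_of f"
  using assms by (simp add: l2_of_def square_integrable_cmult scaleR_l2.abs_eq l2_eq_def)

lemma rep_l2_add: "AE x in lborel. rep_l2 (f + g) x = rep_l2 f x + rep_l2 g x"
  using rep_l2_of[OF square_integrable_add[OF square_integrable_rep_l2 square_integrable_rep_l2], of f g]
  by (simp add: l2_of_add square_integrable_rep_l2 l2_of_rep_l2)

lemma rep_l2_scaleR: "AE x in lborel. rep_l2 (c *\<^sub>R f) x = complex_of_real c * rep_l2 f x"
  using rep_l2_of[OF square_integrable_cmult[OF square_integrable_rep_l2], of "complex_of_real c" f]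
  by (simp add: l2_of_scaleR square_integrable_rep_l2 l2_of_rep_l2)


section \<open>Fourier transform and Fourier multipliers on \<open>L\<^sup>2\<close>\<close>

definition fourier_integral :: "(real^2 \<Rightarrow> complex) \<Rightarrow> real^2 \<Rightarrow> complex" where
  "fourier_integral f \<xi> =
     complex_of_real (1 / (2 * pi)) * (LINT x|lborel. exp (- \<i> * complex_of_real (\<xi> \<bullet> x)) * f x)"

definition cutoff :: "real \<Rightarrow> l2 \<Rightarrow> real^2 \<Rightarrow> complex" where
  "cutoff R f x = indicator (cball 0 R) x * rep_l2 f x"

text \<open>
  The \<open>L\<^sup>2\<close> (Plancherel) transform: \<open>g\<close> is the \<open>L\<^sup>2\<close>-limit, as \<open>R \<rightarrow> \<infinity>\<close>, of the absolutely
  convergent Fourier integrals of \<open>f\<close> over the balls of radius \<open>R\<close>. In the unitary normalisation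
  used here every \<open>f\<close> in \<open>L\<^sup>2\<close> has exactly one transform, and the transform is an isometric
  bijection, so the definite descriptions below are meaningful.
\<close>

definition has_fourier :: "l2 \<Rightarrow> l2 \<Rightarrow> bool" where
  "has_fourier f g \<longleftrightarrow>
     ((\<lambda>R. \<integral>\<^sup>+\<xi>. ennreal ((cmod (fourier_integral (cutoff R f) \<xi> - rep_l2 g \<xi>))\<^sup>2) \<partial>lborel)
        \<longlongrightarrow> 0) at_top"

definition fourier :: "l2 \<Rightarrow> l2" where
  "fourier f = (THE g. has_fourier f g)"

definition fourier_multiplier :: "(real^2 \<Rightarrow> complex) \<Rightarrow> l2 \<Rightarrow> l2" where
  "fourier_multiplier m f =
     (THE h. has_fourier h (l2_of (\<lambda>\<xi>. m \<xi> * rep_l2 (fourier f) \<xi>)))"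

lemma cutoff_measurable: "cutoff R f \<in> borel_measurable lborel"
  unfolding cutoff_def
  by (intro borel_measurable_times borel_measurable_indicator rep_l2_measurable) simp

lemma cutoff_integrable: "integrable lborel (cutoff R f)"
proof (rule Bochner_Integration.integrable_bound)
  have "integrable lborel (\<lambda>x::real^2. indicator (cball 0 R) x :: real)"
    using emeasure_bounded_finite[OF bounded_cball, of "0::real^2" R]
    by (intro integrable_real_indicator) auto
  then show "integrable lborel (\<lambda>x. indicator (cball 0 R) x + (cmod (rep_l2 f x))\<^sup>2)"
    using square_integrable_rep_l2[of f] unfolding square_integrable_def by auto
  show "cutoff R f \<in> borel_measurable lborel" by (rule cutoff_measurable)
  have "cmod z \<le> 1 + (cmod z)\<^sup>2" for z
    using sum_squares_bound[of "cmod z" 1, unfolded power_one mult_1_right] norm_ge_zero[of z]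
    by linarith
  then have "norm (cutoff R f x) \<le> norm (indicator (cball 0 R) x + (cmod (rep_l2 f x))\<^sup>2)" for x
    by (auto simp: cutoff_def indicator_def)
  then show "AE x in lborel. norm (cutoff R f x) \<le>
      norm (indicator (cball 0 R) x + (cmod (rep_l2 f x))\<^sup>2)"
    by simp
qed

lemma fourier_kernel_integrable:
  "integrable lborel (\<lambda>x. exp (- \<i> * complex_of_real (\<xi> \<bullet> x)) * cutoff R f x)"
proof (rule Bochner_Integration.integrable_bound[OF cutoff_integrable[of R f]])
  show "(\<lambda>x. exp (- \<i> * complex_of_real (\<xi> \<bullet> x)) * cutoff R f x) \<in> borel_measurable lborel"
    using cutoff_measurable[of R f] by measurable
qed (simp add: norm_mult)

lemma fourier_cutoff_measurable: "fourier_integral (cutoff R f) \<in> borel_measurable lborel"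
proof -
  have "(\<lambda>(\<xi>, x). exp (- \<i> * complex_of_real (\<xi> \<bullet> x)) * cutoff R f x)
      \<in> borel_measurable (lborel \<Otimes>\<^sub>M lborel)"
    using cutoff_measurable[of R f] by measurable
  from lborel.borel_measurable_lebesgue_integral[OF this] show ?thesis
    unfolding fourier_integral_def by measurable
qed

lemma fourier_cutoff_add:
  "fourier_integral (cutoff R (f + g)) \<xi> =
   fourier_integral (cutoff R f) \<xi> + fourier_integral (cutoff R g) \<xi>"
proof -
  let ?e = "\<lambda>x. exp (- \<i> * complex_of_real (\<xi> \<bullet> x))"
  have "(LINT x|lborel. ?e x * cutoff R (f + g) x) =
      (LINT x|lborel. ?e x * cutoff R f x + ?e x * cutoff R g x)"
  proof (rule integral_cong_AE)
    show "AE x in lborel. ?e x * cutoff R (f + g) x = ?e x * cutoff R f x + ?e x * cutoff R g x"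
      using rep_l2_add[of f g] by (rule eventually_mono) (simp add: cutoff_def algebra_simps)
  qed (use fourier_kernel_integrable[of \<xi> R] in \<open>auto dest!: borel_measurable_integrable\<close>)
  also have "\<dots> = (LINT x|lborel. ?e x * cutoff R f x) + (LINT x|lborel. ?e x * cutoff R g x)"
    by (intro Bochner_Integration.integral_add fourier_kernel_integrable)
  finally show ?thesis by (simp add: fourier_integral_def algebra_simps)
qed

lemma fourier_cutoff_scaleR:
  "fourier_integral (cutoff R (c *\<^sub>R f)) \<xi> = complex_of_real c * fourier_integral (cutoff R f) \<xi>"
proof -
  let ?e = "\<lambda>x. exp (- \<i> * complex_of_real (\<xi> \<bullet> x))"
  have "(LINT x|lborel. ?e x * cutoff R (c *\<^sub>R f) x) =
      (LINT x|lborel. complex_of_real c * (?e x * cutoff R f x))"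
  proof (rule integral_cong_AE)
    show "AE x in lborel. ?e x * cutoff R (c *\<^sub>R f) x = complex_of_real c * (?e x * cutoff R f x)"
      using rep_l2_scaleR[of c f] by (rule eventually_mono) (simp add: cutoff_def algebra_simps)
  qed (use fourier_kernel_integrable[of \<xi> R] in \<open>auto dest!: borel_measurable_integrable\<close>)
  also have "\<dots> = complex_of_real c * (LINT x|lborel. ?e x * cutoff R f x)"
    by (simp only: integral_mult_right_zero)
  finally show ?thesis by (simp add: fourier_integral_def algebra_simps)
qed

lemma nn_integral_sq_add_le:
  fixes a b c :: "real^2 \<Rightarrow> complex"
  assumes [measurable]: "a \<in> borel_measurable lborel" "b \<in> borel_measurable lborel"
    and "AE x in lborel. c x = a x + b x"
  shows "(\<integral>\<^sup>+x. ennreal ((cmod (c x))\<^sup>2) \<partial>lborel) \<le>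
    2 * (\<integral>\<^sup>+x. ennreal ((cmod (a x))\<^sup>2) \<partial>lborel) + 2 * (\<integral>\<^sup>+x. ennreal ((cmod (b x))\<^sup>2) \<partial>lborel)"
proof -
  have "(\<integral>\<^sup>+x. ennreal ((cmod (c x))\<^sup>2) \<partial>lborel) \<le>
      (\<integral>\<^sup>+x. 2 * ennreal ((cmod (a x))\<^sup>2) + 2 * ennreal ((cmod (b x))\<^sup>2) \<partial>lborel)"
  proof (rule nn_integral_mono_AE, use assms(3) in \<open>rule eventually_mono\<close>)
    fix x assume "c x = a x + b x"
    then have "ennreal ((cmod (c x))\<^sup>2) \<le> ennreal (2 * (cmod (a x))\<^sup>2 + 2 * (cmod (b x))\<^sup>2)"
      using cmod_add_sq_le by (metis ennreal_leI)
    then show "ennreal ((cmod (c x))\<^sup>2) \<le> 2 * ennreal ((cmod (a x))\<^sup>2) + 2 * ennreal ((cmod (b x))\<^sup>2)"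
      by (simp add: ennreal_plus ennreal_mult)
  qed
  also have "\<dots> = 2 * (\<integral>\<^sup>+x. ennreal ((cmod (a x))\<^sup>2) \<partial>lborel) +
      2 * (\<integral>\<^sup>+x. ennreal ((cmod (b x))\<^sup>2) \<partial>lborel)"
    by (simp add: nn_integral_add nn_integral_cmult)
  finally show ?thesis .
qed

lemma has_fourier_tendsto_0I:
  assumes "(F \<longlongrightarrow> (0::ennreal)) at_top" "(G \<longlongrightarrow> 0) at_top"
    and "\<And>R::real. H R \<le> 2 * F R + 2 * G R"
  shows "(H \<longlongrightarrow> 0) at_top"
proof (rule tendsto_sandwich[of "\<lambda>_. 0" _ _ "\<lambda>R. 2 * F R + 2 * G R"])
  have "((\<lambda>R. 2 * F R + 2 * G R) \<longlongrightarrow> 2 * 0 + 2 * 0) at_top"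
    by (intro tendsto_add ennreal_tendsto_cmult assms(1,2)) auto
  then show "((\<lambda>R. 2 * F R + 2 * G R) \<longlongrightarrow> 0) at_top" by simp
qed (use assms(3) in auto)

lemma has_fourier_add:
  assumes "has_fourier f g" "has_fourier f' g'"
  shows "has_fourier (f + f') (g + g')"
  unfolding has_fourier_def
proof (rule has_fourier_tendsto_0I[OF assms[unfolded has_fourier_def]], rule nn_integral_sq_add_le)
  fix R
  show "AE \<xi> in lborel. fourier_integral (cutoff R (f + f')) \<xi> - rep_l2 (g + g') \<xi> =
      (fourier_integral (cutoff R f) \<xi> - rep_l2 g \<xi>) +
      (fourier_integral (cutoff R f') \<xi> - rep_l2 g' \<xi>)"
    using rep_l2_add[of g g'] by (rule eventually_mono) (simp add: fourier_cutoff_add)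
qed (intro borel_measurable_diff fourier_cutoff_measurable rep_l2_measurable)+

lemma has_fourier_scaleR:
  assumes "has_fourier f g"
  shows "has_fourier (c *\<^sub>R f) (c *\<^sub>R g)"
proof -
  have [measurable]: "fourier_integral (cutoff R f) \<in> borel_measurable lborel" for R
    by (rule fourier_cutoff_measurable)
  have "(\<integral>\<^sup>+\<xi>. ennreal ((cmod (fourier_integral (cutoff R (c *\<^sub>R f)) \<xi> - rep_l2 (c *\<^sub>R g) \<xi>))\<^sup>2) \<partial>lborel)
     = ennreal (c\<^sup>2) *
       (\<integral>\<^sup>+\<xi>. ennreal ((cmod (fourier_integral (cutoff R f) \<xi> - rep_l2 g \<xi>))\<^sup>2) \<partial>lborel)" for R
  proof -
    have "(\<integral>\<^sup>+\<xi>. ennreal ((cmod (fourier_integral (cutoff R (c *\<^sub>R f)) \<xi> - rep_l2 (c *\<^sub>R g) \<xi>))\<^sup>2) \<partial>lborel)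
       = (\<integral>\<^sup>+\<xi>. ennreal (c\<^sup>2) * ennreal ((cmod (fourier_integral (cutoff R f) \<xi> - rep_l2 g \<xi>))\<^sup>2) \<partial>lborel)"
    proof (rule nn_integral_cong_AE, use rep_l2_scaleR[of c g] in \<open>rule eventually_mono\<close>)
      fix \<xi> assume *: "rep_l2 (c *\<^sub>R g) \<xi> = complex_of_real c * rep_l2 g \<xi>"
      have "fourier_integral (cutoff R (c *\<^sub>R f)) \<xi> - rep_l2 (c *\<^sub>R g) \<xi> =
          complex_of_real c * (fourier_integral (cutoff R f) \<xi> - rep_l2 g \<xi>)"
        by (simp add: * fourier_cutoff_scaleR algebra_simps)
      then show "ennreal ((cmod (fourier_integral (cutoff R (c *\<^sub>R f)) \<xi> - rep_l2 (c *\<^sub>R g) \<xi>))\<^sup>2)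
        = ennreal (c\<^sup>2) * ennreal ((cmod (fourier_integral (cutoff R f) \<xi> - rep_l2 g \<xi>))\<^sup>2)"
        by (simp add: norm_mult power_mult_distrib ennreal_mult)
    qed
    then show ?thesis by (simp add: nn_integral_cmult)
  qed
  moreover have "((\<lambda>R. ennreal (c\<^sup>2) *
      (\<integral>\<^sup>+\<xi>. ennreal ((cmod (fourier_integral (cutoff R f) \<xi> - rep_l2 g \<xi>))\<^sup>2) \<partial>lborel))
      \<longlongrightarrow> ennreal (c\<^sup>2) * 0) at_top"
    using assms unfolding has_fourier_def by (intro ennreal_tendsto_cmult) auto
  ultimately show ?thesis unfolding has_fourier_def by simp
qed

lemma has_fourier_unique:
  assumes "has_fourier f g" "has_fourier f h"
  shows "g = h"
proof (rule l2_eqI)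
  have [measurable]: "fourier_integral (cutoff R f) \<in> borel_measurable lborel" for R
    by (rule fourier_cutoff_measurable)
  let ?I = "\<integral>\<^sup>+\<xi>. ennreal ((cmod (rep_l2 g \<xi> - rep_l2 h \<xi>))\<^sup>2) \<partial>lborel"
  have "((\<lambda>R::real. ?I) \<longlongrightarrow> 0) at_top"
  proof (rule has_fourier_tendsto_0I[OF assms[unfolded has_fourier_def]])
    fix R
    have "?I \<le> 2 * (\<integral>\<^sup>+\<xi>. ennreal ((cmod (- (fourier_integral (cutoff R f) \<xi> - rep_l2 g \<xi>)))\<^sup>2) \<partial>lborel) +
        2 * (\<integral>\<^sup>+\<xi>. ennreal ((cmod (fourier_integral (cutoff R f) \<xi> - rep_l2 h \<xi>))\<^sup>2) \<partial>lborel)"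
      by (rule nn_integral_sq_add_le) auto
    then show "?I \<le> 2 * (\<integral>\<^sup>+\<xi>. ennreal ((cmod (fourier_integral (cutoff R f) \<xi> - rep_l2 g \<xi>))\<^sup>2) \<partial>lborel) +
        2 * (\<integral>\<^sup>+\<xi>. ennreal ((cmod (fourier_integral (cutoff R f) \<xi> - rep_l2 h \<xi>))\<^sup>2) \<partial>lborel)"
      by (simp only: norm_minus_cancel)
  qed
  then have "?I = 0" by (simp add: tendsto_const_iff)
  then show "AE \<xi> in lborel. rep_l2 g \<xi> = rep_l2 h \<xi>"
    by (simp add: nn_integral_0_iff_AE)
qed

lemma fourier_eqI: "has_fourier f g \<Longrightarrow> fourier f = g"
  unfolding fourier_def by (blast intro: the_equality has_fourier_unique)

lemma has_fourier_0: "has_fourier 0 0"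
proof -
  have z: "AE x in lborel. rep_l2 (0::l2) x = 0"
    using rep_l2_of[OF square_integrable_0] by (simp add: l2_of_def square_integrable_0 zero_l2_def)
  have "fourier_integral (cutoff R 0) \<xi> = 0" for R \<xi>
  proof -
    have "(LINT x|lborel. exp (- \<i> * complex_of_real (\<xi> \<bullet> x)) * cutoff R 0 x) = 0"
      using z by (intro integral_eq_zero_AE) (auto simp: cutoff_def elim: eventually_mono)
    then show ?thesis by (simp add: fourier_integral_def)
  qed
  moreover have "(\<integral>\<^sup>+\<xi>. ennreal ((cmod (0 - rep_l2 (0::l2) \<xi>))\<^sup>2) \<partial>lborel) = 0"
    using z by (subst nn_integral_0_iff_AE) (auto elim: eventually_mono)
  ultimately show ?thesis by (simp add: has_fourier_def)
qed


section \<open>The Sobolev space \<open>H\<^sup>1(\<real>\<^sup>2; \<complex>)\<close>\<close>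

definition h1_set :: "l2 set" where
  "h1_set = {f. \<exists>g. has_fourier f g \<and>
     square_integrable (\<lambda>\<xi>. complex_of_real (norm \<xi>) * rep_l2 g \<xi>)}"

lemma square_integrable_cong_AE:
  assumes "square_integrable f" "g \<in> borel_measurable lborel" "AE x in lborel. g x = f x"
  shows "square_integrable g"
proof -
  have "integrable lborel (\<lambda>x. (cmod (g x))\<^sup>2) \<longleftrightarrow> integrable lborel (\<lambda>x. (cmod (f x))\<^sup>2)"
    using assms by (intro integrable_cong_AE) (auto simp: square_integrable_def elim: eventually_mono)
  then show ?thesis using assms by (auto simp: square_integrable_def)
qed

lemma weighted_measurable:
  "(\<lambda>\<xi>. complex_of_real (norm \<xi>) * rep_l2 g \<xi>) \<in> borel_measurable lborel"
  by measurable

lemma weighted_add: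
  assumes "square_integrable (\<lambda>\<xi>. complex_of_real (norm \<xi>) * rep_l2 g \<xi>)"
    "square_integrable (\<lambda>\<xi>. complex_of_real (norm \<xi>) * rep_l2 h \<xi>)"
  shows "square_integrable (\<lambda>\<xi>. complex_of_real (norm \<xi>) * rep_l2 (g + h) \<xi>)"
    and "l2_of (\<lambda>\<xi>. complex_of_real (norm \<xi>) * rep_l2 (g + h) \<xi>) =
      l2_of (\<lambda>\<xi>. complex_of_real (norm \<xi>) * rep_l2 g \<xi>) +
      l2_of (\<lambda>\<xi>. complex_of_real (norm \<xi>) * rep_l2 h \<xi>)"
proof -
  note sq = square_integrable_add[OF assms]
  have ae: "AE \<xi> in lborel. complex_of_real (norm \<xi>) * rep_l2 (g + h) \<xi> =
      complex_of_real (norm \<xi>) * rep_l2 g \<xi> + complex_of_real (norm \<xi>) * rep_l2 h \<xi>"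
    using rep_l2_add[of g h] by (rule eventually_mono) (simp add: algebra_simps)
  show 1: "square_integrable (\<lambda>\<xi>. complex_of_real (norm \<xi>) * rep_l2 (g + h) \<xi>)"
    by (rule square_integrable_cong_AE[OF sq weighted_measurable ae])
  show "l2_of (\<lambda>\<xi>. complex_of_real (norm \<xi>) * rep_l2 (g + h) \<xi>) =
      l2_of (\<lambda>\<xi>. complex_of_real (norm \<xi>) * rep_l2 g \<xi>) +
      l2_of (\<lambda>\<xi>. complex_of_real (norm \<xi>) * rep_l2 h \<xi>)"
    using l2_of_eqI[OF 1 sq ae] l2_of_add[OF assms] by simp
qed

lemma weighted_scaleR:
  assumes "square_integrable (\<lambda>\<xi>. complex_of_real (norm \<xi>) * rep_l2 g \<xi>)"
  shows "square_integrable (\<lambda>\<xi>. complex_of_real (norm \<xi>) * rep_l2 (c *\<^sub>R g) \<xi>)"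
    and "l2_of (\<lambda>\<xi>. complex_of_real (norm \<xi>) * rep_l2 (c *\<^sub>R g) \<xi>) =
      c *\<^sub>R l2_of (\<lambda>\<xi>. complex_of_real (norm \<xi>) * rep_l2 g \<xi>)"
proof -
  note sq = square_integrable_cmult[OF assms, of "complex_of_real c"]
  have ae: "AE \<xi> in lborel. complex_of_real (norm \<xi>) * rep_l2 (c *\<^sub>R g) \<xi> =
      complex_of_real c * (complex_of_real (norm \<xi>) * rep_l2 g \<xi>)"
    using rep_l2_scaleR[of c g] by (rule eventually_mono) (simp add: algebra_simps)
  show 1: "square_integrable (\<lambda>\<xi>. complex_of_real (norm \<xi>) * rep_l2 (c *\<^sub>R g) \<xi>)"
    by (rule square_integrable_cong_AE[OF sq weighted_measurable ae])
  show "l2_of (\<lambda>\<xi>. complex_of_real (norm \<xi>) * rep_l2 (c *\<^sub>R g) \<xi>) =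
      c *\<^sub>R l2_of (\<lambda>\<xi>. complex_of_real (norm \<xi>) * rep_l2 g \<xi>)"
    using l2_of_eqI[OF 1 sq ae] l2_of_scaleR[OF assms] by simp
qed

lemma zero_in_h1_set: "0 \<in> h1_set"
proof -
  have z: "AE x in lborel. rep_l2 (0::l2) x = 0"
    using rep_l2_of[OF square_integrable_0] by (simp add: l2_of_def square_integrable_0 zero_l2_def)
  have "square_integrable (\<lambda>\<xi>. complex_of_real (norm \<xi>) * rep_l2 0 \<xi>)"
    by (rule square_integrable_cong_AE[OF square_integrable_0 weighted_measurable])
      (use z in \<open>auto elim: eventually_mono\<close>)
  with has_fourier_0 show ?thesis by (auto simp: h1_set_def)
qed

lemma add_in_h1_set: "f \<in> h1_set \<Longrightarrow> g \<in> h1_set \<Longrightarrow> f + g \<in> h1_set"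
  unfolding h1_set_def using has_fourier_add weighted_add(1) by blast

lemma scaleR_in_h1_set: "f \<in> h1_set \<Longrightarrow> c *\<^sub>R f \<in> h1_set"
  unfolding h1_set_def using has_fourier_scaleR weighted_scaleR(1) by blast

typedef h1 = h1_set morphisms l2_of_h1 h1_of_l2
  using zero_in_h1_set by blast

setup_lifting type_definition_h1

text \<open>
  The transform of \<open>(-\<Delta>)\<^sup>1\<^sup>/\<^sup>2u\<close>; by Plancherel its \<open>L\<^sup>2\<close> norm is that of \<open>\<nabla>u\<close>. Hence the norm
  on \<^typ>\<open>h1\<close> introduced below is the usual \<open>(\<parallel>u\<parallel>\<^sup>2 + \<parallel>\<nabla>u\<parallel>\<^sup>2)\<^sup>1\<^sup>/\<^sup>2\<close>, equal to the \<open>L\<^sup>2\<close> norm of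
  \<open>(1 + |\<xi>|\<^sup>2)\<^sup>1\<^sup>/\<^sup>2\<close> times the transform of \<open>u\<close>.
\<close>

definition abs_grad :: "l2 \<Rightarrow> l2" where
  "abs_grad f = l2_of (\<lambda>\<xi>. complex_of_real (norm \<xi>) * rep_l2 (fourier f) \<xi>)"

lemma abs_grad_add: "f \<in> h1_set \<Longrightarrow> g \<in> h1_set \<Longrightarrow> abs_grad (f + g) = abs_grad f + abs_grad g"
  unfolding h1_set_def abs_grad_def
  by (auto simp: fourier_eqI fourier_eqI[OF has_fourier_add] weighted_add(2))

lemma abs_grad_scaleR: "f \<in> h1_set \<Longrightarrow> abs_grad (c *\<^sub>R f) = c *\<^sub>R abs_grad f"
  unfolding h1_set_def abs_grad_def
  by (auto simp: fourier_eqI fourier_eqI[OF has_fourier_scaleR] weighted_scaleR(2))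

instantiation h1 :: real_inner
begin

lift_definition zero_h1 :: h1 is 0 by (rule zero_in_h1_set)

lift_definition plus_h1 :: "h1 \<Rightarrow> h1 \<Rightarrow> h1" is "(+)" by (rule add_in_h1_set)

lift_definition scaleR_h1 :: "real \<Rightarrow> h1 \<Rightarrow> h1" is "(*\<^sub>R)" by (rule scaleR_in_h1_set)

definition uminus_h1 :: "h1 \<Rightarrow> h1" where "uminus_h1 f = (-1) *\<^sub>R f"

definition minus_h1 :: "h1 \<Rightarrow> h1 \<Rightarrow> h1" where "minus_h1 f g = f + - g"

lift_definition inner_h1 :: "h1 \<Rightarrow> h1 \<Rightarrow> real" is "\<lambda>f g. f \<bullet> g + abs_grad f \<bullet> abs_grad g" .

lift_definition norm_h1 :: "h1 \<Rightarrow> real" is "\<lambda>f. sqrt ((norm f)\<^sup>2 + (norm (abs_grad f))\<^sup>2)" .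

definition dist_h1 :: "h1 \<Rightarrow> h1 \<Rightarrow> real" where "dist_h1 f g = norm (f - g)"

definition sgn_h1 :: "h1 \<Rightarrow> h1" where "sgn_h1 f = inverse (norm f) *\<^sub>R f"

definition uniformity_h1 :: "(h1 \<times> h1) filter" where
  "uniformity_h1 = (INF e\<in>{0<..}. principal {(f, g). dist f g < e})"

definition open_h1 :: "h1 set \<Rightarrow> bool" where
  "open_h1 U \<longleftrightarrow> (\<forall>f\<in>U. \<forall>\<^sub>F (f', g) in uniformity. f' = f \<longrightarrow> g \<in> U)"

instance
proof
  fix f g h :: h1 and a b :: real and U :: "h1 set"
  show "f + g + h = f + (g + h)" by transfer (simp add: add.assoc)
  show "f + g = g + f" by transfer (simp add: add.commute)
  show "0 + f = f" by transfer simp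
  show "- f + f = 0" unfolding uminus_h1_def by transfer simp
  show "f - g = f + - g" by (simp add: minus_h1_def)
  show "a *\<^sub>R (f + g) = a *\<^sub>R f + a *\<^sub>R g" by transfer (simp add: scaleR_add_right)
  show "(a + b) *\<^sub>R f = a *\<^sub>R f + b *\<^sub>R f" by transfer (simp add: scaleR_add_left)
  show "a *\<^sub>R b *\<^sub>R f = (a * b) *\<^sub>R f" by transfer simp
  show "1 *\<^sub>R f = f" by transfer simp
  show "dist f g = norm (f - g)" by (simp add: dist_h1_def)
  show "sgn f = inverse (norm f) *\<^sub>R f" by (simp add: sgn_h1_def)
  show "uniformity = (INF e\<in>{0<..}. principal {(f, g :: h1). dist f g < e})"
    by (simp add: uniformity_h1_def)
  show "open U \<longleftrightarrow> (\<forall>f\<in>U. \<forall>\<^sub>F (f', g) in uniformity. f' = f \<longrightarrow> g \<in> U)"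
    by (simp add: open_h1_def)
  show "f \<bullet> g = g \<bullet> f" by transfer (simp add: inner_commute)
  show "(f + g) \<bullet> h = f \<bullet> h + g \<bullet> h"
    by transfer (simp add: abs_grad_add inner_add_left)
  show "(a *\<^sub>R f) \<bullet> g = a * (f \<bullet> g)"
    by transfer (simp add: abs_grad_scaleR algebra_simps)
  show "0 \<le> f \<bullet> f" by transfer simp
  have "abs_grad 0 = 0"
    using abs_grad_scaleR[OF zero_in_h1_set, of 0] by simp
  then show "f \<bullet> f = 0 \<longleftrightarrow> f = 0"
    by transfer (auto simp: add_nonneg_eq_0_iff)
  show "norm f = sqrt (f \<bullet> f)" by transfer (simp add: power2_norm_eq_inner)
qed

end


section \<open>The equation\<close>

text \<open>Symbol of \<open>P\<^sub>\<epsilon>\<^sup>s\<close>, where \<open>P\<^sub>\<epsilon> = 1 - \<epsilon>\<^sup>2\<Delta>\<close>.\<close>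

definition P_symbol :: "real \<Rightarrow> real \<Rightarrow> real^2 \<Rightarrow> complex" where
  "P_symbol \<epsilon> s \<xi> = complex_of_real ((1 + \<epsilon>\<^sup>2 * (norm \<xi>)\<^sup>2) powr s)"

definition propagator :: "real \<Rightarrow> real \<Rightarrow> l2 \<Rightarrow> l2" where
  "propagator \<epsilon> t = fourier_multiplier
     (\<lambda>\<xi>. exp (- \<i> * complex_of_real (t * (norm \<xi>)\<^sup>2 / (1 + \<epsilon>\<^sup>2 * (norm \<xi>)\<^sup>2))))"

text \<open>
  \<open>P\<^sub>\<epsilon>\<^sup>-\<^sup>1(1 + i \<delta>\<cdot>\<nabla>)\<close> is treated as a single multiplier, bounded on \<open>L\<^sup>2\<close>; the operator \<open>\<nabla>\<close> has
  symbol \<open>i\<xi>\<close>.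
\<close>

definition forcing :: "real \<Rightarrow> real^2 \<Rightarrow> l2 \<Rightarrow> l2" where
  "forcing \<epsilon> \<delta> = fourier_multiplier
     (\<lambda>\<xi>. P_symbol \<epsilon> (-1) \<xi> * (1 + \<i> * (\<i> * complex_of_real (\<delta> \<bullet> \<xi>))))"

text \<open>
  The function \<open>|u|\<^sup>2\<^sup>\<sigma>u\<close> is in \<open>L\<^sup>2\<close> for every \<open>u\<close> in \<open>H\<^sup>1\<close> and \<open>\<sigma> \<ge> 0\<close>, because \<open>H\<^sup>1(\<real>\<^sup>2)\<close>
  embeds into \<open>L\<^sup>p\<close> for \<open>2 \<le> p < \<infinity>\<close>.
\<close>

definition nonlinearity :: "real \<Rightarrow> h1 \<Rightarrow> l2" where
  "nonlinearity \<sigma> u = l2_of (\<lambda>x. complex_of_real (cmod (rep_l2 (l2_of_h1 u) x) powr (2 * \<sigma>)) *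
     rep_l2 (l2_of_h1 u) x)"

definition has_oriented_integral ::
  "(real \<Rightarrow> 'a::real_normed_vector) \<Rightarrow> 'a \<Rightarrow> real \<Rightarrow> real \<Rightarrow> bool" where
  "has_oriented_integral f I a b \<longleftrightarrow>
     (if a \<le> b then (f has_integral I) {a..b} else (f has_integral (- I)) {b..a})"

text \<open>
  Duhamel's formula is an identity in \<open>L\<^sup>2\<close>, with a vector-valued time integral. For \<open>u\<close> continuous
  into \<open>H\<^sup>1\<close> the integrand is continuous into \<open>H\<^sup>1\<close>, so the integral taken in \<open>H\<^sup>1\<close> is the same.
\<close>

definition global_solution ::
  "real \<Rightarrow> real \<Rightarrow> real^2 \<Rightarrow> h1 \<Rightarrow> (real \<Rightarrow> h1) \<Rightarrow> bool" where
  "global_solution \<epsilon> \<sigma> \<delta> u\<^sub>0 u \<longleftrightarrow>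
     continuous_on UNIV u \<and>
     (\<forall>t. \<exists>I. has_oriented_integral
              (\<lambda>s. propagator \<epsilon> (t - s) (forcing \<epsilon> \<delta> (nonlinearity \<sigma> (u s)))) I 0 t \<and>
            l2_of_h1 (u t) = propagator \<epsilon> t (l2_of_h1 u\<^sub>0) + scaleC_l2 \<i> I)"

definition solution_map :: "real \<Rightarrow> real \<Rightarrow> real^2 \<Rightarrow> h1 \<Rightarrow> real \<Rightarrow> h1" where
  "solution_map \<epsilon> \<sigma> \<delta> u\<^sub>0 = (THE u. global_solution \<epsilon> \<sigma> \<delta> u\<^sub>0 u)"

end

(*
  In the frequency variable g = (1 + |xi|^2)^(1/2) * (transform of u) the space H^1 becomes L^2 and the
  equation becomes an ordinary differential equation: the propagator is a strongly continuous unitary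
  group, and P^(-1) (1 + i delta . grad) applied to |u|^(2 sigma) u is a locally Lipschitz vector field,
  because the operator gains one derivative and H^1(R^2) embeds into L^4 and L^(8 sigma) (8 sigma > 2).

  The energy ||u||^2 + eps^2 ||grad u||^2 is conserved.  The only nontrivial contribution to its
  derivative is the pairing of delta . grad u with |u|^(2 sigma) u, which vanishes because the
  nonlinearity is the gradient of a convex function whose integral is translation invariant.  The
  energy remains conserved when the nonlinearity is composed with a radial truncation; the truncated
  field is globally Lipschitz, its flow exists globally by a single contraction, and conservation
  keeps the solution where the truncation is inactive.
*)

theory Submission
  imports Defs "HOL-Probability.Characteristic_Functions"
begin

section \<open>Completeness of \<open>L\<^sup>2\<close> and multiplication by bounded symbols\<close>

text \<open>Passing from \<open>h1\<close> to \<open>l2\<close> means that completeness is used only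
  for \<open>l2\<close>, and that every linear operator of the equation becomes multiplication by a
  bounded function. The transform is given only as a limit over cutoffs, so multipliers become
  accessible only after Plancherel's theorem and inversion. The propagator is removed by v(t) =
  S(-t) u(t): u solves Duhamel's formula exactly when v is differentiable with derivative S(-t)
  V(S(t) v(t)). Contraction, energy identity and uniqueness then concern ordinary differentiable
  curves. Truncation keeps the energy because the truncated point is a x with a > 0: the field at a
  x is orthogonal to W(a x) = a W x, hence to W x. The a priori bound depends only on the energy
  form and not on the truncation radius, so the radius can be chosen from the initial datum without
  circularity. That bound is the constant of the theorem: min 1 \<epsilon>^2 and max 1 \<epsilon>^2
  compare 1 + \<epsilon>^2 |\<xi>|^2 with 1 + |\<xi>|^2, and the root of the quotient max/min
  multiplies the norm of the datum.\<close>

lemma square_integrableI: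
  assumes "f \<in> borel_measurable lborel" "(\<integral>\<^sup>+x. ennreal ((cmod (f x))\<^sup>2) \<partial>lborel) < \<infinity>"
  shows "square_integrable f"
  using assms unfolding square_integrable_def by (auto intro!: integrableI_bounded)

lemma square_integrable_measurable: "square_integrable f \<Longrightarrow> f \<in> borel_measurable lborel"
  by (simp add: square_integrable_def)

lemma square_integrable_bound:
  assumes "square_integrable f" "g \<in> borel_measurable lborel" "AE x in lborel. cmod (g x) \<le> C * cmod (f x)"
  shows "square_integrable g"
  unfolding square_integrable_def
proof (rule conjI[OF assms(2)], rule Bochner_Integration.integrable_bound)
  show "integrable lborel (\<lambda>x. C\<^sup>2 * (cmod (f x))\<^sup>2)"
    using assms(1) by (auto simp: square_integrable_def)
  show "(\<lambda>x. (cmod (g x))\<^sup>2) \<in> borel_measurable lborel" using assms(2) by measurable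
  show "AE x in lborel. norm ((cmod (g x))\<^sup>2) \<le> norm (C\<^sup>2 * (cmod (f x))\<^sup>2)"
    using assms(3)
  proof eventually_elim
    case (elim x)
    then have "(cmod (g x))\<^sup>2 \<le> (C * cmod (f x))\<^sup>2" by (intro power_mono) auto
    then show ?case by (simp add: power_mult_distrib)
  qed
qed

lemma square_integrable_diff:
  assumes "square_integrable f" "square_integrable g"
  shows "square_integrable (\<lambda>x. f x - g x)"
  using square_integrable_add[OF assms(1) square_integrable_cmult[OF assms(2), of "-1"]] by simp

lemma norm_l2_sq: "(norm f)\<^sup>2 = (LINT x|lborel. (cmod (rep_l2 f x))\<^sup>2)"
  by (simp add: norm_l2_def)

lemma nn_norm_l2: "(\<integral>\<^sup>+x. ennreal ((cmod (rep_l2 f x))\<^sup>2) \<partial>lborel) = ennreal ((norm f)\<^sup>2)"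
  using square_integrable_rep_l2[of f] unfolding norm_l2_sq square_integrable_def
  by (intro nn_integral_eq_integral) auto

lemma inner_l2_rep: "f \<bullet> g = (LINT x|lborel. rep_l2 f x \<bullet> rep_l2 g x)"
  by (simp add: inner_l2_def)

lemma norm_l2_of_sq:
  assumes "square_integrable f"
  shows "(norm (l2_of f))\<^sup>2 = (LINT x|lborel. (cmod (f x))\<^sup>2)"
  unfolding norm_l2_sq
  by (rule integral_cong_AE) (use rep_l2_of[OF assms] assms in \<open>auto simp: square_integrable_def elim: eventually_mono\<close>)

lemma nn_norm_l2_of:
  assumes "square_integrable f"
  shows "(\<integral>\<^sup>+x. ennreal ((cmod (f x))\<^sup>2) \<partial>lborel) = ennreal ((norm (l2_of f))\<^sup>2)"
  using assms unfolding norm_l2_of_sq[OF assms] square_integrable_def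
  by (intro nn_integral_eq_integral) auto

lemma inner_l2_of:
  assumes "square_integrable f" "square_integrable g"
  shows "l2_of f \<bullet> l2_of g = (LINT x|lborel. f x \<bullet> g x)"
  unfolding inner_l2_rep
proof (rule integral_cong_AE)
  show "AE x in lborel. rep_l2 (l2_of f) x \<bullet> rep_l2 (l2_of g) x = f x \<bullet> g x"
    using rep_l2_of[OF assms(1)] rep_l2_of[OF assms(2)] by eventually_elim simp
  show "(\<lambda>x. f x \<bullet> g x) \<in> borel_measurable lborel"
    using assms by (auto simp: square_integrable_def)
qed auto

lemma rep_l2_uminus: "AE x in lborel. rep_l2 (- f) x = - rep_l2 f x"
  using rep_l2_scaleR[of "-1" f] by simp

lemma rep_l2_diff: "AE x in lborel. rep_l2 (f - g) x = rep_l2 f x - rep_l2 g x"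
  using rep_l2_add[of f "-g"] rep_l2_uminus[of g] by eventually_elim simp

lemma rep_l2_0: "AE x in lborel. rep_l2 0 x = 0"
  using rep_l2_scaleR[of 0 0] by simp

lemma l2_of_diff:
  assumes "square_integrable f" "square_integrable g"
  shows "l2_of (\<lambda>x. f x - g x) = l2_of f - l2_of g"
proof (rule l2_eqI)
  show "AE x in lborel. rep_l2 (l2_of (\<lambda>x. f x - g x)) x = rep_l2 (l2_of f - l2_of g) x"
    using rep_l2_of[OF assms(1)] rep_l2_of[OF assms(2)] rep_l2_of[OF square_integrable_diff[OF assms]]
      rep_l2_diff[of "l2_of f" "l2_of g"] by eventually_elim simp
qed

lemma nn_dist_l2:
  "(\<integral>\<^sup>+x. ennreal ((cmod (rep_l2 f x - rep_l2 g x))\<^sup>2) \<partial>lborel) = ennreal ((norm (f - g))\<^sup>2)"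
  unfolding nn_norm_l2[symmetric]
  by (rule nn_integral_cong_AE) (use rep_l2_diff[of f g] in \<open>auto elim: eventually_mono\<close>)

lemma l2_eq_l2_ofI:
  assumes "square_integrable g" "AE x in lborel. rep_l2 f x = g x"
  shows "f = l2_of g"
  using l2_of_eqI[OF square_integrable_rep_l2 assms] by (simp add: l2_of_rep_l2)

lemma norm_l2_le:
  assumes "AE x in lborel. cmod (rep_l2 f x) \<le> C * cmod (rep_l2 g x)" "C \<ge> 0"
  shows "norm f \<le> C * norm g"
proof -
  have "(LINT x|lborel. (cmod (rep_l2 f x))\<^sup>2) \<le> (LINT x|lborel. C\<^sup>2 * (cmod (rep_l2 g x))\<^sup>2)"
  proof (rule integral_mono_AE)
    show "AE x in lborel. (cmod (rep_l2 f x))\<^sup>2 \<le> C\<^sup>2 * (cmod (rep_l2 g x))\<^sup>2"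
      using assms(1) by eventually_elim (metis norm_ge_zero power_mono power_mult_distrib)
  qed (use square_integrable_rep_l2 in \<open>auto simp: square_integrable_def\<close>)
  then have "(norm f)\<^sup>2 \<le> (C * norm g)\<^sup>2" by (simp add: norm_l2_sq power_mult_distrib)
  then show ?thesis using assms(2) by (meson mult_nonneg_nonneg norm_ge_zero power2_le_imp_le)
qed

section \<open>Completeness of L^2\<close>

lemma Cauchy_l2_rates:
  fixes X :: "nat \<Rightarrow> l2"
  assumes "Cauchy X"
  obtains r where "\<And>k m n. m \<ge> r k \<Longrightarrow> n \<ge> r k \<Longrightarrow> norm (X m - X n) < (1/2)^k" "\<And>k. r k \<le> r (Suc k)"
proof -
  have "\<forall>k. \<exists>N. \<forall>m\<ge>N. \<forall>n\<ge>N. norm (X m - X n) < (1/2)^k"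
    using assms unfolding Cauchy_def dist_norm by simp
  then obtain N where N: "\<And>k m n. m \<ge> N k \<Longrightarrow> n \<ge> N k \<Longrightarrow> norm (X m - X n) < (1/2)^k"
    by metis
  \<comment> \<open>Summing the thresholds makes the index monotone in \<open>k\<close> while
    keeping it above \<open>N k\<close>.\<close>
  define r where "r k = (\<Sum>j\<le>k. N j)" for k
  have "N k \<le> r k" for k unfolding r_def by (rule member_le_sum) auto
  then show thesis by (intro that[of r]) (auto simp: r_def intro!: N intro: order_trans)
qed

text \<open>
  Along a subsequence with rates \<open>2\<^sup>-\<^sup>k\<close> the sum \<open>\<Sum>\<^sub>k 2\<^sup>k |f\<^sub>k\<^sub>+\<^sub>1 - f\<^sub>k|\<^sup>2\<close> has finite integral, which
  forces pointwise convergence almost everywhere; Fatou's lemma identifies the limit.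
\<close>

lemma Cauchy_l2_convergent:
  fixes X :: "nat \<Rightarrow> l2"
  assumes "Cauchy X"
  shows "convergent X"
proof -
  obtain r where r: "\<And>k m n. m \<ge> r k \<Longrightarrow> n \<ge> r k \<Longrightarrow> norm (X m - X n) < (1/2)^k"
    and rm: "\<And>k. r k \<le> r (Suc k)"
    using Cauchy_l2_rates[OF assms] by blast
  have rmono: "i \<le> j \<Longrightarrow> r i \<le> r j" for i j using rm lift_Suc_mono_le by blast
  define f where "f k = rep_l2 (X (r k))" for k
  have [measurable]: "f k \<in> borel_measurable lborel" for k by (simp add: f_def)
  have "(\<integral>\<^sup>+x. (\<Sum>k. ennreal (2^k * (cmod (f (Suc k) x - f k x))\<^sup>2)) \<partial>lborel)
    = (\<Sum>k. \<integral>\<^sup>+x. ennreal (2^k * (cmod (f (Suc k) x - f k x))\<^sup>2) \<partial>lborel)"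
    by (rule nn_integral_suminf) measurable
  also have "\<dots> \<le> (\<Sum>k. ennreal ((1/2)^k))"
  proof (rule suminf_le)
    fix k
    have "(\<integral>\<^sup>+x. ennreal (2^k * (cmod (f (Suc k) x - f k x))\<^sup>2) \<partial>lborel)
        = ennreal (2^k) * ennreal ((norm (X (r (Suc k)) - X (r k)))\<^sup>2)"
      by (simp add: f_def nn_dist_l2[symmetric] ennreal_mult nn_integral_cmult)
    also have "\<dots> = ennreal (2^k * (norm (X (r (Suc k)) - X (r k)))\<^sup>2)" by (simp add: ennreal_mult)
    also have "\<dots> \<le> ennreal (2^k * ((1/2)^k)\<^sup>2)"
      using r[of k "r (Suc k)" "r k"] rm[of k] by (intro ennreal_leI mult_left_mono power_mono) auto
    also have "2^k * ((1/2::real)^k)\<^sup>2 = (1/2)^k" by (simp add: power2_eq_square power_one_over)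
    finally show "(\<integral>\<^sup>+x. ennreal (2^k * (cmod (f (Suc k) x - f k x))\<^sup>2) \<partial>lborel) \<le> ennreal ((1/2)^k)" .
  qed auto
  also have "\<dots> = ennreal (\<Sum>k. (1/2)^k)"
    by (rule suminf_ennreal2) (auto intro!: summable_geometric)
  also have "\<dots> < \<infinity>" by (rule ennreal_less_top[unfolded infinity_ennreal_def[symmetric]])
  finally have "AE x in lborel. (\<Sum>k. ennreal (2^k * (cmod (f (Suc k) x - f k x))\<^sup>2)) \<noteq> \<infinity>"
    by (intro nn_integral_PInf_AE) auto
  then have conv: "AE x in lborel. convergent (\<lambda>k. f k x)"
  proof eventually_elim
    case (elim x)
    have s: "summable (\<lambda>k. 2^k * (cmod (f (Suc k) x - f k x))\<^sup>2)"
      using elim by (intro summable_suminf_not_top) auto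
    then have "(\<lambda>k. 2^k * (cmod (f (Suc k) x - f k x))\<^sup>2) \<longlonglongrightarrow> 0" by (rule summable_LIMSEQ_zero)
    then have "Bseq (\<lambda>k. 2^k * (cmod (f (Suc k) x - f k x))\<^sup>2)" by (intro convergent_imp_Bseq convergentI)
    then obtain K where K: "K > 0" "\<And>k. norm (2^k * (cmod (f (Suc k) x - f k x))\<^sup>2) \<le> K"
      unfolding Bseq_def by auto
    \<comment> \<open>Boundedness of \<open>2^k\<close> times the squared increments already gives
      increments of geometric size, with ratio \<open>1 / sqrt 2 < 1\<close>.\<close>
    have le: "cmod (f (Suc k) x - f k x) \<le> sqrt K * (1 / sqrt 2)^k" for k
    proof -
      have "(cmod (f (Suc k) x - f k x))\<^sup>2 \<le> K * (1/2)^k"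
        using K(2)[of k] by (simp add: field_simps power_one_over)
      also have "\<dots> = (sqrt K * (1 / sqrt 2)^k)\<^sup>2"
      proof -
        have "((1 / sqrt 2)^k)\<^sup>2 = ((1 / sqrt 2)\<^sup>2)^k" by (metis power_mult mult.commute)
        also have "(1 / sqrt 2)\<^sup>2 = (1/2::real)" by (simp add: power_divide)
        finally show ?thesis using K(1) by (simp add: power_mult_distrib)
      qed
      finally show ?thesis by (rule power2_le_imp_le) (use K(1) in \<open>intro mult_nonneg_nonneg zero_le_power; simp\<close>)
    qed
    have "summable (\<lambda>k. f (Suc k) x - f k x)"
    proof (rule summable_comparison_test')
      show "summable (\<lambda>k. sqrt K * (1 / sqrt 2)^k)"
        by (intro summable_mult summable_geometric) (simp add: real_less_rsqrt)
    qed (rule le)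
    then have "convergent (\<lambda>n. \<Sum>k<n. f (Suc k) x - f k x)" by (simp add: summable_iff_convergent)
    then have "convergent (\<lambda>n. f n x - f 0 x)"
      unfolding sum_lessThan_telescope[of "\<lambda>k. f k x"] .
    then show ?case by (simp add: convergent_diff_const_right_iff)
  qed
  define g where "g x = lim (\<lambda>k. f k x)" for x
  have [measurable]: "g \<in> borel_measurable lborel" unfolding g_def by measurable
  have lim: "AE x in lborel. (\<lambda>k. f k x) \<longlonglongrightarrow> g x"
    using conv unfolding g_def by eventually_elim (simp add: convergent_LIMSEQ_iff)
  have bd: "(\<integral>\<^sup>+x. ennreal ((cmod (g x - f k x))\<^sup>2) \<partial>lborel) \<le> ennreal (((1/2)^k)\<^sup>2)" for k
  proof -
    have "(\<integral>\<^sup>+x. ennreal ((cmod (g x - f k x))\<^sup>2) \<partial>lborel)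
       = (\<integral>\<^sup>+x. liminf (\<lambda>j. ennreal ((cmod (f j x - f k x))\<^sup>2)) \<partial>lborel)"
    proof (rule nn_integral_cong_AE)
      show "AE x in lborel. ennreal ((cmod (g x - f k x))\<^sup>2) = liminf (\<lambda>j. ennreal ((cmod (f j x - f k x))\<^sup>2))"
        using lim by eventually_elim
          (intro lim_imp_Liminf[symmetric] tendsto_ennrealI tendsto_power tendsto_norm tendsto_diff, auto)
    qed
    also have "\<dots> \<le> liminf (\<lambda>j. \<integral>\<^sup>+x. ennreal ((cmod (f j x - f k x))\<^sup>2) \<partial>lborel)"
      by (rule nn_integral_liminf) measurable
    also have "\<dots> \<le> limsup (\<lambda>j. \<integral>\<^sup>+x. ennreal ((cmod (f j x - f k x))\<^sup>2) \<partial>lborel)"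
      by (intro Liminf_le_Limsup) auto
    also have "\<dots> \<le> ennreal (((1/2)^k)\<^sup>2)"
    proof (rule Limsup_bounded)
      show "\<forall>\<^sub>F j in sequentially. (\<integral>\<^sup>+x. ennreal ((cmod (f j x - f k x))\<^sup>2) \<partial>lborel) \<le> ennreal (((1/2)^k)\<^sup>2)"
        using eventually_ge_at_top[of k]
      proof eventually_elim
        case (elim j)
        show ?case unfolding f_def nn_dist_l2
          using r[of k "r j" "r k"] rmono[OF elim] by (intro ennreal_leI power_mono) auto
      qed
    qed
    finally show ?thesis .
  qed
  have sqd: "square_integrable (\<lambda>x. g x - f k x)" for k
    by (rule square_integrableI) (auto intro!: le_less_trans[OF bd[of k]])
  \<comment> \<open>Fatou controls only the differences \<open>g - f k\<close>; adding
    \<open>f 0\<close> back gives \<open>g\<close> itself.\<close>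
  have sqg: "square_integrable g"
    using square_integrable_add[OF sqd[of 0], of "f 0"] by (simp add: f_def square_integrable_rep_l2)
  have "norm (l2_of g - X (r k)) \<le> (1/2)^k" for k
  proof -
    have "ennreal ((norm (l2_of g - X (r k)))\<^sup>2) \<le> ennreal (((1/2)^k)\<^sup>2)"
      using bd[of k] nn_norm_l2_of[OF sqd[of k]] l2_of_diff[OF sqg square_integrable_rep_l2, of "X (r k)"]
      by (simp add: f_def l2_of_rep_l2)
    then have "(norm (l2_of g - X (r k)))\<^sup>2 \<le> ((1/2)^k)\<^sup>2" by (subst (asm) ennreal_le_iff) auto
    then show ?thesis by (rule power2_le_imp_le) simp
  qed
  note nb = this
  have "X \<longlonglongrightarrow> l2_of g"
  proof (rule LIMSEQ_I)
    fix e :: real assume "e > 0"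
    then obtain k where k: "(1/2)^k < e/2"
      using real_arch_pow_inv[of "e/2" "1/2"] by auto
    show "\<exists>N. \<forall>n\<ge>N. norm (X n - l2_of g) < e"
    proof (intro exI allI impI)
      fix n assume "n \<ge> r k"
      then have "norm (X n - X (r k)) < (1/2)^k" using r[of k n "r k"] by simp
      moreover have "norm (X n - l2_of g) \<le> norm (X n - X (r k)) + norm (l2_of g - X (r k))"
        by (metis norm_minus_commute norm_triangle_ineq diff_add_cancel add_diff_eq)
      ultimately show "norm (X n - l2_of g) < e" using nb[of k] k by linarith
    qed
  qed
  then show ?thesis by (rule convergentI)
qed

instance l2 :: complete_space
  by standard (rule Cauchy_l2_convergent)

instance l2 :: banach ..

section \<open>Limits in L^2 and pointwise limits\<close>

lemma l2_tendstoI: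
  assumes "square_integrable f" "\<And>n. square_integrable (F n)"
    and "(\<lambda>n. \<integral>\<^sup>+x. ennreal ((cmod (F n x - f x))\<^sup>2) \<partial>lborel) \<longlonglongrightarrow> 0"
  shows "(\<lambda>n. l2_of (F n)) \<longlonglongrightarrow> l2_of f"
proof -
  have "(\<lambda>n. ennreal ((norm (l2_of (F n) - l2_of f))\<^sup>2)) \<longlonglongrightarrow> ennreal 0"
    using assms(3) by (simp add: nn_norm_l2_of[OF square_integrable_diff] assms(1,2) l2_of_diff)
  then have "(\<lambda>n. (norm (l2_of (F n) - l2_of f))\<^sup>2) \<longlonglongrightarrow> 0"
    by (subst (asm) tendsto_ennreal_iff) auto
  then have "(\<lambda>n. sqrt ((norm (l2_of (F n) - l2_of f))\<^sup>2)) \<longlonglongrightarrow> sqrt 0" by (rule tendsto_real_sqrt)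
  then show ?thesis by (simp add: tendsto_norm_zero_iff LIM_zero_iff)
qed

lemma l2_dominated:
  assumes [measurable]: "\<And>n. F n \<in> borel_measurable lborel" and f: "square_integrable f"
    and w: "square_integrable w"
    and lim: "AE x in lborel. (\<lambda>n. F n x) \<longlonglongrightarrow> f x"
    and bound: "\<And>n. AE x in lborel. cmod (F n x) \<le> cmod (w x)"
  shows "(\<lambda>n. l2_of (F n)) \<longlonglongrightarrow> l2_of f"
proof (rule l2_tendstoI[OF f])
  have [measurable]: "f \<in> borel_measurable lborel" "w \<in> borel_measurable lborel"
    using f w by (auto simp: square_integrable_def)
  show "square_integrable (F n)" for n
    by (rule square_integrable_bound[OF w, where C=1]) (use bound[of n] in auto)
  have "(\<lambda>n. \<integral>\<^sup>+x. ennreal ((cmod (F n x - f x))\<^sup>2) \<partial>lborel) \<longlonglongrightarrow> (\<integral>\<^sup>+(x::real^2). ennreal 0 \<partial>lborel)"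
  proof (rule nn_integral_dominated_convergence[where w="\<lambda>x. ennreal (2 * (cmod (w x))\<^sup>2 + 2 * (cmod (f x))\<^sup>2)"])
    show "AE x in lborel. ennreal ((cmod (F n x - f x))\<^sup>2) \<le> ennreal (2 * (cmod (w x))\<^sup>2 + 2 * (cmod (f x))\<^sup>2)" for n
      using bound[of n]
    proof eventually_elim
      case (elim x)
      have "(cmod (F n x - f x))\<^sup>2 \<le> 2 * (cmod (F n x))\<^sup>2 + 2 * (cmod (f x))\<^sup>2"
        using cmod_add_sq_le[of "F n x" "- f x"] by simp
      moreover have "(cmod (F n x))\<^sup>2 \<le> (cmod (w x))\<^sup>2" using elim by (intro power_mono) auto
      ultimately show ?case by (intro ennreal_leI) linarith
    qed
    show "(\<integral>\<^sup>+x. ennreal (2 * (cmod (w x))\<^sup>2 + 2 * (cmod (f x))\<^sup>2) \<partial>lborel) < \<infinity>"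
      using f w unfolding square_integrable_def
      by (subst nn_integral_eq_integral) auto
    show "AE x in lborel. (\<lambda>n. ennreal ((cmod (F n x - f x))\<^sup>2)) \<longlonglongrightarrow> ennreal 0"
      using lim
    proof eventually_elim
      case (elim x)
      have "(\<lambda>n. (cmod (F n x - f x))\<^sup>2) \<longlonglongrightarrow> (cmod (f x - f x))\<^sup>2"
        by (intro tendsto_intros elim)
      then show ?case by (intro tendsto_ennrealI) simp
    qed
  qed measurable
  then show "(\<lambda>n. \<integral>\<^sup>+x. ennreal ((cmod (F n x - f x))\<^sup>2) \<partial>lborel) \<longlonglongrightarrow> 0" by simp
qed

text \<open>No subsequence has to be extracted: by Fatou the pointwise liminf of |F n - g|^2 has
  integral 0, and pointwise convergence identifies this liminf with |f - g|^2.\<close>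

lemma l2_tendsto_AE_unique:
  assumes "(\<lambda>n. l2_of (F n)) \<longlonglongrightarrow> g" "\<And>n. square_integrable (F n)"
    and "AE x in lborel. (\<lambda>n. F n x) \<longlonglongrightarrow> f x"
  shows "AE x in lborel. rep_l2 g x = f x"
proof -
  have [measurable]: "F n \<in> borel_measurable lborel" for n by (rule square_integrable_measurable[OF assms(2)])
  have "(\<integral>\<^sup>+x. liminf (\<lambda>n. ennreal ((cmod (F n x - rep_l2 g x))\<^sup>2)) \<partial>lborel)
     \<le> liminf (\<lambda>n. \<integral>\<^sup>+x. ennreal ((cmod (F n x - rep_l2 g x))\<^sup>2) \<partial>lborel)"
    by (rule nn_integral_liminf) measurable
  also have "(\<lambda>n. \<integral>\<^sup>+x. ennreal ((cmod (F n x - rep_l2 g x))\<^sup>2) \<partial>lborel) = (\<lambda>n. ennreal ((norm (l2_of (F n) - g))\<^sup>2))"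
    by (simp add: nn_norm_l2_of[OF square_integrable_diff] assms(2) square_integrable_rep_l2 l2_of_diff l2_of_rep_l2)
  also have "liminf \<dots> = 0"
  proof (rule lim_imp_Liminf)
    have "(\<lambda>n. (norm (l2_of (F n) - g))\<^sup>2) \<longlonglongrightarrow> (norm (g - g))\<^sup>2" by (intro tendsto_intros assms(1))
    then have "(\<lambda>n. ennreal ((norm (l2_of (F n) - g))\<^sup>2)) \<longlonglongrightarrow> ennreal 0" by (intro tendsto_ennrealI) simp
    then show "(\<lambda>n. ennreal ((norm (l2_of (F n) - g))\<^sup>2)) \<longlonglongrightarrow> 0" by simp
  qed simp
  finally have "AE x in lborel. liminf (\<lambda>n. ennreal ((cmod (F n x - rep_l2 g x))\<^sup>2)) = 0"
    unfolding le_zero_eq by (subst (asm) nn_integral_0_iff_AE) measurable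
  with assms(3) show ?thesis
  proof eventually_elim
    case (elim x)
    have "(\<lambda>n. ennreal ((cmod (F n x - rep_l2 g x))\<^sup>2)) \<longlonglongrightarrow> ennreal ((cmod (f x - rep_l2 g x))\<^sup>2)"
      by (intro tendsto_intros elim tendsto_ennrealI)
    then have "liminf (\<lambda>n. ennreal ((cmod (F n x - rep_l2 g x))\<^sup>2)) = ennreal ((cmod (f x - rep_l2 g x))\<^sup>2)"
      by (intro lim_imp_Liminf) auto
    with elim show ?case by simp
  qed
qed


section \<open>Multiplication operators with bounded symbols\<close>

text \<open>The bound is required at every point rather than almost everywhere, so that sums,
  products and conjugates of symbols involve no null sets.\<close>

definition bounded_symbol :: "(real^2 \<Rightarrow> complex) \<Rightarrow> bool" where
  "bounded_symbol m \<longleftrightarrow> m \<in> borel_measurable lborel \<and> (\<exists>C. \<forall>\<xi>. cmod (m \<xi>) \<le> C)"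

text \<open>Acts on the frequency side; \<open>fourier_multiplier\<close> turns out to be its
  conjugate by the transform.\<close>

definition mult_l2 :: "(real^2 \<Rightarrow> complex) \<Rightarrow> l2 \<Rightarrow> l2" where
  "mult_l2 m f = l2_of (\<lambda>\<xi>. m \<xi> * rep_l2 f \<xi>)"

lemma bounded_symbolI:
  "m \<in> borel_measurable lborel \<Longrightarrow> (\<And>\<xi>. cmod (m \<xi>) \<le> C) \<Longrightarrow> bounded_symbol m"
  by (auto simp: bounded_symbol_def)

lemma bounded_symbol_measurable: "bounded_symbol m \<Longrightarrow> m \<in> borel_measurable lborel"
  by (simp add: bounded_symbol_def)

lemma bounded_symbol_const: "bounded_symbol (\<lambda>_. c)"
  by (rule bounded_symbolI[where C="cmod c"]) auto

lemma bounded_symbol_mult: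
  assumes "bounded_symbol m" "bounded_symbol m'"
  shows "bounded_symbol (\<lambda>\<xi>. m \<xi> * m' \<xi>)"
proof -
  from assms obtain C C' where C: "\<And>\<xi>. cmod (m \<xi>) \<le> C" "\<And>\<xi>. cmod (m' \<xi>) \<le> C'"
    unfolding bounded_symbol_def by blast
  have "C \<ge> 0" using C(1)[of 0] norm_ge_zero[of "m 0"] by linarith
  then have "cmod (m \<xi> * m' \<xi>) \<le> C * C'" for \<xi>
    using C by (auto simp: norm_mult intro: mult_mono)
  moreover have [measurable]: "m \<in> borel_measurable lborel" "m' \<in> borel_measurable lborel"
    using assms by (auto simp only: bounded_symbol_def)
  ultimately show ?thesis by (intro bounded_symbolI) auto
qed

lemma bounded_symbol_cnj:
  assumes "bounded_symbol m"
  shows "bounded_symbol (\<lambda>\<xi>. cnj (m \<xi>))"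
proof -
  have [measurable]: "cnj \<in> borel_measurable borel"
    by (intro borel_measurable_continuous_onI continuous_intros)
  have [measurable]: "m \<in> borel_measurable lborel" by (rule bounded_symbol_measurable[OF assms])
  show ?thesis using assms by (auto simp: bounded_symbol_def)
qed

lemma bounded_symbol_add:
  assumes "bounded_symbol m" "bounded_symbol m'"
  shows "bounded_symbol (\<lambda>\<xi>. m \<xi> + m' \<xi>)"
proof -
  from assms obtain C C' where C: "\<And>\<xi>. cmod (m \<xi>) \<le> C" "\<And>\<xi>. cmod (m' \<xi>) \<le> C'"
    unfolding bounded_symbol_def by blast
  have "cmod (m \<xi> + m' \<xi>) \<le> C + C'" for \<xi> using C(1)[of \<xi>] C(2)[of \<xi>] norm_triangle_ineq[of "m \<xi>" "m' \<xi>"] by linarith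
  moreover have [measurable]: "m \<in> borel_measurable lborel" "m' \<in> borel_measurable lborel"
    using assms by (auto simp only: bounded_symbol_def)
  ultimately show ?thesis by (intro bounded_symbolI) auto
qed

lemma square_integrable_symbol:
  assumes "bounded_symbol m" "square_integrable f"
  shows "square_integrable (\<lambda>\<xi>. m \<xi> * f \<xi>)"
proof -
  obtain C where "\<And>\<xi>. cmod (m \<xi>) \<le> C" using assms(1) unfolding bounded_symbol_def by blast
  then show ?thesis
    using assms by (intro square_integrable_bound[OF assms(2), of _ C])
      (auto simp: norm_mult square_integrable_def bounded_symbol_def intro!: mult_right_mono)
qed

lemma rep_mult_l2:
  "bounded_symbol m \<Longrightarrow> AE \<xi> in lborel. rep_l2 (mult_l2 m f) \<xi> = m \<xi> * rep_l2 f \<xi>"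
  unfolding mult_l2_def by (intro rep_l2_of square_integrable_symbol square_integrable_rep_l2)

lemma mult_l2_l2_of:
  assumes "bounded_symbol m" "square_integrable f"
  shows "mult_l2 m (l2_of f) = l2_of (\<lambda>\<xi>. m \<xi> * f \<xi>)"
  unfolding mult_l2_def
proof (rule l2_of_eqI)
  show "AE x in lborel. m x * rep_l2 (l2_of f) x = m x * f x"
    using rep_l2_of[OF assms(2)] by eventually_elim simp
qed (auto intro: square_integrable_symbol assms square_integrable_rep_l2)

lemma mult_l2_add:
  assumes "bounded_symbol m"
  shows "mult_l2 m (f + g) = mult_l2 m f + mult_l2 m g"
proof (rule l2_eqI)
  show "AE x in lborel. rep_l2 (mult_l2 m (f + g)) x = rep_l2 (mult_l2 m f + mult_l2 m g) x"
    using rep_mult_l2[OF assms, of f] rep_mult_l2[OF assms, of g] rep_mult_l2[OF assms, of "f + g"]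
      rep_l2_add[of f g] rep_l2_add[of "mult_l2 m f" "mult_l2 m g"]
    by eventually_elim (simp add: algebra_simps)
qed

lemma mult_l2_scaleR:
  assumes "bounded_symbol m"
  shows "mult_l2 m (c *\<^sub>R f) = c *\<^sub>R mult_l2 m f"
proof (rule l2_eqI)
  show "AE x in lborel. rep_l2 (mult_l2 m (c *\<^sub>R f)) x = rep_l2 (c *\<^sub>R mult_l2 m f) x"
    using rep_mult_l2[OF assms, of f] rep_mult_l2[OF assms, of "c *\<^sub>R f"]
      rep_l2_scaleR[of c f] rep_l2_scaleR[of c "mult_l2 m f"]
    by eventually_elim (simp add: algebra_simps)
qed

lemma norm_mult_l2_le:
  assumes "m \<in> borel_measurable lborel" "\<And>\<xi>. cmod (m \<xi>) \<le> C"
  shows "norm (mult_l2 m f) \<le> C * norm f"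
proof (rule norm_l2_le)
  have m: "bounded_symbol m" using assms by (rule bounded_symbolI)
  show "AE \<xi> in lborel. cmod (rep_l2 (mult_l2 m f) \<xi>) \<le> C * cmod (rep_l2 f \<xi>)"
    using rep_mult_l2[OF m, of f] by eventually_elim (simp add: norm_mult assms(2) mult_right_mono)
  show "0 \<le> C" using assms(2)[of 0] norm_ge_zero[of "m 0"] by linarith
qed

lemma bounded_linear_mult_l2:
  assumes "bounded_symbol m"
  shows "bounded_linear (mult_l2 m)"
proof -
  obtain C where C: "\<And>\<xi>. cmod (m \<xi>) \<le> C" using assms unfolding bounded_symbol_def by blast
  show ?thesis
    using norm_mult_l2_le[OF bounded_symbol_measurable[OF assms] C]
    by (intro bounded_linear_intro[of _ C]) (auto simp: mult_l2_add mult_l2_scaleR assms mult.commute)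
qed

lemma mult_l2_mult_l2:
  assumes "bounded_symbol m" "bounded_symbol m'"
  shows "mult_l2 m (mult_l2 m' f) = mult_l2 (\<lambda>\<xi>. m \<xi> * m' \<xi>) f"
proof (rule l2_eqI)
  show "AE x in lborel. rep_l2 (mult_l2 m (mult_l2 m' f)) x = rep_l2 (mult_l2 (\<lambda>\<xi>. m \<xi> * m' \<xi>) f) x"
    using rep_mult_l2[OF assms(1), of "mult_l2 m' f"] rep_mult_l2[OF assms(2), of f]
      rep_mult_l2[OF bounded_symbol_mult[OF assms], of f]
    by eventually_elim simp
qed

lemma mult_l2_1: "mult_l2 (\<lambda>_. 1) f = f"
  by (simp add: mult_l2_def l2_of_rep_l2)

lemma mult_l2_symbol_add:
  assumes "bounded_symbol m" "bounded_symbol m'"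
  shows "mult_l2 (\<lambda>\<xi>. m \<xi> + m' \<xi>) f = mult_l2 m f + mult_l2 m' f"
proof (rule l2_eqI)
  show "AE x in lborel. rep_l2 (mult_l2 (\<lambda>\<xi>. m \<xi> + m' \<xi>) f) x = rep_l2 (mult_l2 m f + mult_l2 m' f) x"
    using rep_mult_l2[OF bounded_symbol_add[OF assms], of f] rep_mult_l2[OF assms(1), of f]
      rep_mult_l2[OF assms(2), of f] rep_l2_add[of "mult_l2 m f" "mult_l2 m' f"]
    by eventually_elim (simp add: algebra_simps)
qed

lemma norm_mult_l2_isometry:
  assumes "m \<in> borel_measurable lborel" "\<And>\<xi>. cmod (m \<xi>) = 1"
  shows "norm (mult_l2 m f) = norm f"
proof (rule antisym)
  have m: "bounded_symbol m" using assms by (intro bounded_symbolI[where C=1]) auto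
  show "norm (mult_l2 m f) \<le> norm f" using norm_mult_l2_le[of m 1 f] assms by simp
  have "AE \<xi> in lborel. cmod (rep_l2 f \<xi>) \<le> 1 * cmod (rep_l2 (mult_l2 m f) \<xi>)"
    using rep_mult_l2[OF m, of f] by eventually_elim (simp add: norm_mult assms(2))
  from norm_l2_le[OF this] show "norm f \<le> norm (mult_l2 m f)" by simp
qed

lemma inner_mult_l2:
  assumes "bounded_symbol m"
  shows "mult_l2 m f \<bullet> g = f \<bullet> mult_l2 (\<lambda>\<xi>. cnj (m \<xi>)) g"
  unfolding inner_l2_rep
proof (rule integral_cong_AE)
  show "AE x in lborel. rep_l2 (mult_l2 m f) x \<bullet> rep_l2 g x = rep_l2 f x \<bullet> rep_l2 (mult_l2 (\<lambda>\<xi>. cnj (m \<xi>)) g) x"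
    using rep_mult_l2[OF assms, of f] rep_mult_l2[OF bounded_symbol_cnj[OF assms], of g]
    by eventually_elim (simp add: inner_complex_def algebra_simps)
qed auto

text \<open>Pointwise convergence under a uniform bound suffices, because a multiple of
  \<open>f\<close> dominates. This yields the strong continuity of the propagator and the limit of
  the translation difference quotients.\<close>

lemma mult_l2_tendsto:
  assumes "\<And>n. m n \<in> borel_measurable lborel" "bounded_symbol m'" "\<And>n \<xi>. cmod (m n \<xi>) \<le> C"
    and "\<And>\<xi>. (\<lambda>n. m n \<xi>) \<longlonglongrightarrow> m' \<xi>"
  shows "(\<lambda>n. mult_l2 (m n) f) \<longlonglongrightarrow> mult_l2 m' f"
  unfolding mult_l2_def
proof (rule l2_dominated)
  show "square_integrable (\<lambda>\<xi>. complex_of_real C * rep_l2 f \<xi>)"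
    by (intro square_integrable_cmult square_integrable_rep_l2)
  have "C \<ge> 0" using assms(3)[of 0 0] norm_ge_zero[of "m 0 0"] by linarith
  then show "AE x in lborel. cmod (m n x * rep_l2 f x) \<le> cmod (complex_of_real C * rep_l2 f x)" for n
    using assms(3) by (auto simp: norm_mult intro!: mult_right_mono)
  show "(\<lambda>\<xi>. m n \<xi> * rep_l2 f \<xi>) \<in> borel_measurable lborel" for n using assms(1) by measurable
qed (use assms in \<open>auto intro!: square_integrable_symbol square_integrable_rep_l2 tendsto_intros\<close>)

lemma square_integrable_cutoff: "square_integrable (cutoff R f)"
  by (rule square_integrable_bound[OF square_integrable_rep_l2[of f] cutoff_measurable, where C=1])
    (auto simp: cutoff_def indicator_def)

section \<open>Plancherel's theorem\<close>

text \<open>Lebesgue measure is the image of the product measure over \<open>Basis\<close> under the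
  coordinate map, so the one-variable theory of product measures applies.\<close>

lemma lborel_prod_Basis:
  fixes f :: "'a::euclidean_space \<Rightarrow> real \<Rightarrow> complex"
  assumes "\<And>b. b \<in> Basis \<Longrightarrow> integrable lborel (f b)"
  shows integrable_lborel_prod_Basis: "integrable lborel (\<lambda>x::'a. \<Prod>b\<in>Basis. f b (x \<bullet> b))"
    and integral_lborel_prod_Basis:
      "integral\<^sup>L lborel (\<lambda>x::'a. \<Prod>b\<in>Basis. f b (x \<bullet> b)) = (\<Prod>b\<in>Basis. LINT t|lborel. f b t)"
proof -
  interpret P: product_sigma_finite "\<lambda>_::'a. lborel :: real measure" ..
  let ?e = "\<lambda>y. \<Sum>b\<in>Basis. y b *\<^sub>R b :: 'a"
  have [measurable]: "f b \<in> borel_measurable borel" if "b \<in> Basis" for b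
    using borel_measurable_integrable[OF assms[OF that]] by simp
  have m: "?e \<in> measurable (\<Pi>\<^sub>M b\<in>Basis. lborel) borel" by measurable
  have m2: "(\<lambda>x::'a. \<Prod>b\<in>Basis. f b (x \<bullet> b)) \<in> borel_measurable borel" by measurable
  have eq: "(\<Prod>b\<in>Basis. f b (?e y \<bullet> b)) = (\<Prod>b\<in>Basis. f b (y b))" for y
    by (intro prod.cong refl) simp
  show "integrable lborel (\<lambda>x::'a. \<Prod>b\<in>Basis. f b (x \<bullet> b))"
    unfolding lborel_eq[where 'a='a] integrable_distr_eq[OF m m2] eq
    by (rule P.product_integrable_prod) (auto intro: assms)
  show "integral\<^sup>L lborel (\<lambda>x::'a. \<Prod>b\<in>Basis. f b (x \<bullet> b)) = (\<Prod>b\<in>Basis. LINT t|lborel. f b t)"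
    unfolding lborel_eq[where 'a='a] integral_distr[OF m m2] eq
    by (rule P.product_integral_prod) (auto intro: assms)
qed

text \<open>A rescaling of the characteristic function of the standard normal law.\<close>

lemma gaussian_fourier_line:
  fixes \<eta> t :: real
  assumes "\<eta> > 0"
  shows "has_bochner_integral lborel (\<lambda>s. exp (- \<i> * complex_of_real (s * t)) * exp (- complex_of_real (\<eta> * s\<^sup>2 / 2)))
    (complex_of_real (sqrt (2 * pi / \<eta>) * exp (- t\<^sup>2 / (2 * \<eta>))))"
proof -
  interpret S: prob_space std_normal_distribution by (rule prob_space_normal_density) simp
  \<comment> \<open>The substitution \<open>x = sqrt \<eta> * s\<close> turns the standard density
    into the weight, and this frequency into \<open>- t\<close>.\<close>
  let ?\<tau> = "- t / sqrt \<eta>"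
  let ?h = "\<lambda>x. complex_of_real (std_normal_density x) * iexp (?\<tau> * x)"
  have int: "integrable lborel ?h"
  proof (rule Bochner_Integration.integrable_bound)
    show "integrable lborel std_normal_density" by (rule integrable_normal_density) simp
    show "AE x in lborel. norm (?h x) \<le> norm (std_normal_density x)"
      by (auto simp: norm_mult)
  qed measurable
  have "(LINT x|lborel. ?h x) = char std_normal_distribution ?\<tau>"
    unfolding char_def
    by (subst integral_density) (auto simp: scaleR_conv_of_real)
  also have "\<dots> = complex_of_real (exp (- t\<^sup>2 / (2 * \<eta>)))"
    using assms by (simp add: char_std_normal_distribution power_divide)
  finally have "has_bochner_integral lborel ?h (complex_of_real (exp (- t\<^sup>2 / (2 * \<eta>))))"
    using int by (simp add: has_bochner_integral_iff)
  then have "has_bochner_integral lborel (\<lambda>s. ?h (0 + sqrt \<eta> * s)) (complex_of_real (exp (- t\<^sup>2 / (2 * \<eta>))) /\<^sub>R \<bar>sqrt \<eta>\<bar>)"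
    using assms by (subst (asm) lborel_has_bochner_integral_real_affine_iff[of "sqrt \<eta>" _ _ 0]) auto
  then have "has_bochner_integral lborel (\<lambda>s. complex_of_real (sqrt (2 * pi)) * ?h (0 + sqrt \<eta> * s))
      (complex_of_real (sqrt (2 * pi)) * (complex_of_real (exp (- t\<^sup>2 / (2 * \<eta>))) /\<^sub>R \<bar>sqrt \<eta>\<bar>))"
    by (intro has_bochner_integral_mult_right) auto
  also have "(\<lambda>s. complex_of_real (sqrt (2 * pi)) * ?h (0 + sqrt \<eta> * s)) =
      (\<lambda>s. exp (- \<i> * complex_of_real (s * t)) * exp (- complex_of_real (\<eta> * s\<^sup>2 / 2)))"
  proof
    fix s
    have "iexp (?\<tau> * (0 + sqrt \<eta> * s)) = exp (- \<i> * complex_of_real (s * t))"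
      using assms by (simp add: field_simps)
    moreover have "complex_of_real (sqrt (2 * pi)) * complex_of_real (std_normal_density (0 + sqrt \<eta> * s)) =
       exp (- complex_of_real (\<eta> * s\<^sup>2 / 2))"
    proof -
      have "sqrt (2 * pi) * std_normal_density (0 + sqrt \<eta> * s) = exp (- (\<eta> * s\<^sup>2 / 2))"
        using assms by (simp add: std_normal_density_def power_mult_distrib)
      then show ?thesis by (simp only: flip: of_real_mult of_real_minus exp_of_real)
    qed
    ultimately show "complex_of_real (sqrt (2 * pi)) * ?h (0 + sqrt \<eta> * s) =
      exp (- \<i> * complex_of_real (s * t)) * exp (- complex_of_real (\<eta> * s\<^sup>2 / 2))"
      by (metis mult.assoc mult.commute)
  qed
  also have "complex_of_real (sqrt (2 * pi)) * (complex_of_real (exp (- t\<^sup>2 / (2 * \<eta>))) /\<^sub>R \<bar>sqrt \<eta>\<bar>) =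
     complex_of_real (sqrt (2 * pi / \<eta>) * exp (- t\<^sup>2 / (2 * \<eta>)))"
    using assms by (simp add: real_sqrt_divide scaleR_conv_of_real field_simps del: of_real_exp)
  finally show ?thesis .
qed

text \<open>The normal density with variance \<eta> in each coordinate; it has mass 1 and
  concentrates at the origin as \<eta> tends to 0.\<close>

definition gauss :: "real \<Rightarrow> real^2 \<Rightarrow> real" where
  "gauss \<eta> x = 1 / (2 * pi * \<eta>) * exp (- (norm x)\<^sup>2 / (2 * \<eta>))"

lemma gauss_measurable [measurable]: "gauss \<eta> \<in> borel_measurable borel"
  unfolding gauss_def by measurable

lemma gauss_pos: "\<eta> > 0 \<Longrightarrow> gauss \<eta> x > 0"
  by (simp add: gauss_def)

lemma gauss_le: "\<eta> > 0 \<Longrightarrow> gauss \<eta> x \<le> 1 / (2 * pi * \<eta>)"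
  by (simp add: gauss_def divide_right_mono)

text \<open>Factors over the coordinates into \<open>gaussian_fourier_line\<close>. The constant
  \<open>4 * pi\<^sup>2\<close> is the square of the \<open>2 * pi\<close> in
  \<open>fourier_integral\<close>, so it cancels when squared transforms are integrated against the
  weight.\<close>

lemma gaussian_fourier:
  fixes z :: "real^2"
  assumes "\<eta> > 0"
  shows "has_bochner_integral lborel
    (\<lambda>\<xi>. exp (- \<i> * complex_of_real (\<xi> \<bullet> z)) * complex_of_real (exp (- (\<eta> * (norm \<xi>)\<^sup>2 / 2))))
    (complex_of_real (4 * pi\<^sup>2 * gauss \<eta> z))"
proof -
  let ?f = "\<lambda>(b::real^2) s. exp (- \<i> * complex_of_real (s * (z \<bullet> b))) * exp (- complex_of_real (\<eta> * s\<^sup>2 / 2))"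
  have eq: "(\<Prod>b\<in>Basis. ?f b (\<xi> \<bullet> b)) = exp (- \<i> * complex_of_real (\<xi> \<bullet> z)) * complex_of_real (exp (- (\<eta> * (norm \<xi>)\<^sup>2 / 2)))"
    for \<xi> :: "real^2"
  proof -
    have "\<xi> \<bullet> z = (\<Sum>b\<in>Basis. (\<xi> \<bullet> b) * (z \<bullet> b))" by (rule euclidean_inner)
    moreover have "(norm \<xi>)\<^sup>2 = (\<Sum>b\<in>Basis. (\<xi> \<bullet> b)\<^sup>2)"
      unfolding power2_norm_eq_inner by (subst euclidean_inner) (simp add: power2_eq_square)
    ultimately show ?thesis
      by (simp add: prod.distrib exp_sum[symmetric] sum_distrib_left sum_negf sum_divide_distrib flip: exp_of_real)
  qed
  have "(\<Prod>b\<in>(Basis::(real^2) set). LINT t|lborel. ?f b t) =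
     (\<Prod>b\<in>(Basis::(real^2) set). complex_of_real (sqrt (2 * pi / \<eta>) * exp (- (z \<bullet> b)\<^sup>2 / (2 * \<eta>))))"
    using gaussian_fourier_line[OF assms] by (intro prod.cong refl) (simp add: has_bochner_integral_iff)
  also have "\<dots> = complex_of_real (\<Prod>b\<in>(Basis::(real^2) set). sqrt (2 * pi / \<eta>) * exp (- (z \<bullet> b)\<^sup>2 / (2 * \<eta>)))"
    by (rule of_real_prod[symmetric])
  also have "(\<Prod>b\<in>(Basis::(real^2) set). sqrt (2 * pi / \<eta>) * exp (- (z \<bullet> b)\<^sup>2 / (2 * \<eta>))) =
     (sqrt (2 * pi / \<eta>))\<^sup>2 * exp (\<Sum>b\<in>(Basis::(real^2) set). - (z \<bullet> b)\<^sup>2 / (2 * \<eta>))"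
    by (simp add: prod.distrib exp_sum)
  also have "(\<Sum>b\<in>(Basis::(real^2) set). - (z \<bullet> b)\<^sup>2 / (2 * \<eta>)) = - (norm z)\<^sup>2 / (2 * \<eta>)"
    unfolding power2_norm_eq_inner euclidean_inner[of z z]
    by (simp add: sum_negf sum_divide_distrib power2_eq_square)
  also have "(sqrt (2 * pi / \<eta>))\<^sup>2 = 2 * pi / \<eta>" using assms by simp
  also have "2 * pi / \<eta> * exp (- (norm z)\<^sup>2 / (2 * \<eta>)) = 4 * pi\<^sup>2 * gauss \<eta> z"
    using assms by (simp add: gauss_def power2_eq_square)
  finally have "(\<Prod>b\<in>(Basis::(real^2) set). LINT t|lborel. ?f b t) = complex_of_real (4 * pi\<^sup>2 * gauss \<eta> z)" .
  moreover have i: "integrable lborel (?f b)" for b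
    using gaussian_fourier_line[OF assms] by (simp add: has_bochner_integral_iff)
  ultimately show ?thesis
    using integrable_lborel_prod_Basis[of ?f, OF i] integral_lborel_prod_Basis[of ?f, OF i]
    unfolding eq has_bochner_integral_iff by simp
qed

text \<open>The mass is read off from \<open>gaussian_fourier\<close> at the origin with
  \<open>1/\<eta>\<close> in place of \<eta>.\<close>

lemma gauss_integral:
  assumes "\<eta> > 0"
  shows "has_bochner_integral lborel (gauss \<eta>) 1"
proof -
  have "has_bochner_integral lborel
    (\<lambda>\<xi>::real^2. complex_of_real (exp (- ((1/\<eta>) * (norm \<xi>)\<^sup>2 / 2)))) (complex_of_real (4 * pi\<^sup>2 * gauss (1/\<eta>) 0))"
    using gaussian_fourier[of "1/\<eta>" 0] assms by simp
  then have "has_bochner_integral lborel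
    (\<lambda>\<xi>::real^2. exp (- ((1/\<eta>) * (norm \<xi>)\<^sup>2 / 2))) (4 * pi\<^sup>2 * gauss (1/\<eta>) 0)"
    unfolding has_bochner_integral_iff
    by (simp add: complex_of_real_integrable_eq del: of_real_exp of_real_mult)
  then have "has_bochner_integral lborel
    (\<lambda>\<xi>::real^2. 1 / (2 * pi * \<eta>) * exp (- ((1/\<eta>) * (norm \<xi>)\<^sup>2 / 2))) (1 / (2 * pi * \<eta>) * (4 * pi\<^sup>2 * gauss (1/\<eta>) 0))"
    by (intro has_bochner_integral_mult_right) auto
  moreover have "1 / (2 * pi * \<eta>) * (4 * pi\<^sup>2 * gauss (1/\<eta>) 0) = 1"
    using assms by (simp add: gauss_def power2_eq_square)
  moreover have "(\<lambda>\<xi>::real^2. 1 / (2 * pi * \<eta>) * exp (- ((1/\<eta>) * (norm \<xi>)\<^sup>2 / 2))) = gauss \<eta>"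
    by (simp add: gauss_def fun_eq_iff)
  ultimately show ?thesis by (simp only:)
qed

text \<open>One statement serves translations (\<open>c = 1\<close>), reflections
  (\<open>c = -1\<close>, \<open>t = 0\<close>) and the substitution \<open>x - y\<close> in
  convolutions; the Jacobian is 1 in each case.\<close>

lemma lborel_distr_reflect:
  fixes t :: "'a::euclidean_space"
  assumes "c = 1 \<or> c = -1"
  shows "distr lborel borel (\<lambda>x. t + c *\<^sub>R x) = lborel"
proof -
  have "lborel = density (distr lborel borel (\<lambda>x. t + c *\<^sub>R x)) (\<lambda>_. \<bar>c\<bar> ^ DIM('a))"
    using assms by (intro lborel_affine) auto
  also have "(\<lambda>_::'a. ennreal (\<bar>c\<bar> ^ DIM('a))) = (\<lambda>_. 1)" using assms by auto
  finally show ?thesis by (simp add: density_1)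
qed

lemma has_bochner_integral_affine_isometry:
  fixes t :: "'a::euclidean_space" and f :: "'a \<Rightarrow> 'b::{banach, second_countable_topology}"
  assumes "c = 1 \<or> c = -1" "has_bochner_integral lborel f I"
  shows "has_bochner_integral lborel (\<lambda>x. f (t + c *\<^sub>R x)) I"
proof -
  have m: "(\<lambda>x. t + c *\<^sub>R x) \<in> measurable lborel borel" by simp
  have f: "f \<in> borel_measurable borel" using assms(2) by (auto simp: has_bochner_integral_iff)
  show ?thesis
    using assms(2) integrable_distr_eq[OF m f] integral_distr[OF m f]
    unfolding lborel_distr_reflect[OF assms(1)] has_bochner_integral_iff by simp
qed

text \<open>Integrating first over the variable on which \<open>h\<close> does not depend leaves the
  unit mass of the kernel.\<close>

lemma gauss_convolution:
  fixes h :: "real^2 \<Rightarrow> real"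
  assumes "\<eta> > 0" "integrable lborel h"
  shows integrable_gauss_fst: "integrable (lborel \<Otimes>\<^sub>M lborel) (\<lambda>(x,y). h x * gauss \<eta> (x - y))"
    and integral_gauss_fst: "integral\<^sup>L (lborel \<Otimes>\<^sub>M lborel) (\<lambda>(x,y). h x * gauss \<eta> (x - y)) = integral\<^sup>L lborel h"
    and integrable_gauss_snd: "integrable (lborel \<Otimes>\<^sub>M lborel) (\<lambda>(x,y). h y * gauss \<eta> (x - y))"
    and integral_gauss_snd: "integral\<^sup>L (lborel \<Otimes>\<^sub>M lborel) (\<lambda>(x,y). h y * gauss \<eta> (x - y)) = integral\<^sup>L lborel h"
proof -
  have [measurable]: "h \<in> borel_measurable borel" using assms(2) by auto
  have g: "has_bochner_integral lborel (\<lambda>y. gauss \<eta> (x - y)) 1" for x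
    using has_bochner_integral_affine_isometry[OF _ gauss_integral[OF assms(1)], of "-1" x] by simp
  have g1: "integrable lborel (\<lambda>y. gauss \<eta> (x - y))" "(LINT y|lborel. gauss \<eta> (x - y)) = 1" for x
    using g by (auto simp: has_bochner_integral_iff)
  have m: "(\<lambda>(x,y). h x * gauss \<eta> (x - y)) \<in> borel_measurable (lborel \<Otimes>\<^sub>M lborel)" by measurable
  show 1: "integrable (lborel \<Otimes>\<^sub>M lborel) (\<lambda>(x,y). h x * gauss \<eta> (x - y))"
  proof (rule lborel_pair.Fubini_integrable[OF m])
    have "(\<lambda>x. LINT y|lborel. norm (case (x,y) of (x,y) \<Rightarrow> h x * gauss \<eta> (x - y))) = (\<lambda>x. \<bar>h x\<bar>)"
      using assms(1) by (simp add: abs_mult gauss_pos less_imp_le g1)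
    then show "integrable lborel (\<lambda>x. LINT y|lborel. norm (case (x,y) of (x,y) \<Rightarrow> h x * gauss \<eta> (x - y)))"
      using assms(2) by simp
    show "AE x in lborel. integrable lborel (\<lambda>y. case (x, y) of (x, y) \<Rightarrow> h x * gauss \<eta> (x - y))"
      using g1 by simp
  qed
  show 2: "integral\<^sup>L (lborel \<Otimes>\<^sub>M lborel) (\<lambda>(x,y). h x * gauss \<eta> (x - y)) = integral\<^sup>L lborel h"
    using lborel_pair.integral_fst'[OF 1] by (simp add: g1)
  have sym: "gauss \<eta> (x - y) = gauss \<eta> (y - x)" for x y by (simp add: gauss_def norm_minus_commute)
  show "integrable (lborel \<Otimes>\<^sub>M lborel) (\<lambda>(x,y). h y * gauss \<eta> (x - y))"
    using lborel_pair.integrable_product_swap[OF 1] by (simp add: sym)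
  show "integral\<^sup>L (lborel \<Otimes>\<^sub>M lborel) (\<lambda>(x,y). h y * gauss \<eta> (x - y)) = integral\<^sup>L lborel h"
    using lborel_pair.integral_product_swap[OF m] 2 by (simp add: sym)
qed

lemma lborel_pair_prod:
  fixes f :: "'a::euclidean_space \<Rightarrow> complex" and g :: "'b::euclidean_space \<Rightarrow> complex"
  assumes "integrable lborel f" "integrable lborel g"
  shows integrable_lborel_pair_prod: "integrable (lborel \<Otimes>\<^sub>M lborel) (\<lambda>(x,y). f x * g y)"
    and integral_lborel_pair_prod: "integral\<^sup>L (lborel \<Otimes>\<^sub>M lborel) (\<lambda>(x,y). f x * g y) = integral\<^sup>L lborel f * integral\<^sup>L lborel g"
proof -
  have [measurable]: "f \<in> borel_measurable borel" "g \<in> borel_measurable borel" using assms by auto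
  show 1: "integrable (lborel \<Otimes>\<^sub>M lborel) (\<lambda>(x,y). f x * g y)"
    by (rule lborel_pair.Fubini_integrable) (use assms in \<open>auto simp: norm_mult\<close>)
  show "integral\<^sup>L (lborel \<Otimes>\<^sub>M lborel) (\<lambda>(x,y). f x * g y) = integral\<^sup>L lborel f * integral\<^sup>L lborel g"
    using lborel_pair.integral_fst'[OF 1] by simp
qed


section \<open>The Fourier integral of integrable functions\<close>

lemma fourier_integrable:
  assumes "integrable lborel f"
  shows "integrable lborel (\<lambda>x. exp (- \<i> * complex_of_real (\<xi> \<bullet> x)) * f x)"
proof (rule Bochner_Integration.integrable_bound[OF assms])
  have [measurable]: "f \<in> borel_measurable borel" using assms by auto
  show "(\<lambda>x. exp (- \<i> * complex_of_real (\<xi> \<bullet> x)) * f x) \<in> borel_measurable lborel" by measurable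
qed (simp add: norm_mult)

lemma fourier_integral_measurable:
  assumes [measurable]: "f \<in> borel_measurable borel"
  shows "fourier_integral f \<in> borel_measurable borel"
proof -
  have "(\<lambda>(\<xi>, x). exp (- \<i> * complex_of_real (\<xi> \<bullet> x)) * f x) \<in> borel_measurable (lborel \<Otimes>\<^sub>M lborel)"
    by measurable
  from lborel.borel_measurable_lebesgue_integral[OF this]
  have "(\<lambda>\<xi>. LINT x|lborel. exp (- \<i> * complex_of_real (\<xi> \<bullet> x)) * f x) \<in> borel_measurable borel" by simp
  then show ?thesis unfolding fourier_integral_def by measurable
qed

lemma fourier_integral_bound: "cmod (fourier_integral f \<xi>) \<le> 1 / (2 * pi) * (LINT x|lborel. cmod (f x))"
proof -
  have "cmod (LINT x|lborel. exp (- \<i> * complex_of_real (\<xi> \<bullet> x)) * f x) \<le>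
      (LINT x|lborel. cmod (exp (- \<i> * complex_of_real (\<xi> \<bullet> x)) * f x))"
    by (rule integral_norm_bound)
  also have "\<dots> = (LINT x|lborel. cmod (f x))" by (simp add: norm_mult)
  finally show ?thesis unfolding fourier_integral_def
    by (simp add: norm_mult norm_divide divide_right_mono del: of_real_mult)
qed

text \<open>
  Against a Gaussian weight the square of the transform becomes a double integral of \<open>f(x) \<bullet> f(y)\<close>. On
  \<open>L\<^sup>1 \<inter> L\<^sup>2\<close> this gives the contraction bound; equality is needed only for Lipschitz functions of bounded
  support, because inversion then extends to \<open>L\<^sup>2\<close> by orthogonality.
\<close>

lemma fourier_integral_gauss:
  assumes f: "integrable lborel f" and "\<eta> > 0"
  shows "has_bochner_integral lborel (\<lambda>\<xi>. (cmod (fourier_integral f \<xi>))\<^sup>2 * exp (- (\<eta> * (norm \<xi>)\<^sup>2 / 2)))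
     (integral\<^sup>L (lborel \<Otimes>\<^sub>M lborel) (\<lambda>(x,y). (f x \<bullet> f y) * gauss \<eta> (x - y)))"
    and "integrable (lborel \<Otimes>\<^sub>M lborel) (\<lambda>(x,y). (f x \<bullet> f y) * gauss \<eta> (x - y))"
proof -
  have [measurable]: "f \<in> borel_measurable borel" "cnj \<in> borel_measurable borel"
    using f by (auto intro!: borel_measurable_continuous_onI continuous_intros)
  let ?e = "\<lambda>\<xi>. complex_of_real (exp (- (\<eta> * (norm \<xi>)\<^sup>2 / 2)))"
  let ?F = "\<lambda>p. f (fst p) * cnj (f (snd p))"
  have cf: "integrable lborel (\<lambda>y. cnj (f y))" using f by simp
  have F: "integrable (lborel \<Otimes>\<^sub>M lborel) ?F"
    using integrable_lborel_pair_prod[OF f cf] by (simp add: case_prod_unfold)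
  have e: "integrable lborel (\<lambda>\<xi>::real^2. ?e \<xi>)"
    using gaussian_fourier[OF assms(2), of 0] by (simp add: has_bochner_integral_iff del: of_real_exp)
  \<comment> \<open>Integrated over \<open>p\<close> this gives the weighted square of the
    transform, integrated over \<xi> the Gaussian kernel against \<open>?F\<close>, each with the
    factor \<open>4 * pi\<^sup>2\<close>. The weight makes it integrable, and Fubini equates the
    two.\<close>
  let ?K = "\<lambda>(\<xi>, p). exp (- \<i> * complex_of_real (\<xi> \<bullet> (fst p - snd p))) * (?e \<xi> * ?F p)"
  interpret Q: pair_sigma_finite "lborel :: (real^2) measure" "lborel \<Otimes>\<^sub>M lborel :: ((real^2) \<times> (real^2)) measure"
    by standard
  have K: "integrable (lborel \<Otimes>\<^sub>M (lborel \<Otimes>\<^sub>M lborel)) ?K"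
  proof (rule Q.Fubini_integrable)
    show "?K \<in> borel_measurable (lborel \<Otimes>\<^sub>M (lborel \<Otimes>\<^sub>M lborel))" by measurable
    have "(\<lambda>\<xi>. \<integral>p. norm (?K (\<xi>, p)) \<partial>(lborel \<Otimes>\<^sub>M lborel)) = (\<lambda>\<xi>. cmod (?e \<xi>) * (\<integral>p. norm (?F p) \<partial>(lborel \<Otimes>\<^sub>M lborel)))"
      by (simp add: norm_mult del: of_real_exp)
    then show "integrable lborel (\<lambda>\<xi>. \<integral>p. norm (?K (\<xi>, p)) \<partial>(lborel \<Otimes>\<^sub>M lborel))"
      using integrable_mult_left[OF integrable_norm[OF e]] by (simp only:)
    have "integrable (lborel \<Otimes>\<^sub>M lborel) (\<lambda>p. ?K (\<xi>, p))" for \<xi>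
    proof (rule Bochner_Integration.integrable_bound)
      show "integrable (lborel \<Otimes>\<^sub>M lborel) (\<lambda>p. ?e \<xi> * ?F p)" using F by simp
      show "(\<lambda>p. ?K (\<xi>, p)) \<in> borel_measurable (lborel \<Otimes>\<^sub>M lborel)"
        unfolding prod.case by measurable
    qed (simp add: norm_mult)
    then show "AE \<xi> in lborel. integrable (lborel \<Otimes>\<^sub>M lborel) (\<lambda>p. ?K (\<xi>, p))" by simp
  qed
  have inner1: "(\<integral>p. ?K (\<xi>, p) \<partial>(lborel \<Otimes>\<^sub>M lborel)) =
      complex_of_real (4 * pi\<^sup>2) * complex_of_real ((cmod (fourier_integral f \<xi>))\<^sup>2 * exp (- (\<eta> * (norm \<xi>)\<^sup>2 / 2)))" for \<xi>
  proof -
    let ?k = "\<lambda>x. exp (- \<i> * complex_of_real (\<xi> \<bullet> x)) * f x"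
    have k: "integrable lborel ?k" by (rule fourier_integrable[OF f])
    have ck: "integrable lborel (\<lambda>x. cnj (?k x))" unfolding complex_integrable_cnj by (rule k)
    have E: "exp (- \<i> * complex_of_real (\<xi> \<bullet> (x - y))) =
        exp (- \<i> * complex_of_real (\<xi> \<bullet> x)) * cnj (exp (- \<i> * complex_of_real (\<xi> \<bullet> y)))" for x y
      by (simp add: exp_cnj inner_diff_right algebra_simps flip: exp_add)
    have "(\<integral>p. ?K (\<xi>, p) \<partial>(lborel \<Otimes>\<^sub>M lborel)) = (\<integral>p. ?e \<xi> * (case p of (x,y) \<Rightarrow> ?k x * cnj (?k y)) \<partial>(lborel \<Otimes>\<^sub>M lborel))"
      by (intro Bochner_Integration.integral_cong refl) (simp only: case_prod_unfold fst_conv snd_conv E complex_cnj_mult mult_ac)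
    also have "\<dots> = ?e \<xi> * (integral\<^sup>L lborel ?k * integral\<^sup>L lborel (\<lambda>x. cnj (?k x)))"
      by (subst integral_mult_right_zero) (simp only: integral_lborel_pair_prod[OF k ck])
    also have "integral\<^sup>L lborel (\<lambda>x. cnj (?k x)) = cnj (integral\<^sup>L lborel ?k)"
      by (rule Bochner_Integration.integral_cnj)
    also have "integral\<^sup>L lborel ?k = complex_of_real (2 * pi) * fourier_integral f \<xi>"
      by (simp add: fourier_integral_def)
    also have "complex_of_real (2 * pi) * fourier_integral f \<xi> * cnj (complex_of_real (2 * pi) * fourier_integral f \<xi>)
      = complex_of_real (4 * pi\<^sup>2) * complex_of_real ((cmod (fourier_integral f \<xi>))\<^sup>2)"
      unfolding of_real_power[of "cmod (fourier_integral f \<xi>)"] complex_norm_square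
      by (simp add: power2_eq_square)
    finally show ?thesis by (simp add: algebra_simps)
  qed
  have inner2: "(LINT \<xi>|lborel. ?K (\<xi>, p)) = complex_of_real (4 * pi\<^sup>2) * (complex_of_real (gauss \<eta> (fst p - snd p)) * ?F p)" for p
  proof -
    have "(LINT \<xi>|lborel. ?K (\<xi>, p)) = (LINT \<xi>|lborel. exp (- \<i> * complex_of_real (\<xi> \<bullet> (fst p - snd p))) * ?e \<xi>) * ?F p"
      by (subst integral_mult_left_zero[symmetric]) (simp add: algebra_simps del: of_real_exp)
    also have "(LINT \<xi>|lborel. exp (- \<i> * complex_of_real (\<xi> \<bullet> (fst p - snd p))) * ?e \<xi>) = complex_of_real (4 * pi\<^sup>2 * gauss \<eta> (fst p - snd p))"
      using gaussian_fourier[OF assms(2)] by (simp only: has_bochner_integral_iff)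
    finally show ?thesis by simp
  qed
  have G: "integrable (lborel \<Otimes>\<^sub>M lborel) (\<lambda>p. complex_of_real (gauss \<eta> (fst p - snd p)) * ?F p)"
  proof (rule Bochner_Integration.integrable_bound)
    show "integrable (lborel \<Otimes>\<^sub>M lborel) (\<lambda>p. complex_of_real (1 / (2 * pi * \<eta>)) * ?F p)" using F by simp
    have "cmod (complex_of_real (gauss \<eta> (fst p - snd p)) * ?F p) \<le> cmod (complex_of_real (1 / (2 * pi * \<eta>)) * ?F p)" for p
      using gauss_le[OF assms(2), of "fst p - snd p"] gauss_pos[OF assms(2), of "fst p - snd p"] assms(2)
      by (simp only: norm_mult norm_of_real) (intro mult_right_mono, auto)
    then show "AE p in lborel \<Otimes>\<^sub>M lborel. cmod (complex_of_real (gauss \<eta> (fst p - snd p)) * ?F p) \<le> cmod (complex_of_real (1 / (2 * pi * \<eta>)) * ?F p)"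
      by simp
  qed measurable
  have Re: "Re (complex_of_real (gauss \<eta> (fst p - snd p)) * ?F p) = (case p of (x,y) \<Rightarrow> (f x \<bullet> f y) * gauss \<eta> (x - y))" for p
    by (simp add: case_prod_unfold inner_complex_def algebra_simps)
  show "integrable (lborel \<Otimes>\<^sub>M lborel) (\<lambda>(x,y). (f x \<bullet> f y) * gauss \<eta> (x - y))"
    using integrable_Re[OF G] unfolding Re .
  have "(LINT \<xi>|lborel. \<integral>p. ?K (\<xi>, p) \<partial>(lborel \<Otimes>\<^sub>M lborel)) = (\<integral>p. (LINT \<xi>|lborel. ?K (\<xi>, p)) \<partial>(lborel \<Otimes>\<^sub>M lborel))"
    using Q.Fubini_integral[of "\<lambda>\<xi> p. ?K (\<xi>, p)"] K by (simp add: case_prod_unfold)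
  then have "(LINT \<xi>|lborel. complex_of_real ((cmod (fourier_integral f \<xi>))\<^sup>2 * exp (- (\<eta> * (norm \<xi>)\<^sup>2 / 2)))) =
     (\<integral>p. complex_of_real (gauss \<eta> (fst p - snd p)) * ?F p \<partial>(lborel \<Otimes>\<^sub>M lborel))"
    unfolding inner1 inner2 integral_mult_right_zero by simp
  then have "(LINT \<xi>|lborel. (cmod (fourier_integral f \<xi>))\<^sup>2 * exp (- (\<eta> * (norm \<xi>)\<^sup>2 / 2))) =
     Re (\<integral>p. complex_of_real (gauss \<eta> (fst p - snd p)) * ?F p \<partial>(lborel \<Otimes>\<^sub>M lborel))"
    by (metis Re_complex_of_real integral_complex_of_real)
  also have "\<dots> = (\<integral>p. Re (complex_of_real (gauss \<eta> (fst p - snd p)) * ?F p) \<partial>(lborel \<Otimes>\<^sub>M lborel))"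
    using integral_Re[OF G] by simp
  finally have eq: "(LINT \<xi>|lborel. (cmod (fourier_integral f \<xi>))\<^sup>2 * exp (- (\<eta> * (norm \<xi>)\<^sup>2 / 2))) =
     integral\<^sup>L (lborel \<Otimes>\<^sub>M lborel) (\<lambda>(x,y). (f x \<bullet> f y) * gauss \<eta> (x - y))"
    unfolding Re .
  have "integrable lborel (\<lambda>\<xi>. (cmod (fourier_integral f \<xi>))\<^sup>2 * exp (- (\<eta> * (norm \<xi>)\<^sup>2 / 2)))"
  proof -
    have "integrable lborel (\<lambda>\<xi>. 4 * pi\<^sup>2 * ((cmod (fourier_integral f \<xi>))\<^sup>2 * exp (- (\<eta> * (norm \<xi>)\<^sup>2 / 2))))"
      using Q.integrable_fst'[OF K] unfolding inner1 of_real_mult[symmetric] complex_of_real_integrable_eq .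
    then have "integrable lborel (\<lambda>\<xi>. 1 / (4 * pi\<^sup>2) * (4 * pi\<^sup>2 * ((cmod (fourier_integral f \<xi>))\<^sup>2 * exp (- (\<eta> * (norm \<xi>)\<^sup>2 / 2)))))"
      by (rule integrable_mult_right)
    moreover have "1 / (4 * pi\<^sup>2) * (4 * pi\<^sup>2 * r) = r" for r :: real by simp
    ultimately show ?thesis by (simp only:)
  qed
  with eq show "has_bochner_integral lborel (\<lambda>\<xi>. (cmod (fourier_integral f \<xi>))\<^sup>2 * exp (- (\<eta> * (norm \<xi>)\<^sup>2 / 2)))
     (integral\<^sup>L (lborel \<Otimes>\<^sub>M lborel) (\<lambda>(x,y). (f x \<bullet> f y) * gauss \<eta> (x - y)))"
    by (simp add: has_bochner_integral_iff)
qed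

text \<open>Bounding \<open>f x \<bullet> f y\<close> by half the sum of the squares and using the
  unit mass of the kernel gives a bound on the weighted square that is independent of \<eta>;
  Fatou's lemma then removes the weight.\<close>

lemma fourier_integral_contraction:
  assumes f: "integrable lborel f" "square_integrable f"
  shows "square_integrable (fourier_integral f)"
    and "norm (l2_of (fourier_integral f)) \<le> norm (l2_of f)"
proof -
  have [measurable]: "f \<in> borel_measurable borel" using f by auto
  have [measurable]: "fourier_integral f \<in> borel_measurable borel" by (rule fourier_integral_measurable) measurable
  have s: "integrable lborel (\<lambda>x. (cmod (f x))\<^sup>2 / 2)" using f(2) by (simp add: square_integrable_def)
  have 1: "(\<integral>\<^sup>+\<xi>. ennreal ((cmod (fourier_integral f \<xi>))\<^sup>2 * exp (- (\<eta> * (norm \<xi>)\<^sup>2 / 2))) \<partial>lborel)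
      \<le> ennreal ((norm (l2_of f))\<^sup>2)" if "\<eta> > 0" for \<eta>
  proof -
    have "integral\<^sup>L (lborel \<Otimes>\<^sub>M lborel) (\<lambda>(x,y). (f x \<bullet> f y) * gauss \<eta> (x - y)) \<le>
      integral\<^sup>L (lborel \<Otimes>\<^sub>M lborel) (\<lambda>p. (case p of (x,y) \<Rightarrow> (cmod (f x))\<^sup>2 / 2 * gauss \<eta> (x - y)) +
         (case p of (x,y) \<Rightarrow> (cmod (f y))\<^sup>2 / 2 * gauss \<eta> (x - y)))"
    proof (rule integral_mono)
      fix p :: "(real^2) \<times> (real^2)"
      obtain x y where p: "p = (x,y)" by force
      have "f x \<bullet> f y \<le> (cmod (f x))\<^sup>2 / 2 + (cmod (f y))\<^sup>2 / 2"
        using inner_ge_zero[of "f x - f y"] by (simp add: inner_diff power2_norm_eq_inner inner_commute)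
      then have "(f x \<bullet> f y) * gauss \<eta> (x - y) \<le> ((cmod (f x))\<^sup>2 / 2 + (cmod (f y))\<^sup>2 / 2) * gauss \<eta> (x - y)"
        using gauss_pos[OF that] by (intro mult_right_mono) (auto simp: less_imp_le)
      then show "(case p of (x,y) \<Rightarrow> (f x \<bullet> f y) * gauss \<eta> (x - y)) \<le> (case p of (x,y) \<Rightarrow> (cmod (f x))\<^sup>2 / 2 * gauss \<eta> (x - y)) +
         (case p of (x,y) \<Rightarrow> (cmod (f y))\<^sup>2 / 2 * gauss \<eta> (x - y))"
        by (simp add: p algebra_simps)
    qed (use fourier_integral_gauss(2)[OF f(1) that] gauss_convolution[OF that s] in auto)
    also have "\<dots> = (norm (l2_of f))\<^sup>2"
      using gauss_convolution[OF that s] by (simp add: norm_l2_of_sq[OF f(2)])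
    finally have le: "integral\<^sup>L (lborel \<Otimes>\<^sub>M lborel) (\<lambda>(x,y). (f x \<bullet> f y) * gauss \<eta> (x - y)) \<le> (norm (l2_of f))\<^sup>2" .
    have "(\<integral>\<^sup>+\<xi>. ennreal ((cmod (fourier_integral f \<xi>))\<^sup>2 * exp (- (\<eta> * (norm \<xi>)\<^sup>2 / 2))) \<partial>lborel) =
      ennreal (integral\<^sup>L (lborel \<Otimes>\<^sub>M lborel) (\<lambda>(x,y). (f x \<bullet> f y) * gauss \<eta> (x - y)))"
      using fourier_integral_gauss(1)[OF f(1) that] nn_integral_eq_integral
      by (subst nn_integral_eq_integral) (auto simp: has_bochner_integral_iff)
    then show ?thesis using le by (simp add: ennreal_leI)
  qed
  have "(\<integral>\<^sup>+\<xi>. ennreal ((cmod (fourier_integral f \<xi>))\<^sup>2) \<partial>lborel) =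
     (\<integral>\<^sup>+\<xi>. liminf (\<lambda>n. ennreal ((cmod (fourier_integral f \<xi>))\<^sup>2 * exp (- (inverse (real (Suc n)) * (norm \<xi>)\<^sup>2 / 2)))) \<partial>lborel)"
  proof (intro nn_integral_cong)
    fix \<xi> :: "real^2"
    have "(\<lambda>n. (cmod (fourier_integral f \<xi>))\<^sup>2 * exp (- (inverse (real (Suc n)) * (norm \<xi>)\<^sup>2 / 2))) \<longlonglongrightarrow>
       (cmod (fourier_integral f \<xi>))\<^sup>2 * exp (- (0 * (norm \<xi>)\<^sup>2 / 2))"
      by (intro tendsto_intros LIMSEQ_inverse_real_of_nat) auto
    then show "ennreal ((cmod (fourier_integral f \<xi>))\<^sup>2) = liminf (\<lambda>n. ennreal ((cmod (fourier_integral f \<xi>))\<^sup>2 * exp (- (inverse (real (Suc n)) * (norm \<xi>)\<^sup>2 / 2))))"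
      by (intro lim_imp_Liminf[symmetric] tendsto_ennrealI) simp_all
  qed
  also have "\<dots> \<le> liminf (\<lambda>n. \<integral>\<^sup>+\<xi>. ennreal ((cmod (fourier_integral f \<xi>))\<^sup>2 * exp (- (inverse (real (Suc n)) * (norm \<xi>)\<^sup>2 / 2))) \<partial>lborel)"
    by (rule nn_integral_liminf) measurable
  also have "\<dots> \<le> limsup (\<lambda>n. \<integral>\<^sup>+\<xi>. ennreal ((cmod (fourier_integral f \<xi>))\<^sup>2 * exp (- (inverse (real (Suc n)) * (norm \<xi>)\<^sup>2 / 2))) \<partial>lborel)"
    by (intro Liminf_le_Limsup) auto
  also have "\<dots> \<le> ennreal ((norm (l2_of f))\<^sup>2)"
    by (intro Limsup_bounded always_eventually allI 1) simp
  finally have le: "(\<integral>\<^sup>+\<xi>. ennreal ((cmod (fourier_integral f \<xi>))\<^sup>2) \<partial>lborel) \<le> ennreal ((norm (l2_of f))\<^sup>2)" .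
  show sq: "square_integrable (fourier_integral f)"
    by (rule square_integrableI) (use le_less_trans[OF le] in auto)
  have "(norm (l2_of (fourier_integral f)))\<^sup>2 \<le> (norm (l2_of f))\<^sup>2"
    using le unfolding nn_norm_l2_of[OF sq] by (subst (asm) ennreal_le_iff) auto
  then show "norm (l2_of (fourier_integral f)) \<le> norm (l2_of f)" by (rule power2_le_imp_le) simp
qed

text \<open>From s exp(-2s) \<le> exp(-s) with s = |z|^2 / (4\<eta>): the quadratic factor is traded
  for a doubled variance, so that only the mass of a Gaussian has to be known afterwards.\<close>

lemma gauss_second_moment_bound:
  assumes "\<eta> > 0"
  shows "(norm z)\<^sup>2 * gauss \<eta> z \<le> 8 * \<eta> * gauss (2 * \<eta>) z"
proof -
  let ?s = "(norm z)\<^sup>2 / (4 * \<eta>)"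
  have "?s \<le> exp ?s" using exp_ge_add_one_self[of ?s] by linarith
  then have "?s * exp (- (2 * ?s)) \<le> exp ?s * exp (- (2 * ?s))" by (intro mult_right_mono) auto
  also have "\<dots> = exp (- ?s)" by (simp flip: exp_add)
  finally have "4 * \<eta> / (2 * pi * \<eta>) * (?s * exp (- (2 * ?s))) \<le> 4 * \<eta> / (2 * pi * \<eta>) * exp (- ?s)"
    using assms by (intro mult_left_mono) auto
  moreover have "4 * \<eta> / (2 * pi * \<eta>) * (?s * exp (- (2 * ?s))) = (norm z)\<^sup>2 * gauss \<eta> z"
    using assms by (simp add: gauss_def)
  moreover have "4 * \<eta> / (2 * pi * \<eta>) * exp (- ?s) = 8 * \<eta> * gauss (2 * \<eta>) z"
    using assms by (simp add: gauss_def)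
  ultimately show ?thesis by simp
qed

text \<open>Lipschitz regularity is what the second moment bound can exploit, and the class contains
  the distance functions that approximate indicators of compact sets.\<close>

definition lipschitz_bump :: "(real^2 \<Rightarrow> complex) \<Rightarrow> bool" where
  "lipschitz_bump \<phi> \<longleftrightarrow> (\<exists>L R. (\<forall>x y. cmod (\<phi> x - \<phi> y) \<le> L * norm (x - y)) \<and> (\<forall>x. x \<notin> cball 0 R \<longrightarrow> \<phi> x = 0))"

lemma lipschitz_bump_integrable:
  assumes "lipschitz_bump \<phi>"
  shows "\<phi> \<in> borel_measurable borel" "integrable lborel \<phi>" "square_integrable \<phi>"
proof -
  obtain L R where L: "\<And>x y. cmod (\<phi> x - \<phi> y) \<le> L * norm (x - y)" and R: "\<And>x. x \<notin> cball 0 R \<Longrightarrow> \<phi> x = 0"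
    using assms unfolding lipschitz_bump_def by blast
  \<comment> \<open>The definition leaves the sign of \<open>L\<close> open; comparing two distinct
    points determines it.\<close>
  have "L * norm (1::real^2) \<ge> 0" using order_trans[OF norm_ge_zero L[of 1 0]] by simp
  then have "L \<ge> 0" by (simp add: zero_le_mult_iff)
  then have "L-lipschitz_on UNIV \<phi>" using L by (intro lipschitz_onI) (auto simp: dist_norm)
  then have c: "continuous_on UNIV \<phi>" by (rule lipschitz_on_continuous_on)
  then show m [measurable]: "\<phi> \<in> borel_measurable borel" by (rule borel_measurable_continuous_onI)
  have "compact (\<phi> ` cball 0 R)" by (intro compact_continuous_image continuous_on_subset[OF c]) auto
  then obtain B where B: "\<And>x. x \<in> cball 0 R \<Longrightarrow> cmod (\<phi> x) \<le> B" by (meson bounded_iff compact_imp_bounded image_eqI)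
  have i: "integrable lborel (\<lambda>x::real^2. indicator (cball 0 R) x * (c::real))" for c
    using emeasure_bounded_finite[OF bounded_cball, of "0::real^2" R]
    by (intro integrable_mult_left integrable_real_indicator) auto
  show "integrable lborel \<phi>"
  proof (rule Bochner_Integration.integrable_bound[OF i[of B]])
    have "cmod (\<phi> x) \<le> norm (indicator (cball 0 R) x * B)" for x
      using B[of x] R[of x] by (cases "x \<in> cball 0 R") (auto simp: indicator_def)
    then show "AE x in lborel. cmod (\<phi> x) \<le> norm (indicator (cball 0 R) x * B)" by simp
  qed measurable
  have "integrable lborel (\<lambda>x. (cmod (\<phi> x))\<^sup>2)"
  proof (rule Bochner_Integration.integrable_bound[OF i[of "B\<^sup>2"]])
    show "AE x in lborel. norm ((cmod (\<phi> x))\<^sup>2) \<le> norm (indicator (cball 0 R) x * B\<^sup>2)"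
      using B R by (auto simp: indicator_def intro!: power_mono)
  qed measurable
  then show "square_integrable \<phi>" by (simp add: square_integrable_def)
qed

text \<open>Polarisation writes the double integral as the norm minus half the integral of
  |\<phi>(x) - \<phi>(y)|^2 against the kernel. The Lipschitz bound and the second moment make this
  error of order \<eta>, which gives the inequality opposite to contraction.\<close>

lemma fourier_integral_bump_isometry:
  assumes "lipschitz_bump \<phi>"
  shows "norm (l2_of (fourier_integral \<phi>)) = norm (l2_of \<phi>)"
proof (rule antisym)
  note \<phi> = lipschitz_bump_integrable[OF assms]
  note fc = fourier_integral_contraction[OF \<phi>(2,3)]
  show "norm (l2_of (fourier_integral \<phi>)) \<le> norm (l2_of \<phi>)" by (rule fc(2))
  obtain L R where L: "\<And>x y. cmod (\<phi> x - \<phi> y) \<le> L * norm (x - y)" and R: "\<And>x. x \<notin> cball 0 R \<Longrightarrow> \<phi> x = 0"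
    using assms unfolding lipschitz_bump_def by blast
  let ?S = "cball (0::real^2) R"
  have i: "integrable lborel (\<lambda>x. indicator ?S x :: real)"
    using emeasure_bounded_finite[OF bounded_cball, of "0::real^2" R] by (intro integrable_real_indicator) auto
  have s: "integrable lborel (\<lambda>x. (cmod (\<phi> x))\<^sup>2 / 2)" using \<phi>(3) by (simp add: square_integrable_def)
  have 1: "(norm (l2_of \<phi>))\<^sup>2 - 8 * L\<^sup>2 * measure lborel ?S * \<eta> \<le> (norm (l2_of (fourier_integral \<phi>)))\<^sup>2" if "\<eta> > 0" for \<eta>
  proof -
    have e2: "2 * \<eta> > 0" using that by simp
    have i': "integrable lborel (\<lambda>x. 4 * \<eta> * L\<^sup>2 * indicator ?S x :: real)" using i by simp
    let ?A = "\<lambda>h \<eta> p. case p of (x,y) \<Rightarrow> (h x :: real) * gauss \<eta> (x - y)"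
    let ?B = "\<lambda>h \<eta> p. case p of (x,y) \<Rightarrow> (h y :: real) * gauss \<eta> (x - y)"
    \<comment> \<open>\<open>?i\<close> carries half of the \<open>8 * \<eta>\<close> from the
      second moment bound, the half coming from polarisation. \<open>?A\<close> and
      \<open>?B\<close> account for \<open>x\<close> or \<open>y\<close> lying in the support ball,
      so the total error is \<open>8 * L\<^sup>2 * measure lborel ?S * \<eta>\<close>.\<close>
    let ?s = "\<lambda>x. (cmod (\<phi> x))\<^sup>2 / 2" and ?i = "\<lambda>x. 4 * \<eta> * L\<^sup>2 * indicator ?S x"
    have "(norm (l2_of \<phi>))\<^sup>2 - 8 * L\<^sup>2 * measure lborel ?S * \<eta> =
       integral\<^sup>L (lborel \<Otimes>\<^sub>M lborel) (\<lambda>p. (?A ?s \<eta> p + ?B ?s \<eta> p) - (?A ?i (2*\<eta>) p + ?B ?i (2*\<eta>) p))"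
      using gauss_convolution[OF that s] gauss_convolution[OF e2 i']
      by (simp add: norm_l2_of_sq[OF \<phi>(3)])
    also have "\<dots> \<le> integral\<^sup>L (lborel \<Otimes>\<^sub>M lborel) (\<lambda>(x,y). (\<phi> x \<bullet> \<phi> y) * gauss \<eta> (x - y))"
    proof (rule integral_mono)
      show "integrable (lborel \<Otimes>\<^sub>M lborel) (\<lambda>p. (?A ?s \<eta> p + ?B ?s \<eta> p) - (?A ?i (2*\<eta>) p + ?B ?i (2*\<eta>) p))"
        by (intro Bochner_Integration.integrable_diff Bochner_Integration.integrable_add
            gauss_convolution[OF that s] gauss_convolution[OF e2 i'])
      fix p :: "(real^2) \<times> (real^2)"
      obtain x y where p: "p = (x,y)" by force
      have "(cmod (\<phi> x - \<phi> y))\<^sup>2 \<le> L\<^sup>2 * (norm (x - y))\<^sup>2 * (indicator ?S x + indicator ?S y)"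
      proof (cases "x \<in> ?S \<or> y \<in> ?S")
        case True
        then have "(1::real) \<le> indicator ?S x + indicator ?S y" by (auto simp: indicator_def)
        then have "L\<^sup>2 * (norm (x - y))\<^sup>2 * 1 \<le> L\<^sup>2 * (norm (x - y))\<^sup>2 * (indicator ?S x + indicator ?S y)"
          by (intro mult_left_mono) auto
        moreover have "(cmod (\<phi> x - \<phi> y))\<^sup>2 \<le> (L * norm (x - y))\<^sup>2" using L by (intro power_mono) auto
        ultimately show ?thesis by (simp add: power_mult_distrib)
      qed (use R in simp)
      then have "(cmod (\<phi> x - \<phi> y))\<^sup>2 * gauss \<eta> (x - y) \<le> L\<^sup>2 * (norm (x - y))\<^sup>2 * (indicator ?S x + indicator ?S y) * gauss \<eta> (x - y)"
        using gauss_pos[OF that] by (intro mult_right_mono) (auto simp: less_imp_le)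
      also have "\<dots> = (L\<^sup>2 * (indicator ?S x + indicator ?S y)) * ((norm (x - y))\<^sup>2 * gauss \<eta> (x - y))" by (simp add: algebra_simps)
      also have "\<dots> \<le> (L\<^sup>2 * (indicator ?S x + indicator ?S y)) * (8 * \<eta> * gauss (2 * \<eta>) (x - y))"
        by (intro mult_left_mono gauss_second_moment_bound that mult_nonneg_nonneg) (auto simp: indicator_def)
      finally have a: "(cmod (\<phi> x - \<phi> y))\<^sup>2 * gauss \<eta> (x - y) \<le> 8 * \<eta> * L\<^sup>2 * (indicator ?S x + indicator ?S y) * gauss (2 * \<eta>) (x - y)"
        by (simp add: algebra_simps)
      have "\<phi> x \<bullet> \<phi> y = ?s x + ?s y - (cmod (\<phi> x - \<phi> y))\<^sup>2 / 2"
        by (simp add: inner_diff power2_norm_eq_inner inner_commute field_simps)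
      then have "(\<phi> x \<bullet> \<phi> y) * gauss \<eta> (x - y) = ?s x * gauss \<eta> (x - y) + ?s y * gauss \<eta> (x - y) - ((cmod (\<phi> x - \<phi> y))\<^sup>2 * gauss \<eta> (x - y)) / 2"
        by (simp only: left_diff_distrib distrib_right times_divide_eq_left)
      with a show "(?A ?s \<eta> p + ?B ?s \<eta> p) - (?A ?i (2*\<eta>) p + ?B ?i (2*\<eta>) p) \<le> (case p of (x,y) \<Rightarrow> (\<phi> x \<bullet> \<phi> y) * gauss \<eta> (x - y))"
        unfolding p by (simp add: algebra_simps)
    qed (rule fourier_integral_gauss(2)[OF \<phi>(2) that])
    also have "\<dots> = (LINT \<xi>|lborel. (cmod (fourier_integral \<phi> \<xi>))\<^sup>2 * exp (- (\<eta> * (norm \<xi>)\<^sup>2 / 2)))"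
      using fourier_integral_gauss(1)[OF \<phi>(2) that] by (simp add: has_bochner_integral_iff)
    also have "\<dots> \<le> (LINT \<xi>|lborel. (cmod (fourier_integral \<phi> \<xi>))\<^sup>2)"
    proof (rule integral_mono)
      show "integrable lborel (\<lambda>\<xi>. (cmod (fourier_integral \<phi> \<xi>))\<^sup>2 * exp (- (\<eta> * (norm \<xi>)\<^sup>2 / 2)))"
        using fourier_integral_gauss(1)[OF \<phi>(2) that] by (simp add: has_bochner_integral_iff)
      show "integrable lborel (\<lambda>\<xi>. (cmod (fourier_integral \<phi> \<xi>))\<^sup>2)" using fc(1) by (simp add: square_integrable_def)
      show "(cmod (fourier_integral \<phi> \<xi>))\<^sup>2 * exp (- (\<eta> * (norm \<xi>)\<^sup>2 / 2)) \<le> (cmod (fourier_integral \<phi> \<xi>))\<^sup>2" for \<xi>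
        using that by (intro mult_left_le) auto
    qed
    finally show ?thesis by (simp add: norm_l2_of_sq[OF fc(1)])
  qed
  have "(norm (l2_of \<phi>))\<^sup>2 \<le> (norm (l2_of (fourier_integral \<phi>)))\<^sup>2"
  proof (rule tendsto_upperbound)
    show "((\<lambda>n. (norm (l2_of \<phi>))\<^sup>2 - 8 * L\<^sup>2 * measure lborel ?S * inverse (real (Suc n))) \<longlongrightarrow> (norm (l2_of \<phi>))\<^sup>2) sequentially"
    proof -
      have "((\<lambda>n. (norm (l2_of \<phi>))\<^sup>2 - 8 * L\<^sup>2 * measure lborel ?S * inverse (real (Suc n))) \<longlongrightarrow>
          (norm (l2_of \<phi>))\<^sup>2 - 8 * L\<^sup>2 * measure lborel ?S * 0) sequentially"
        by (intro tendsto_intros LIMSEQ_inverse_real_of_nat)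
      then show ?thesis by simp
    qed
    show "\<forall>\<^sub>F n in sequentially. (norm (l2_of \<phi>))\<^sup>2 - 8 * L\<^sup>2 * measure lborel ?S * inverse (real (Suc n)) \<le> (norm (l2_of (fourier_integral \<phi>)))\<^sup>2"
      by (intro always_eventually allI 1) simp
  qed simp
  then show "norm (l2_of \<phi>) \<le> norm (l2_of (fourier_integral \<phi>))" by (rule power2_le_imp_le) simp
qed

section \<open>Extension of the transform to L^2\<close>

lemma fourier_integral_cong_AE:
  assumes "AE x in lborel. f x = g x" "f \<in> borel_measurable borel" "g \<in> borel_measurable borel"
  shows "fourier_integral f \<xi> = fourier_integral g \<xi>"
proof -
  have [measurable]: "f \<in> borel_measurable borel" "g \<in> borel_measurable borel" by fact+
  have "(LINT x|lborel. exp (- \<i> * complex_of_real (\<xi> \<bullet> x)) * f x) = (LINT x|lborel. exp (- \<i> * complex_of_real (\<xi> \<bullet> x)) * g x)"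
    by (rule integral_cong_AE) (measurable, use assms(1) in \<open>auto elim: eventually_mono\<close>)
  then show ?thesis by (simp add: fourier_integral_def)
qed

lemma fourier_integral_diff:
  assumes "integrable lborel f" "integrable lborel g"
  shows "fourier_integral (\<lambda>x. f x - g x) \<xi> = fourier_integral f \<xi> - fourier_integral g \<xi>"
  unfolding fourier_integral_def right_diff_distrib
    Bochner_Integration.integral_diff[OF fourier_integrable[OF assms(1)] fourier_integrable[OF assms(2)]] ..

lemma fourier_integral_cmult: "fourier_integral (\<lambda>x. c * f x) \<xi> = c * fourier_integral f \<xi>"
proof -
  have "(LINT x|lborel. exp (- \<i> * complex_of_real (\<xi> \<bullet> x)) * (c * f x)) =
      (LINT x|lborel. c * (exp (- \<i> * complex_of_real (\<xi> \<bullet> x)) * f x))"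
    by (simp only: mult_ac)
  then show ?thesis by (simp add: fourier_integral_def)
qed

lemma norm_fourier_integral_diff_le:
  assumes "integrable lborel f" "square_integrable f" "integrable lborel g" "square_integrable g"
  shows "norm (l2_of (fourier_integral f) - l2_of (fourier_integral g)) \<le> norm (l2_of f - l2_of g)"
proof -
  have "l2_of (fourier_integral f) - l2_of (fourier_integral g) = l2_of (\<lambda>\<xi>. fourier_integral f \<xi> - fourier_integral g \<xi>)"
    by (intro l2_of_diff[symmetric] fourier_integral_contraction assms)
  also have "\<dots> = l2_of (fourier_integral (\<lambda>x. f x - g x))"
    using fourier_integral_diff[OF assms(1,3)] by (intro arg_cong[of _ _ l2_of] ext) simp
  also have "norm \<dots> \<le> norm (l2_of (\<lambda>x. f x - g x))"
    by (intro fourier_integral_contraction square_integrable_diff Bochner_Integration.integrable_diff assms)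
  finally show ?thesis by (simp add: l2_of_diff assms)
qed

lemma cutoff_tendsto: "((\<lambda>R. l2_of (cutoff R f)) \<longlongrightarrow> f) at_top"
proof (rule tendsto_at_topI_sequentially)
  fix X :: "nat \<Rightarrow> real" assume X: "filterlim X at_top sequentially"
  have "(\<lambda>n. l2_of (cutoff (X n) f)) \<longlonglongrightarrow> l2_of (rep_l2 f)"
  proof (rule l2_dominated[OF cutoff_measurable square_integrable_rep_l2 square_integrable_rep_l2])
    show "AE x in lborel. (\<lambda>n. cutoff (X n) f x) \<longlonglongrightarrow> rep_l2 f x"
    proof (intro always_eventually allI)
      fix x :: "real^2"
      have "\<forall>\<^sub>F n in sequentially. norm x \<le> X n" using X by (simp add: filterlim_at_top)
      then have "\<forall>\<^sub>F n in sequentially. cutoff (X n) f x = rep_l2 f x"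
        by eventually_elim (simp add: cutoff_def)
      then show "(\<lambda>n. cutoff (X n) f x) \<longlonglongrightarrow> rep_l2 f x" by (rule tendsto_eventually)
    qed
  qed (auto simp: cutoff_def indicator_def)
  then show "(\<lambda>n. l2_of (cutoff (X n) f)) \<longlonglongrightarrow> f" by (simp add: l2_of_rep_l2)
qed

text \<open>Restates the definition as norm convergence in \<open>l2\<close>, so that limits can be
  taken through continuous linear maps and inner products.\<close>

lemma has_fourier_iff:
  "has_fourier f g \<longleftrightarrow> ((\<lambda>R. l2_of (fourier_integral (cutoff R f))) \<longlongrightarrow> g) at_top"
proof -
  note sq = fourier_integral_contraction(1)[OF cutoff_integrable square_integrable_cutoff]
  have "(\<integral>\<^sup>+\<xi>. ennreal ((cmod (fourier_integral (cutoff R f) \<xi> - rep_l2 g \<xi>))\<^sup>2) \<partial>lborel) =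
      ennreal ((norm (l2_of (fourier_integral (cutoff R f)) - g))\<^sup>2)" for R
    by (subst nn_norm_l2_of[OF square_integrable_diff[OF sq square_integrable_rep_l2]])
      (simp add: l2_of_diff[OF sq square_integrable_rep_l2] l2_of_rep_l2)
  then have "has_fourier f g \<longleftrightarrow> ((\<lambda>R. ennreal ((norm (l2_of (fourier_integral (cutoff R f)) - g))\<^sup>2)) \<longlongrightarrow> ennreal 0) at_top"
    by (simp add: has_fourier_def)
  also have "\<dots> \<longleftrightarrow> ((\<lambda>R. (norm (l2_of (fourier_integral (cutoff R f)) - g))\<^sup>2) \<longlongrightarrow> 0) at_top"
    by (rule tendsto_ennreal_iff) auto
  also have "\<dots> \<longleftrightarrow> ((\<lambda>R. norm (l2_of (fourier_integral (cutoff R f)) - g)) \<longlongrightarrow> 0) at_top"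
    by (simp add: power_tendsto_0_iff)
  finally show ?thesis by (simp add: tendsto_norm_zero_iff LIM_zero_iff)
qed

text \<open>Contraction transfers the Cauchy property from the cutoffs to their transforms. This is
  the existence half of well-definedness for the description in \<open>fourier\<close>.\<close>

lemma fourier_cutoff_tendsto: "((\<lambda>R. l2_of (fourier_integral (cutoff R f))) \<longlongrightarrow> fourier f) at_top"
proof -
  let ?G = "\<lambda>R. l2_of (fourier_integral (cutoff R f))" and ?c = "\<lambda>R. l2_of (cutoff R f)"
  have le: "norm (?G R - ?G S) \<le> norm (?c R - ?c S)" for R S
    by (intro norm_fourier_integral_diff_le cutoff_integrable square_integrable_cutoff)
  have cn: "(\<lambda>n. ?c (real n)) \<longlonglongrightarrow> f"
    using filterlim_compose[OF cutoff_tendsto filterlim_real_sequentially] .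
  then have "Cauchy (\<lambda>n. ?c (real n))" by (rule LIMSEQ_imp_Cauchy)
  then have "Cauchy (\<lambda>n. ?G (real n))"
    unfolding Cauchy_def dist_norm using le by (meson le_less_trans)
  then obtain g where g: "(\<lambda>n. ?G (real n)) \<longlonglongrightarrow> g"
    using Cauchy_convergent_iff convergent_def by blast
  \<comment> \<open>The second radius is sent to infinity along the integers, which upgrades the
    sequential limit to one along all real radii.\<close>
  have "norm (?G R - g) \<le> norm (?c R - f)" for R
  proof (rule LIMSEQ_le)
    show "(\<lambda>n. norm (?G R - ?G (real n))) \<longlonglongrightarrow> norm (?G R - g)" by (intro tendsto_intros g)
    show "(\<lambda>n. norm (?c R - ?c (real n))) \<longlonglongrightarrow> norm (?c R - f)" by (intro tendsto_intros cn)
  qed (use le in auto)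
  moreover have "((\<lambda>R. norm (?c R - f)) \<longlongrightarrow> 0) at_top"
    using tendsto_norm_zero[OF LIM_zero[OF cutoff_tendsto[of f]]] .
  ultimately have "((\<lambda>R. ?G R - g) \<longlongrightarrow> 0) at_top"
    by (intro Lim_null_comparison[of "\<lambda>R. ?G R - g" "\<lambda>R. norm (?c R - f)"]) auto
  then have lim: "(?G \<longlongrightarrow> g) at_top" by (rule LIM_zero_cancel)
  then have "fourier f = g" by (intro fourier_eqI) (simp add: has_fourier_iff)
  with lim show ?thesis by simp
qed

lemma has_fourier_fourier: "has_fourier f (fourier f)"
  by (simp add: has_fourier_iff fourier_cutoff_tendsto)

lemma has_fourier_eq: "has_fourier f g \<longleftrightarrow> fourier f = g"
  using has_fourier_fourier fourier_eqI by blast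

lemma fourier_add: "fourier (f + g) = fourier f + fourier g"
  by (intro fourier_eqI has_fourier_add has_fourier_fourier)

lemma fourier_scaleR: "fourier (c *\<^sub>R f) = c *\<^sub>R fourier f"
  by (intro fourier_eqI has_fourier_scaleR has_fourier_fourier)

lemma norm_fourier_le: "norm (fourier f) \<le> norm f"
proof (rule tendsto_le)
  show "((\<lambda>R. norm (l2_of (fourier_integral (cutoff R f)))) \<longlongrightarrow> norm (fourier f)) at_top"
    by (intro tendsto_intros fourier_cutoff_tendsto)
  show "((\<lambda>R. norm (l2_of (cutoff R f))) \<longlongrightarrow> norm f) at_top"
    by (intro tendsto_intros cutoff_tendsto)
  show "\<forall>\<^sub>F R in at_top. norm (l2_of (fourier_integral (cutoff R f))) \<le> norm (l2_of (cutoff R f))"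
    by (intro always_eventually allI fourier_integral_contraction cutoff_integrable square_integrable_cutoff)
qed simp

lemma bounded_linear_fourier: "bounded_linear fourier"
  using norm_fourier_le by (intro bounded_linear_intro[of _ 1]) (auto simp: fourier_add fourier_scaleR)

text \<open>The transforms of the cutoffs converge in L^2 to the one and pointwise, by dominated
  convergence, to the other.\<close>

lemma fourier_l2_of:
  assumes f: "integrable lborel f" "square_integrable f"
  shows "fourier (l2_of f) = l2_of (fourier_integral f)"
proof -
  have [measurable]: "f \<in> borel_measurable borel" using f by auto
  have "(\<lambda>n. l2_of (fourier_integral (cutoff (real n) (l2_of f)))) \<longlonglongrightarrow> fourier (l2_of f)"
    using filterlim_compose[OF fourier_cutoff_tendsto filterlim_real_sequentially] .
  then have "AE \<xi> in lborel. rep_l2 (fourier (l2_of f)) \<xi> = fourier_integral f \<xi>"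
  proof (rule l2_tendsto_AE_unique)
    show "square_integrable (fourier_integral (cutoff (real n) (l2_of f)))" for n
      by (intro fourier_integral_contraction cutoff_integrable square_integrable_cutoff)
    have eq: "fourier_integral (cutoff (real n) (l2_of f)) \<xi> = fourier_integral (\<lambda>x. indicator (cball 0 (real n)) x * f x) \<xi>" for n \<xi>
    proof (rule fourier_integral_cong_AE)
      show "AE x in lborel. cutoff (real n) (l2_of f) x = indicator (cball 0 (real n)) x * f x"
        using rep_l2_of[OF f(2)] by eventually_elim (simp add: cutoff_def)
      show "cutoff (real n) (l2_of f) \<in> borel_measurable borel" using cutoff_measurable by simp
      show "(\<lambda>x. indicator (cball 0 (real n)) x * f x) \<in> borel_measurable borel"
        by (intro borel_measurable_times borel_measurable_indicator borel_closed closed_cball) fact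
    qed
    have "(\<lambda>n. LINT x|lborel. exp (- \<i> * complex_of_real (\<xi> \<bullet> x)) * (indicator (cball 0 (real n)) x * f x)) \<longlonglongrightarrow>
        (LINT x|lborel. exp (- \<i> * complex_of_real (\<xi> \<bullet> x)) * f x)" for \<xi>
    proof (rule integral_dominated_convergence[where w="\<lambda>x. norm (f x)"])
      show "AE x in lborel. (\<lambda>n. exp (- \<i> * complex_of_real (\<xi> \<bullet> x)) * (indicator (cball 0 (real n)) x * f x)) \<longlonglongrightarrow>
         exp (- \<i> * complex_of_real (\<xi> \<bullet> x)) * f x"
      proof (rule always_eventually, rule allI, rule tendsto_eventually)
        fix x :: "real^2"
        obtain N where "norm x \<le> real N" using real_arch_simple by blast
        then have "norm x \<le> real n" if "n \<ge> N" for n using that by (meson of_nat_le_iff order_trans)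
        then have "\<forall>\<^sub>F n in sequentially. norm x \<le> real n"
          using eventually_ge_at_top[of N] by (rule eventually_mono[rotated])
        then show "\<forall>\<^sub>F n in sequentially. exp (- \<i> * complex_of_real (\<xi> \<bullet> x)) * (indicator (cball 0 (real n)) x * f x) =
            exp (- \<i> * complex_of_real (\<xi> \<bullet> x)) * f x"
          by eventually_elim simp
      qed
    qed (use f in \<open>auto simp: norm_mult indicator_def\<close>)
    then show "AE \<xi> in lborel. (\<lambda>n. fourier_integral (cutoff (real n) (l2_of f)) \<xi>) \<longlonglongrightarrow> fourier_integral f \<xi>"
      unfolding eq unfolding fourier_integral_def by (intro always_eventually allI tendsto_mult tendsto_const)
  qed
  then show ?thesis
    by (rule l2_eq_l2_ofI[OF fourier_integral_contraction(1)[OF f]])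
qed

section \<open>Reflections and translations on L^2\<close>

definition reflect_l2 :: "l2 \<Rightarrow> l2" where
  "reflect_l2 f = l2_of (\<lambda>x. rep_l2 f (- x))"

definition translate_l2 :: "real^2 \<Rightarrow> l2 \<Rightarrow> l2" where
  "translate_l2 a f = l2_of (\<lambda>x. rep_l2 f (a + x))"

lemma AE_affine_isometry:
  fixes t :: "'a::euclidean_space"
  assumes "c = 1 \<or> c = -1" "AE x in lborel. P x"
  shows "AE x in lborel. P (t + c *\<^sub>R x)"
proof -
  have "AE x in distr lborel borel (\<lambda>x. t + c *\<^sub>R x). P x"
    using assms(2) unfolding lborel_distr_reflect[OF assms(1)] .
  then obtain N where N: "N \<in> null_sets (distr lborel borel (\<lambda>x. t + c *\<^sub>R x))" "{x. \<not> P x} \<subseteq> N"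
    unfolding eventually_ae_filter by auto
  have "(\<lambda>x. t + c *\<^sub>R x) -` N \<inter> space lborel \<in> null_sets lborel"
    using N(1) by (subst (asm) null_sets_distr_iff) auto
  then show ?thesis using N(2) unfolding eventually_ae_filter by (intro bexI) auto
qed

lemma square_integrable_affine_isometry:
  assumes "c = 1 \<or> c = -1" "square_integrable f"
  shows "square_integrable (\<lambda>x. f (t + c *\<^sub>R x))"
    and "norm (l2_of (\<lambda>x. f (t + c *\<^sub>R x))) = norm (l2_of f)"
proof -
  have [measurable]: "f \<in> borel_measurable borel" using square_integrable_measurable[OF assms(2)] by simp
  have "has_bochner_integral lborel (\<lambda>x. (cmod (f x))\<^sup>2) ((norm (l2_of f))\<^sup>2)"
    using assms(2) by (simp add: norm_l2_of_sq has_bochner_integral_iff square_integrable_def)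
  from has_bochner_integral_affine_isometry[OF assms(1) this, of t]
  have *: "integrable lborel (\<lambda>x. (cmod (f (t + c *\<^sub>R x)))\<^sup>2)"
     "(LINT x|lborel. (cmod (f (t + c *\<^sub>R x)))\<^sup>2) = (norm (l2_of f))\<^sup>2"
    by (auto simp: has_bochner_integral_iff)
  show sq: "square_integrable (\<lambda>x. f (t + c *\<^sub>R x))"
    using *(1) unfolding square_integrable_def by (intro conjI) measurable
  show "norm (l2_of (\<lambda>x. f (t + c *\<^sub>R x))) = norm (l2_of f)"
    using norm_l2_of_sq[OF sq] *(2) by (simp add: power2_eq_iff_nonneg)
qed

lemma rep_reflect_l2: "AE x in lborel. rep_l2 (reflect_l2 f) x = rep_l2 f (- x)"
  unfolding reflect_l2_def
  using rep_l2_of[OF square_integrable_affine_isometry(1)[OF _ square_integrable_rep_l2, where c="-1" and t=0]] by simp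

lemma rep_translate_l2: "AE x in lborel. rep_l2 (translate_l2 a f) x = rep_l2 f (a + x)"
  unfolding translate_l2_def
  using rep_l2_of[OF square_integrable_affine_isometry(1)[OF _ square_integrable_rep_l2, where c=1 and t=a]] by simp

lemma reflect_l2_of:
  assumes "square_integrable f"
  shows "reflect_l2 (l2_of f) = l2_of (\<lambda>x. f (- x))"
  unfolding reflect_l2_def
proof (rule l2_of_eqI)
  show "square_integrable (\<lambda>x. rep_l2 (l2_of f) (- x))"
    using square_integrable_affine_isometry(1)[OF _ square_integrable_rep_l2, where c="-1" and t=0] by simp
  show "square_integrable (\<lambda>x. f (- x))"
    using square_integrable_affine_isometry(1)[OF _ assms, where c="-1" and t=0] by simp
  show "AE x in lborel. rep_l2 (l2_of f) (- x) = f (- x)"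
    using AE_affine_isometry[OF _ rep_l2_of[OF assms], where c="-1" and t=0] by simp
qed

lemma translate_l2_of:
  assumes "square_integrable f"
  shows "translate_l2 a (l2_of f) = l2_of (\<lambda>x. f (a + x))"
  unfolding translate_l2_def
proof (rule l2_of_eqI)
  show "square_integrable (\<lambda>x. rep_l2 (l2_of f) (a + x))"
    using square_integrable_affine_isometry(1)[OF _ square_integrable_rep_l2, where c=1 and t=a] by simp
  show "square_integrable (\<lambda>x. f (a + x))"
    using square_integrable_affine_isometry(1)[OF _ assms, where c=1 and t=a] by simp
  show "AE x in lborel. rep_l2 (l2_of f) (a + x) = f (a + x)"
    using AE_affine_isometry[OF _ rep_l2_of[OF assms], where c=1 and t=a] by simp
qed

lemma norm_reflect_l2: "norm (reflect_l2 f) = norm f"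
  using square_integrable_affine_isometry(2)[OF _ square_integrable_rep_l2, where c="-1" and t=0]
  by (simp add: reflect_l2_def l2_of_rep_l2)

lemma norm_translate_l2: "norm (translate_l2 a f) = norm f"
  using square_integrable_affine_isometry(2)[OF _ square_integrable_rep_l2, where c=1 and t=a]
  by (simp add: translate_l2_def l2_of_rep_l2)

lemma reflect_reflect_l2: "reflect_l2 (reflect_l2 f) = f"
proof (rule l2_eqI)
  show "AE x in lborel. rep_l2 (reflect_l2 (reflect_l2 f)) x = rep_l2 f x"
    using rep_reflect_l2[of "reflect_l2 f"] AE_affine_isometry[OF _ rep_reflect_l2[of f], where c="-1" and t=0, simplified]
    by eventually_elim simp
qed

lemma bounded_linear_reflect_l2: "bounded_linear reflect_l2"
proof (rule bounded_linear_intro[of _ 1])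
  show "reflect_l2 (f + g) = reflect_l2 f + reflect_l2 g" for f g
  proof (rule l2_eqI)
    show "AE x in lborel. rep_l2 (reflect_l2 (f + g)) x = rep_l2 (reflect_l2 f + reflect_l2 g) x"
      using rep_reflect_l2[of "f + g"] rep_reflect_l2[of f] rep_reflect_l2[of g]
        rep_l2_add[of "reflect_l2 f" "reflect_l2 g"] AE_affine_isometry[OF _ rep_l2_add[of f g], where c="-1" and t=0, simplified]
      by eventually_elim simp
  qed
  show "reflect_l2 (c *\<^sub>R f) = c *\<^sub>R reflect_l2 f" for c f
  proof (rule l2_eqI)
    show "AE x in lborel. rep_l2 (reflect_l2 (c *\<^sub>R f)) x = rep_l2 (c *\<^sub>R reflect_l2 f) x"
      using rep_reflect_l2[of "c *\<^sub>R f"] rep_reflect_l2[of f]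
        rep_l2_scaleR[of c "reflect_l2 f"] AE_affine_isometry[OF _ rep_l2_scaleR[of c f], where c="-1" and t=0, simplified]
      by eventually_elim simp
  qed
qed (simp add: norm_reflect_l2)

lemma bounded_linear_translate_l2: "bounded_linear (translate_l2 a)"
proof (rule bounded_linear_intro[of _ 1])
  show "translate_l2 a (f + g) = translate_l2 a f + translate_l2 a g" for f g
  proof (rule l2_eqI)
    show "AE x in lborel. rep_l2 (translate_l2 a (f + g)) x = rep_l2 (translate_l2 a f + translate_l2 a g) x"
      using rep_translate_l2[of a "f + g"] rep_translate_l2[of a f] rep_translate_l2[of a g]
        rep_l2_add[of "translate_l2 a f" "translate_l2 a g"] AE_affine_isometry[OF _ rep_l2_add[of f g], where c=1 and t=a, simplified]
      by eventually_elim simp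
  qed
  show "translate_l2 a (c *\<^sub>R f) = c *\<^sub>R translate_l2 a f" for c f
  proof (rule l2_eqI)
    show "AE x in lborel. rep_l2 (translate_l2 a (c *\<^sub>R f)) x = rep_l2 (c *\<^sub>R translate_l2 a f) x"
      using rep_translate_l2[of a "c *\<^sub>R f"] rep_translate_l2[of a f]
        rep_l2_scaleR[of c "translate_l2 a f"] AE_affine_isometry[OF _ rep_l2_scaleR[of c f], where c=1 and t=a, simplified]
      by eventually_elim simp
  qed
qed (simp add: norm_translate_l2)

section \<open>The adjoint of the transform and Fourier inversion\<close>

lemma integrable_cmult_cancel:
  fixes c :: complex
  assumes "integrable M (\<lambda>x. c * f x)" "c \<noteq> 0"
  shows "integrable M f"
  using integrable_mult_right[OF assms(1), of "1 / c"] assms(2) by simp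

text \<open>Fubini for the exponential kernel: conjugating it amounts to reflecting one argument, so
  the adjoint of the transform is the reflected transform. The complex identity is proved first
  because \<open>inner\<close> on \<open>complex\<close> is only its real part.\<close>

lemma fourier_integral_adjoint:
  assumes f: "integrable lborel f" "square_integrable f" and g: "integrable lborel g" "square_integrable g"
  shows "l2_of (fourier_integral f) \<bullet> l2_of g = l2_of f \<bullet> reflect_l2 (l2_of (fourier_integral g))"
proof -
  have [measurable]: "f \<in> borel_measurable borel" "g \<in> borel_measurable borel" "cnj \<in> borel_measurable borel"
    using f g by (auto intro!: borel_measurable_continuous_onI continuous_intros)
  note fc = fourier_integral_contraction(1)[OF f] and gc = fourier_integral_contraction(1)[OF g]
  have rc: "square_integrable (\<lambda>x. fourier_integral g (- x))"
    using square_integrable_affine_isometry(1)[OF _ gc, where c="-1" and t=0] by simp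
  let ?K = "\<lambda>x \<xi>. exp (- \<i> * complex_of_real (\<xi> \<bullet> x)) * (f x * cnj (g \<xi>))"
  have cg: "integrable lborel (\<lambda>x. cnj (g x))" unfolding complex_integrable_cnj by (rule g(1))
  have K: "integrable (lborel \<Otimes>\<^sub>M lborel) (\<lambda>(x, \<xi>). ?K x \<xi>)"
  proof (rule Bochner_Integration.integrable_bound[OF integrable_lborel_pair_prod[OF f(1) cg]])
    show "(\<lambda>(x, \<xi>). ?K x \<xi>) \<in> borel_measurable (lborel \<Otimes>\<^sub>M lborel)" by measurable
  qed (auto simp: norm_mult)
  have 1: "(LINT x|lborel. ?K x \<xi>) = complex_of_real (2 * pi) * (fourier_integral f \<xi> * cnj (g \<xi>))" for \<xi>
  proof -
    have "(LINT x|lborel. ?K x \<xi>) = (LINT x|lborel. (exp (- \<i> * complex_of_real (\<xi> \<bullet> x)) * f x) * cnj (g \<xi>))"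
      by (simp only: mult.assoc)
    then show ?thesis by (simp add: fourier_integral_def)
  qed
  have 2: "(LINT \<xi>|lborel. ?K x \<xi>) = complex_of_real (2 * pi) * (f x * cnj (fourier_integral g (- x)))" for x
  proof -
    have E: "exp (- \<i> * complex_of_real (\<xi> \<bullet> x)) = cnj (exp (- \<i> * complex_of_real ((- x) \<bullet> \<xi>)))" for \<xi>
      by (simp add: exp_cnj inner_commute)
    have "(LINT \<xi>|lborel. ?K x \<xi>) = (LINT \<xi>|lborel. f x * cnj (exp (- \<i> * complex_of_real ((- x) \<bullet> \<xi>)) * g \<xi>))"
      by (simp only: E complex_cnj_mult mult_ac)
    also have "\<dots> = f x * cnj (LINT \<xi>|lborel. exp (- \<i> * complex_of_real ((- x) \<bullet> \<xi>)) * g \<xi>)"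
      by (simp only: integral_mult_right_zero Bochner_Integration.integral_cnj)
    also have "(LINT \<xi>|lborel. exp (- \<i> * complex_of_real ((- x) \<bullet> \<xi>)) * g \<xi>) = complex_of_real (2 * pi) * fourier_integral g (- x)"
      by (simp add: fourier_integral_def)
    finally show ?thesis by simp
  qed
  have "(LINT \<xi>|lborel. (LINT x|lborel. ?K x \<xi>)) = (LINT x|lborel. (LINT \<xi>|lborel. ?K x \<xi>))"
    by (rule lborel_pair.Fubini_integral[OF K])
  then have eq: "(LINT \<xi>|lborel. fourier_integral f \<xi> * cnj (g \<xi>)) = (LINT x|lborel. f x * cnj (fourier_integral g (- x)))"
    unfolding 1 2 integral_mult_right_zero by simp
  have i1: "integrable lborel (\<lambda>\<xi>. fourier_integral f \<xi> * cnj (g \<xi>))"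
    using lborel_pair.integrable_snd[OF K] unfolding 1 by (rule integrable_cmult_cancel) simp
  have i2: "integrable lborel (\<lambda>x. f x * cnj (fourier_integral g (- x)))"
    using lborel_pair.integrable_fst[OF K] unfolding 2 by (rule integrable_cmult_cancel) simp
  have Re: "a \<bullet> b = Re (a * cnj b)" for a b :: complex by (simp add: inner_complex_def)
  have "l2_of (fourier_integral f) \<bullet> l2_of g = (LINT \<xi>|lborel. Re (fourier_integral f \<xi> * cnj (g \<xi>)))"
    by (simp only: inner_l2_of[OF fc g(2)] Re)
  also have "\<dots> = (LINT x|lborel. Re (f x * cnj (fourier_integral g (- x))))"
    using eq by (simp only: integral_Re[OF i1] integral_Re[OF i2])
  also have "\<dots> = l2_of f \<bullet> reflect_l2 (l2_of (fourier_integral g))"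
    by (simp only: reflect_l2_of[OF gc] inner_l2_of[OF f(2) rc] Re)
  finally show ?thesis .
qed

lemma fourier_adjoint: "fourier f \<bullet> g = f \<bullet> reflect_l2 (fourier g)"
proof (rule tendsto_unique[OF trivial_limit_at_top_linorder])
  let ?I = "\<lambda>R h. l2_of (fourier_integral (cutoff R h))"
  show "((\<lambda>R. ?I R f \<bullet> l2_of (cutoff R g)) \<longlongrightarrow> fourier f \<bullet> g) at_top"
    by (intro tendsto_intros fourier_cutoff_tendsto cutoff_tendsto)
  have "((\<lambda>R. l2_of (cutoff R f) \<bullet> reflect_l2 (?I R g)) \<longlongrightarrow> f \<bullet> reflect_l2 (fourier g)) at_top"
    by (intro tendsto_intros fourier_cutoff_tendsto cutoff_tendsto bounded_linear.tendsto[OF bounded_linear_reflect_l2])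
  then show "((\<lambda>R. ?I R f \<bullet> l2_of (cutoff R g)) \<longlongrightarrow> f \<bullet> reflect_l2 (fourier g)) at_top"
    by (simp add: fourier_integral_adjoint cutoff_integrable square_integrable_cutoff)
qed

text \<open>With A the contractive adjoint of the transform F, isometry at u gives |A F u - u|^2
  \<le> |u|^2 - 2 |F u|^2 + |u|^2 = 0.\<close>

lemma fourier_bump_inversion:
  assumes "lipschitz_bump \<phi>"
  shows "reflect_l2 (fourier (fourier (l2_of \<phi>))) = l2_of \<phi>"
proof -
  let ?u = "l2_of \<phi>" and ?A = "\<lambda>f. reflect_l2 (fourier f)"
  have iso: "norm (fourier ?u) = norm ?u"
    using fourier_integral_bump_isometry[OF assms] lipschitz_bump_integrable[OF assms] by (simp add: fourier_l2_of)
  have "(norm (?A (fourier ?u) - ?u))\<^sup>2 = (norm (?A (fourier ?u)))\<^sup>2 - 2 * (?u \<bullet> ?A (fourier ?u)) + (norm ?u)\<^sup>2"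
    by (simp add: power2_norm_eq_inner inner_diff inner_commute)
  also have "?u \<bullet> ?A (fourier ?u) = (norm ?u)\<^sup>2"
    by (simp add: fourier_adjoint[symmetric] iso flip: power2_norm_eq_inner)
  also have "(norm (?A (fourier ?u)))\<^sup>2 \<le> (norm ?u)\<^sup>2"
    using norm_fourier_le[of "fourier ?u"] by (intro power_mono) (auto simp: norm_reflect_l2 iso)
  finally show ?thesis by simp
qed

text \<open>Otherwise \<open>h\<close> is positive on a bounded set of positive measure, which by
  inner regularity contains a compact set that is not null; the integral of \<open>h\<close> over
  that set could not vanish.\<close>

lemma AE_nonpos_if_compact_integrals_zero:
  fixes h :: "real^2 \<Rightarrow> real"
  assumes [measurable]: "h \<in> borel_measurable borel"
    and K: "\<And>K. compact K \<Longrightarrow> integrable lborel (\<lambda>x. indicator K x * h x)"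
      "\<And>K. compact K \<Longrightarrow> (LINT x|lborel. indicator K x * h x) = 0"
  shows "AE x in lborel. h x \<le> 0"
proof -
  have "AE x in lborel. x \<notin> {x \<in> cball 0 (real m). h x > 0}" for m
  proof (rule ccontr)
    let ?A = "{x \<in> cball 0 (real m). h x > 0}"
    have A: "?A \<in> sets lborel" by measurable
    assume "\<not> (AE x in lborel. x \<notin> ?A)"
    then have "?A \<notin> null_sets lborel" using AE_not_in by blast
    then have pos: "emeasure lborel ?A > 0" using A by (auto simp: null_sets_def zero_less_iff_neq_zero)
    have "emeasure lborel ?A \<le> emeasure lborel (cball 0 (real m) :: (real^2) set)" by (intro emeasure_mono) auto
    also have "\<dots> < \<infinity>" using emeasure_bounded_finite[OF bounded_cball] by simp
    finally have fin: "emeasure lborel ?A = ennreal (measure lborel ?A)" using emeasure_eq_ennreal_measure[of lborel ?A] by (simp add: less_top)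
    then have mpos: "measure lborel ?A > 0" using pos by simp
    have "?A \<in> sets lebesgue" using A by (rule sets_completionI_sets)
    \<comment> \<open>The tolerance is the full measure of \<open>?A\<close>, which is what prevents
      \<open>T\<close> from being null.\<close>
    then obtain T where T: "closed T" "T \<subseteq> ?A" "?A - T \<in> lmeasurable" "emeasure lebesgue (?A - T) < ennreal (measure lborel ?A)"
      by (rule sets_lebesgue_inner_closed[OF _ mpos])
    have "bounded T" using T(2) by (intro bounded_subset[OF bounded_cball[of 0 "real m"]]) auto
    then have cT: "compact T" using T(1) by (simp add: compact_eq_bounded_closed)
    then have [measurable]: "T \<in> sets borel" by (simp add: borel_compact)
    have "AE x in lborel. 0 \<le> indicator T x * h x"
      by (rule AE_I2) (use T(2) in \<open>auto simp: indicator_def intro: less_imp_le\<close>)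
    then have "AE x in lborel. indicator T x * h x = 0"
      using integral_nonneg_eq_0_iff_AE[OF K(1)[OF cT]] K(2)[OF cT] by blast
    then have "AE x in lborel. x \<notin> T"
      by eventually_elim (use T(2) in \<open>auto simp: indicator_def\<close>)
    then have "T \<in> null_sets lborel" by (subst (asm) AE_iff_null_sets[symmetric]) auto
    then have "emeasure lborel (?A - T) = emeasure lborel ?A" using A by (rule emeasure_Diff_null_set)
    moreover have "emeasure lebesgue (?A - T) = emeasure lborel (?A - T)"
    proof -
      have D: "?A - T \<in> sets lborel" using A by (rule sets.Diff) simp
      then have "emeasure lebesgue (?A - T) = emeasure lborel (main_part lborel (?A - T))"
        by (intro emeasure_completion sets_completionI_sets)
      also have "main_part lborel (?A - T) = ?A - T" using D by (rule main_part)
      finally show ?thesis .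
    qed
    ultimately show False using T(4) unfolding fin by simp
  qed
  then have "AE x in lborel. \<forall>m. x \<notin> {x \<in> cball 0 (real m). h x > 0}"
    by (subst AE_all_countable) blast
  then show ?thesis
  proof eventually_elim
    case (elim x)
    obtain m where "norm x \<le> real m" using real_arch_simple by blast
    with elim show ?case by (auto simp: not_less dest: spec[of _ m])
  qed
qed

text \<open>Tents of slope \<open>n\<close> over the distance to \<open>K\<close> equal 1 on
  \<open>K\<close> and decrease to its indicator; for positive \<open>n\<close> they live within
  distance 1 of \<open>K\<close>, inside one ball that dominates them all.\<close>

lemma compact_indicator_approx:
  assumes K: "compact K" "K \<noteq> {}"
  shows "(\<lambda>n. l2_of (\<lambda>x. c * complex_of_real (max 0 (1 - real n * infdist x K)))) \<longlonglongrightarrow> l2_of (\<lambda>x. c * complex_of_real (indicator K x))"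
    and "n > 0 \<Longrightarrow> lipschitz_bump (\<lambda>x. c * complex_of_real (max 0 (1 - real n * infdist x K)))"
    and "square_integrable (\<lambda>x. c * complex_of_real (indicator K x))"
proof -
  obtain R where R: "\<And>x. x \<in> K \<Longrightarrow> norm x \<le> R" using K(1) by (meson bounded_iff compact_imp_bounded)
  let ?\<psi> = "\<lambda>n x. c * complex_of_real (max 0 (1 - real n * infdist x K))"
  have outside: "infdist x K \<ge> 1" if "x \<notin> cball 0 (R + 1)" for x
  proof -
    have "1 \<le> dist x y" if "y \<in> K" for y
      using R[OF that] \<open>x \<notin> cball 0 (R + 1)\<close> norm_triangle_ineq3[of x y] by (simp add: dist_norm)
    then show ?thesis unfolding infdist_notempty[OF K(2)] by (intro cINF_greatest K(2))
  qed
  have [measurable]: "K \<in> sets borel" using K(1) by (simp add: borel_compact)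
  have sqi: "square_integrable (\<lambda>x. c * complex_of_real (indicator (cball 0 S) x))" for S
  proof -
    have "integrable lborel (\<lambda>x::real^2. indicator (cball 0 S) x :: real)"
      using emeasure_bounded_finite[OF bounded_cball, of "0::real^2" S] by (intro integrable_real_indicator) auto
    moreover have "(cmod (complex_of_real (indicator (cball 0 S) x)))\<^sup>2 = indicator (cball 0 S) x" for x :: "real^2"
      by (simp add: indicator_def)
    ultimately have "square_integrable (\<lambda>x. complex_of_real (indicator (cball 0 S) x))"
      unfolding square_integrable_def by simp
    then show ?thesis by (rule square_integrable_cmult)
  qed
  show sqK: "square_integrable (\<lambda>x. c * complex_of_real (indicator K x))"
    by (rule square_integrable_bound[OF sqi[of R], where C=1]) (measurable, auto simp: norm_mult indicator_def dest: R)
  show bump: "lipschitz_bump (?\<psi> n)" if "n > 0" for n :: nat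
    unfolding lipschitz_bump_def
  proof (intro exI conjI allI impI)
    show "cmod (?\<psi> n x - ?\<psi> n y) \<le> (cmod c * real n) * norm (x - y)" for x y
    proof -
      have "\<bar>infdist x K - infdist y K\<bar> \<le> dist x y"
        using infdist_triangle[of x K y] infdist_triangle[of y K x] by (simp add: dist_commute abs_le_iff)
      then have "real n * \<bar>infdist x K - infdist y K\<bar> \<le> real n * dist x y" by (rule mult_left_mono) simp
      then have "\<bar>real n * infdist x K - real n * infdist y K\<bar> \<le> real n * dist x y"
        by (simp add: abs_mult right_diff_distrib[symmetric])
      then have "\<bar>max 0 (1 - real n * infdist x K) - max 0 (1 - real n * infdist y K)\<bar> \<le> real n * norm (x - y)"
        unfolding dist_norm by linarith
      then have "cmod c * \<bar>max 0 (1 - real n * infdist x K) - max 0 (1 - real n * infdist y K)\<bar> \<le> cmod c * (real n * norm (x - y))"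
        by (rule mult_left_mono) simp
      moreover have "?\<psi> n x - ?\<psi> n y = c * complex_of_real (max 0 (1 - real n * infdist x K) - max 0 (1 - real n * infdist y K))"
        by (simp only: of_real_diff right_diff_distrib)
      ultimately show ?thesis by (simp only: norm_mult norm_of_real mult.assoc)
    qed
    fix x :: "real^2" assume "x \<notin> cball 0 (R + 1)"
    then have "1 * 1 \<le> real n * infdist x K" using that outside[of x] by (intro mult_mono) auto
    then show "?\<psi> n x = 0" by simp
  qed
  have sqn: "?\<psi> n \<in> borel_measurable lborel" for n
    by (intro borel_measurable_times borel_measurable_const borel_measurable_of_real borel_measurable_max borel_measurable_diff)
      (auto intro!: borel_measurable_continuous_onI continuous_intros)
  \<comment> \<open>For \<open>n = 0\<close> the tent is the constant \<open>c\<close>, so the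
    domination starts at index 1.\<close>
  have "(\<lambda>n. l2_of (?\<psi> (Suc n))) \<longlonglongrightarrow> l2_of (\<lambda>x. c * complex_of_real (indicator K x))"
  proof (rule l2_dominated[OF sqn sqK sqi[of "R + 1"]])
    show "AE x in lborel. (\<lambda>n. ?\<psi> (Suc n) x) \<longlonglongrightarrow> c * complex_of_real (indicator K x)"
    proof (intro always_eventually allI)
      fix x
      show "(\<lambda>n. ?\<psi> (Suc n) x) \<longlonglongrightarrow> c * complex_of_real (indicator K x)"
      proof (cases "x \<in> K")
        case True
        then show ?thesis using K by simp
      next
        case False
        then have d: "infdist x K > 0"
          using K compact_imp_closed[OF K(1)] by (simp add: infdist_pos_not_in_closed)
        obtain N where N: "1 < real N * infdist x K" using reals_Archimedean3[OF d] by blast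
        have "\<forall>\<^sub>F n in sequentially. ?\<psi> (Suc n) x = 0"
          using eventually_ge_at_top[of N]
        proof eventually_elim
          case (elim n)
          have "real N * infdist x K \<le> real (Suc n) * infdist x K" using elim d by (intro mult_right_mono) auto
          with N show ?case by simp
        qed
        then show ?thesis using False by (simp add: tendsto_eventually)
      qed
    qed
    fix n
    have "cmod (?\<psi> (Suc n) x) \<le> cmod (c * complex_of_real (indicator (cball 0 (R + 1)) x))" for x
    proof (cases "x \<in> cball 0 (R + 1)")
      case True
      have "max 0 (1 - real (Suc n) * infdist x K) \<le> 1" using infdist_nonneg[of x K] by simp
      then have "cmod c * \<bar>max 0 (1 - real (Suc n) * infdist x K)\<bar> \<le> cmod c * 1" by (intro mult_left_mono) auto
      with True show ?thesis by (simp only: norm_mult norm_of_real indicator_simps abs_one)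
    next
      case False
      then have "1 * 1 \<le> real (Suc n) * infdist x K" using outside[of x] by (intro mult_mono) auto
      then show ?thesis by simp
    qed
    then show "AE x in lborel. cmod (?\<psi> (Suc n) x) \<le> cmod (c * complex_of_real (indicator (cball 0 (R + 1)) x))" by simp
  qed
  then show "(\<lambda>n. l2_of (?\<psi> n)) \<longlonglongrightarrow> l2_of (\<lambda>x. c * complex_of_real (indicator K x))"
    by (rule LIMSEQ_imp_Suc)
qed

text \<open>Orthogonality passes to constants times indicators of compact sets. The four constants
  1, -1, \<open>\<i>\<close> and \<open>-\<i>\<close> then bound the real and imaginary parts from
  both sides.\<close>

lemma l2_eq_0_if_orthogonal_to_bumps:
  assumes orth: "\<And>\<phi>. lipschitz_bump \<phi> \<Longrightarrow> l2_of \<phi> \<bullet> w = 0"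
  shows "w = 0"
proof -
  have K: "integrable lborel (\<lambda>x. indicator K x * (c \<bullet> rep_l2 w x))" "(LINT x|lborel. indicator K x * (c \<bullet> rep_l2 w x)) = 0"
    if "compact K" for K c
  proof -
    have e: "(c * complex_of_real (indicator K x)) \<bullet> rep_l2 w x = indicator K x * (c \<bullet> rep_l2 w x)" for x
      by (simp add: indicator_def)
    have "integrable lborel (\<lambda>x. indicator K x * (c \<bullet> rep_l2 w x)) \<and> (LINT x|lborel. indicator K x * (c \<bullet> rep_l2 w x)) = 0"
    proof (cases "K = {}")
      case False
      note ap = compact_indicator_approx[OF that False, where c=c]
      have i: "integrable lborel (\<lambda>x. indicator K x * (c \<bullet> rep_l2 w x))"
        using square_integrable_inner[OF ap(3) square_integrable_rep_l2[of w]] unfolding e .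
      let ?\<psi> = "\<lambda>n. l2_of (\<lambda>x. c * complex_of_real (max 0 (1 - real n * infdist x K)))"
      have "(\<lambda>n. ?\<psi> (Suc n) \<bullet> w) \<longlonglongrightarrow> l2_of (\<lambda>x. c * complex_of_real (indicator K x)) \<bullet> w"
        using LIMSEQ_Suc[OF ap(1)] by (intro tendsto_inner tendsto_const)
      moreover have "?\<psi> (Suc n) \<bullet> w = 0" for n by (rule orth[OF ap(2)]) simp
      ultimately have "l2_of (\<lambda>x. c * complex_of_real (indicator K x)) \<bullet> l2_of (rep_l2 w) = 0"
        by (simp add: LIMSEQ_const_iff l2_of_rep_l2)
      then show ?thesis using i unfolding inner_l2_of[OF ap(3) square_integrable_rep_l2] e by simp
    qed simp
    then show "integrable lborel (\<lambda>x. indicator K x * (c \<bullet> rep_l2 w x))" "(LINT x|lborel. indicator K x * (c \<bullet> rep_l2 w x)) = 0"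
      by auto
  qed
  have [measurable]: "rep_l2 w \<in> borel_measurable borel" using rep_l2_measurable[of w] by simp
  have nonpos: "AE x in lborel. c \<bullet> rep_l2 w x \<le> 0" for c
    by (rule AE_nonpos_if_compact_integrals_zero) (measurable, use K in auto)
  have "AE x in lborel. rep_l2 w x = 0"
    using nonpos[of 1] nonpos[of "-1"] nonpos[of \<i>] nonpos[of "-\<i>"]
    by eventually_elim (auto simp: inner_complex_def complex_eq_iff)
  then show ?thesis using rep_l2_0 by (intro l2_eqI) (auto elim: eventually_elim2)
qed

text \<open>Inversion is extended by duality: moving both transforms onto a bump, where inversion is
  known, shows that the defect is orthogonal to every bump.\<close>

lemma reflect_fourier_fourier: "reflect_l2 (fourier (fourier f)) = f"
proof -
  have "f - reflect_l2 (fourier (fourier f)) = 0"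
  proof (rule l2_eq_0_if_orthogonal_to_bumps)
    fix \<phi> assume \<phi>: "lipschitz_bump \<phi>"
    have "l2_of \<phi> \<bullet> reflect_l2 (fourier (fourier f)) = fourier (l2_of \<phi>) \<bullet> fourier f"
      by (rule fourier_adjoint[symmetric])
    also have "\<dots> = f \<bullet> reflect_l2 (fourier (fourier (l2_of \<phi>)))"
      by (simp add: inner_commute flip: fourier_adjoint)
    also have "\<dots> = l2_of \<phi> \<bullet> f" by (simp add: fourier_bump_inversion[OF \<phi>] inner_commute)
    finally show "l2_of \<phi> \<bullet> (f - reflect_l2 (fourier (fourier f))) = 0" by (simp add: inner_diff)
  qed
  then show ?thesis by simp
qed

definition ifourier :: "l2 \<Rightarrow> l2" where
  "ifourier f = reflect_l2 (fourier f)"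

lemma ifourier_fourier: "ifourier (fourier f) = f"
  by (simp add: ifourier_def reflect_fourier_fourier)

lemma fourier_fourier: "fourier (fourier f) = reflect_l2 f"
  by (metis reflect_fourier_fourier reflect_reflect_l2)

lemma fourier_ifourier: "fourier (ifourier f) = f"
proof -
  \<comment> \<open>Both sides are the threefold transform of \<open>g\<close>.\<close>
  have "fourier (reflect_l2 g) = reflect_l2 (fourier g)" for g
    by (metis fourier_fourier)
  then show ?thesis by (simp add: ifourier_def fourier_fourier reflect_reflect_l2)
qed

lemma inner_fourier_fourier: "fourier f \<bullet> fourier g = f \<bullet> g"
  by (simp add: fourier_adjoint reflect_fourier_fourier)

lemma norm_fourier: "norm (fourier f) = norm f"
  by (simp add: norm_eq_sqrt_inner inner_fourier_fourier)

lemma norm_ifourier: "norm (ifourier f) = norm f"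
  by (metis fourier_ifourier norm_fourier)

lemma bounded_linear_ifourier: "bounded_linear ifourier"
  unfolding ifourier_def
  using bounded_linear_compose[OF bounded_linear_reflect_l2 bounded_linear_fourier] by (simp add: o_def)

lemma has_fourier_inverse: "has_fourier f g \<longleftrightarrow> f = ifourier g"
  by (metis has_fourier_eq fourier_ifourier ifourier_fourier)

section \<open>Multipliers, complex constants and translations under the transform\<close>

text \<open>Bijectivity of the transform resolves the definite description; the operators of the
  equation are handled in this form.\<close>

lemma fourier_multiplier_eq: "fourier_multiplier m f = ifourier (mult_l2 m (fourier f))"
  unfolding fourier_multiplier_def mult_l2_def has_fourier_inverse by simp

text \<open>Complex linearity of the transform. The class structure of \<open>l2\<close> is that of
  a real space, so complex constants appear as constant symbols.\<close>

lemma fourier_mult_const: "fourier (mult_l2 (\<lambda>_. c) f) = mult_l2 (\<lambda>_. c) (fourier f)"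
proof (rule fourier_eqI, unfold has_fourier_iff)
  have "l2_of (fourier_integral (cutoff R (mult_l2 (\<lambda>_. c) f))) = mult_l2 (\<lambda>_. c) (l2_of (fourier_integral (cutoff R f)))" for R
  proof -
    have "fourier_integral (cutoff R (mult_l2 (\<lambda>_. c) f)) \<xi> = c * fourier_integral (cutoff R f) \<xi>" for \<xi>
    proof -
      have [measurable]: "cutoff R g \<in> borel_measurable borel" for g using cutoff_measurable by simp
      have "AE x in lborel. cutoff R (mult_l2 (\<lambda>_. c) f) x = c * cutoff R f x"
        using rep_mult_l2[OF bounded_symbol_const, of c f] by eventually_elim (simp add: cutoff_def)
      then have "fourier_integral (cutoff R (mult_l2 (\<lambda>_. c) f)) \<xi> = fourier_integral (\<lambda>x. c * cutoff R f x) \<xi>"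
        by (rule fourier_integral_cong_AE) measurable
      then show ?thesis by (simp add: fourier_integral_cmult)
    qed
    then have "fourier_integral (cutoff R (mult_l2 (\<lambda>_. c) f)) = (\<lambda>\<xi>. c * fourier_integral (cutoff R f) \<xi>)"
      by (rule ext)
    then show ?thesis
      by (simp add: mult_l2_l2_of bounded_symbol_const fourier_integral_contraction cutoff_integrable square_integrable_cutoff)
  qed
  then show "((\<lambda>R. l2_of (fourier_integral (cutoff R (mult_l2 (\<lambda>_. c) f)))) \<longlongrightarrow> mult_l2 (\<lambda>_. c) (fourier f)) at_top"
    using bounded_linear.tendsto[OF bounded_linear_mult_l2[OF bounded_symbol_const] fourier_cutoff_tendsto, of c f] by simp
qed

lemma bounded_symbol_phase: "bounded_symbol (\<lambda>\<xi>. exp (\<i> * complex_of_real (a \<bullet> \<xi>)))"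
proof (rule bounded_symbolI[where C=1])
  show "(\<lambda>\<xi>. exp (\<i> * complex_of_real (a \<bullet> \<xi>))) \<in> borel_measurable lborel" by measurable
qed simp

text \<open>On cutoffs this is the change of variables \<open>x\<close> to \<open>a + x\<close> in
  an integral; both sides are continuous in \<open>f\<close>.\<close>

lemma fourier_translate: "fourier (translate_l2 a f) = mult_l2 (\<lambda>\<xi>. exp (\<i> * complex_of_real (a \<bullet> \<xi>))) (fourier f)"
proof (rule tendsto_unique[OF trivial_limit_at_top_linorder])
  let ?m = "\<lambda>\<xi>. exp (\<i> * complex_of_real (a \<bullet> \<xi>))"
  show "((\<lambda>R. fourier (translate_l2 a (l2_of (cutoff R f)))) \<longlongrightarrow> fourier (translate_l2 a f)) at_top"
    by (intro bounded_linear.tendsto[OF bounded_linear_fourier] bounded_linear.tendsto[OF bounded_linear_translate_l2] cutoff_tendsto)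
  have "fourier (translate_l2 a (l2_of (cutoff R f))) = mult_l2 ?m (l2_of (fourier_integral (cutoff R f)))" for R
  proof -
    note c = cutoff_integrable[of R f] square_integrable_cutoff[of R f]
    have ci: "integrable lborel (\<lambda>x. cutoff R f (a + x))"
      using has_bochner_integral_affine_isometry[OF _ has_bochner_integral_integrable[OF c(1)], where c=1 and t=a]
      by (simp add: has_bochner_integral_iff)
    have cs: "square_integrable (\<lambda>x. cutoff R f (a + x))"
      using square_integrable_affine_isometry(1)[OF _ c(2), where c=1 and t=a] by simp
    have "fourier_integral (\<lambda>x. cutoff R f (a + x)) \<xi> = ?m \<xi> * fourier_integral (cutoff R f) \<xi>" for \<xi>
    proof -
      have h: "has_bochner_integral lborel (\<lambda>x. exp (- \<i> * complex_of_real (\<xi> \<bullet> x)) * cutoff R f x) (integral\<^sup>L lborel (\<lambda>x. exp (- \<i> * complex_of_real (\<xi> \<bullet> x)) * cutoff R f x))"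
        by (rule has_bochner_integral_integrable[OF fourier_integrable[OF c(1)]])
      have shift: "(LINT x|lborel. exp (- \<i> * complex_of_real (\<xi> \<bullet> (a + 1 *\<^sub>R x))) * cutoff R f (a + 1 *\<^sub>R x)) = integral\<^sup>L lborel (\<lambda>x. exp (- \<i> * complex_of_real (\<xi> \<bullet> x)) * cutoff R f x)"
        using has_bochner_integral_affine_isometry[OF disjI1[OF refl] h, of a] by (simp only: has_bochner_integral_iff)
      have "exp (- \<i> * complex_of_real (\<xi> \<bullet> x)) * y = ?m \<xi> * (exp (- \<i> * complex_of_real (\<xi> \<bullet> (a + 1 *\<^sub>R x))) * y)" for x y
        by (simp add: inner_add_right inner_commute algebra_simps flip: exp_add)
      then have "(LINT x|lborel. exp (- \<i> * complex_of_real (\<xi> \<bullet> x)) * cutoff R f (a + x)) =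
         (LINT x|lborel. ?m \<xi> * (exp (- \<i> * complex_of_real (\<xi> \<bullet> (a + 1 *\<^sub>R x))) * cutoff R f (a + 1 *\<^sub>R x)))"
        unfolding scaleR_one by (intro Bochner_Integration.integral_cong refl)
      then have eq: "(LINT x|lborel. exp (- \<i> * complex_of_real (\<xi> \<bullet> x)) * cutoff R f (a + x)) =
         ?m \<xi> * (LINT x|lborel. exp (- \<i> * complex_of_real (\<xi> \<bullet> x)) * cutoff R f x)"
        unfolding integral_mult_right_zero shift .
      show ?thesis unfolding fourier_integral_def eq by (rule mult.left_commute)
    qed
    then have "fourier_integral (\<lambda>x. cutoff R f (a + x)) = (\<lambda>\<xi>. ?m \<xi> * fourier_integral (cutoff R f) \<xi>)"
      by (rule ext)
    then show ?thesis
      by (simp add: translate_l2_of[OF c(2)] fourier_l2_of[OF ci cs] mult_l2_l2_of[OF bounded_symbol_phase fourier_integral_contraction(1)[OF c]])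
  qed
  then show "((\<lambda>R. fourier (translate_l2 a (l2_of (cutoff R f)))) \<longlongrightarrow> mult_l2 ?m (fourier f)) at_top"
    using bounded_linear.tendsto[OF bounded_linear_mult_l2[OF bounded_symbol_phase] fourier_cutoff_tendsto, of a f] by simp
qed

section \<open>Sobolev embedding\<close>

text \<open>The Japanese bracket, the frequency weight of the \<open>H\<^sup>1\<close> norm.\<close>

definition bracket :: "real^2 \<Rightarrow> real" where
  "bracket \<xi> = sqrt (1 + (norm \<xi>)\<^sup>2)"

lemma bracket_measurable [measurable]: "bracket \<in> borel_measurable borel"
  unfolding bracket_def by measurable

lemma bracket_ge_1: "1 \<le> bracket \<xi>"
  by (simp add: bracket_def)

lemma bracket_pos: "0 < bracket \<xi>"
  using bracket_ge_1[of \<xi>] by linarith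

lemma bracket_sq: "(bracket \<xi>)\<^sup>2 = 1 + (norm \<xi>)\<^sup>2"
  by (simp add: bracket_def add_nonneg_nonneg)

lemma norm_le_bracket: "norm \<xi> \<le> bracket \<xi>"
  by (rule power2_le_imp_le) (simp_all add: bracket_sq bracket_pos less_imp_le)

definition inv_bracket :: "real^2 \<Rightarrow> complex" where
  "inv_bracket \<xi> = complex_of_real (1 / bracket \<xi>)"

lemma inv_bracket_measurable [measurable]: "inv_bracket \<in> borel_measurable borel"
  unfolding inv_bracket_def by measurable

lemma norm_inv_bracket: "cmod (inv_bracket \<xi>) = 1 / bracket \<xi>"
  using bracket_pos[of \<xi>] by (simp add: inv_bracket_def norm_divide)

lemma bounded_symbol_inv_bracket: "bounded_symbol inv_bracket"
proof (rule bounded_symbolI[where C=1])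
  show "cmod (inv_bracket \<xi>) \<le> 1" for \<xi>
    using bracket_ge_1[of \<xi>] by (simp add: norm_inv_bracket)
qed simp

text \<open>
  \<open>of_freq g\<close> is the function with transform \<open>g / (1 + |\<xi>|\<^sup>2)\<^sup>1\<^sup>/\<^sup>2\<close>; it identifies \<open>L\<^sup>2\<close> isometrically
  with \<open>H\<^sup>1\<close>.
\<close>

definition of_freq :: "l2 \<Rightarrow> l2" where
  "of_freq g = ifourier (mult_l2 inv_bracket g)"

lemma bounded_linear_of_freq: "bounded_linear of_freq"
  unfolding of_freq_def
  by (rule bounded_linear_compose[OF bounded_linear_ifourier bounded_linear_mult_l2[OF bounded_symbol_inv_bracket]])

section \<open>Low frequency bounds and level sets\<close>

lemma nn_integral_powr:
  assumes "a > (-1::real)" "c \<ge> 0"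
  shows "(\<integral>\<^sup>+t. ennreal (t powr a) * indicator {0..c} t \<partial>lborel) = ennreal (c powr (a + 1) / (a + 1))"
  using has_integral_powr_from_0[OF assms] by (intro nn_integral_has_integral_lebesgue') auto

text \<open>The integral grows like a logarithm. Comparing the integrand with
  \<open>\<bar>s\<bar> powr (\<beta> - 1)\<close> replaces the logarithm by a power, whose small
  exponent is adapted to the target exponent of the embedding.\<close>

lemma nn_integral_inverse_bracket_line:
  assumes "A \<ge> (0::real)" "0 < \<beta>" "\<beta> \<le> 1"
  shows "(\<integral>\<^sup>+s. ennreal (indicator {-A..A} s / sqrt (1 + s\<^sup>2)) \<partial>lborel) \<le> ennreal (2 * A powr \<beta> / \<beta>)"
proof -
  let ?g = "\<lambda>s. ennreal (s powr (\<beta> - 1)) * indicator {0..A} s"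
  \<comment> \<open>The origin is excluded because \<open>0 powr (\<beta> - 1)\<close> is 0, so the
    bound fails there.\<close>
  have le: "ennreal (indicator {-A..A} s / sqrt (1 + s\<^sup>2)) \<le> ?g s + ?g (- s)" if "s \<noteq> 0" for s :: real
  proof -
    have *: "1 / sqrt (1 + r\<^sup>2) \<le> r powr (\<beta> - 1)" if "r > 0" for r :: real
    proof -
      have "r powr (1 - \<beta>) \<le> sqrt (1 + r\<^sup>2) powr (1 - \<beta>)"
        using that assms by (intro powr_mono2) (auto intro: real_le_rsqrt)
      also have "\<dots> \<le> sqrt (1 + r\<^sup>2) powr 1" using assms by (intro powr_mono) auto
      finally have "r powr (1 - \<beta>) \<le> sqrt (1 + r\<^sup>2)" by (simp add: add_nonneg_nonneg)
      then have "1 / sqrt (1 + r\<^sup>2) \<le> 1 / r powr (1 - \<beta>)" using that by (intro divide_left_mono) (auto simp: add_pos_nonneg)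
      also have "\<dots> = r powr (\<beta> - 1)" using powr_minus_divide[of r "1 - \<beta>"] by simp
      finally show ?thesis .
    qed
    show ?thesis
    proof (cases "s > 0")
      case True
      then show ?thesis using *[of s] by (auto simp: indicator_def intro!: ennreal_leI)
    next
      case False
      then have "- s > 0" using that by simp
      then show ?thesis using *[of "- s"] by (auto simp: indicator_def intro!: ennreal_leI)
    qed
  qed
  have "(\<integral>\<^sup>+s. ennreal (indicator {-A..A} s / sqrt (1 + s\<^sup>2)) \<partial>lborel) \<le> (\<integral>\<^sup>+s. ?g s + ?g (- s) \<partial>lborel)"
  proof (rule nn_integral_mono_AE)
    show "AE s in lborel. ennreal (indicator {-A..A} s / sqrt (1 + s\<^sup>2)) \<le> ?g s + ?g (- s)"
      using AE_lborel_singleton[of "0::real"] by eventually_elim (rule le)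
  qed
  also have "\<dots> = (\<integral>\<^sup>+s. ?g s \<partial>lborel) + (\<integral>\<^sup>+s. ?g (- s) \<partial>lborel)"
    by (rule nn_integral_add) auto
  also have "(\<integral>\<^sup>+s. ?g (- s) \<partial>lborel) = (\<integral>\<^sup>+s. ?g s \<partial>lborel)"
    using nn_integral_real_affine[of ?g "-1" 0] by simp
  also have "(\<integral>\<^sup>+s. ?g s \<partial>lborel) = ennreal (A powr \<beta> / \<beta>)"
    using nn_integral_powr[of "\<beta> - 1" A] assms by simp
  also have "ennreal (A powr \<beta> / \<beta>) + ennreal (A powr \<beta> / \<beta>) = ennreal (2 * A powr \<beta> / \<beta>)"
    using assms by (simp flip: ennreal_plus)
  finally show ?thesis .
qed

text \<open>The power 2 matches the dimension: one factor \<open>1 / bracket \<xi>\<close> is spent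
  on each coordinate, and the ball is contained in a square.\<close>

lemma nn_integral_inverse_bracket_ball:
  assumes "A \<ge> 0" "0 < \<beta>" "\<beta> \<le> 1"
  shows "(\<integral>\<^sup>+\<xi>. ennreal ((indicator (cball 0 A) \<xi> / bracket \<xi>)\<^sup>2) \<partial>lborel) \<le> ennreal ((2 * A powr \<beta> / \<beta>)\<^sup>2)"
proof -
  let ?w = "\<lambda>s::real. indicator {-A..A} s / sqrt (1 + s\<^sup>2) :: real"
  have D: "card (Basis :: (real^2) set) = 2" by simp
  have le: "(indicator (cball 0 A) \<xi> / bracket \<xi>)\<^sup>2 \<le> (\<Prod>b\<in>Basis. ?w (\<xi> \<bullet> b))" for \<xi> :: "real^2"
  proof (cases "\<xi> \<in> cball 0 A")
    case True
    have "(\<Prod>b\<in>(Basis::(real^2) set). 1 / bracket \<xi>) \<le> (\<Prod>b\<in>Basis. ?w (\<xi> \<bullet> b))"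
    proof (rule prod_mono)
      fix b :: "real^2" assume b: "b \<in> Basis"
      have n: "\<bar>\<xi> \<bullet> b\<bar> \<le> norm \<xi>" using Basis_le_norm[OF b] by simp
      then have "(\<xi> \<bullet> b)\<^sup>2 \<le> (norm \<xi>)\<^sup>2" by (metis abs_le_square_iff abs_norm_cancel)
      then have "sqrt (1 + (\<xi> \<bullet> b)\<^sup>2) \<le> bracket \<xi>" by (simp add: bracket_def)
      then have "1 / bracket \<xi> \<le> 1 / sqrt (1 + (\<xi> \<bullet> b)\<^sup>2)"
        using bracket_pos[of \<xi>] by (intro divide_left_mono) (auto simp: add_pos_nonneg)
      moreover have "\<xi> \<bullet> b \<in> {-A..A}" using n True by (auto simp: abs_le_iff)
      ultimately show "0 \<le> 1 / bracket \<xi> \<and> 1 / bracket \<xi> \<le> ?w (\<xi> \<bullet> b)"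
        using bracket_pos[of \<xi>] by (simp add: less_imp_le)
    qed
    then show ?thesis using True by (simp add: D)
  qed (simp add: prod_nonneg)
  have "(\<integral>\<^sup>+\<xi>. ennreal ((indicator (cball 0 A) \<xi> / bracket \<xi>)\<^sup>2) \<partial>lborel) \<le>
      (\<integral>\<^sup>+\<xi>. (\<Prod>b\<in>Basis. ennreal (?w ((\<xi>::real^2) \<bullet> b))) \<partial>lborel)"
    by (intro nn_integral_mono) (subst prod_ennreal, simp, intro ennreal_leI le)
  also have "\<dots> = (\<Prod>b\<in>(Basis::(real^2) set). \<integral>\<^sup>+s. ennreal (?w s) \<partial>lborel)"
    by (rule nn_integral_lborel_prod) auto
  also have "\<dots> = (\<integral>\<^sup>+s. ennreal (?w s) \<partial>lborel)\<^sup>2" by (simp add: D)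
  also have "\<dots> \<le> (ennreal (2 * A powr \<beta> / \<beta>))\<^sup>2"
    by (intro power_mono nn_integral_inverse_bracket_line assms) auto
  also have "\<dots> = ennreal ((2 * A powr \<beta> / \<beta>)\<^sup>2)" using assms by (simp add: ennreal_power)
  finally show ?thesis .
qed

text \<open>Cauchy-Schwarz between \<open>g\<close> and the inverse bracket on the ball. Through
  \<open>fourier_integral_bound\<close> it becomes a sup bound on the low frequency part of
  \<open>of_freq g\<close>.\<close>

lemma cutoff_L1_bound:
  assumes "A \<ge> 0" "0 < \<beta>" "\<beta> \<le> 1"
  shows "(LINT \<xi>|lborel. cmod (cutoff A (mult_l2 inv_bracket g) \<xi>)) \<le> 2 * A powr \<beta> / \<beta> * norm g"
proof -
  let ?u = "mult_l2 inv_bracket g"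
  let ?i = "\<lambda>\<xi>. indicator (cball 0 A) \<xi> / bracket \<xi> :: real"
  have [measurable]: "rep_l2 g \<in> borel_measurable borel" using rep_l2_measurable[of g] by simp
  have "?i \<in> borel_measurable lborel"
    by (intro borel_measurable_divide borel_measurable_indicator) auto
  then have im: "(\<lambda>\<xi>. ennreal (?i \<xi>)) \<in> borel_measurable lborel" by measurable
  have gm: "(\<lambda>\<xi>. ennreal (cmod (rep_l2 g \<xi>))) \<in> borel_measurable lborel" by measurable
  have i0: "?i \<xi> \<ge> 0" for \<xi> using bracket_pos[of \<xi>] by simp
  have "(\<integral>\<^sup>+\<xi>. ennreal (cmod (cutoff A ?u \<xi>)) \<partial>lborel) = (\<integral>\<^sup>+\<xi>. ennreal (?i \<xi>) * ennreal (cmod (rep_l2 g \<xi>)) \<partial>lborel)"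
  proof (rule nn_integral_cong_AE)
    show "AE \<xi> in lborel. ennreal (cmod (cutoff A ?u \<xi>)) = ennreal (?i \<xi>) * ennreal (cmod (rep_l2 g \<xi>))"
      using rep_mult_l2[OF bounded_symbol_inv_bracket, of g]
    proof eventually_elim
      case (elim \<xi>)
      have "cmod (cutoff A ?u \<xi>) = ?i \<xi> * cmod (rep_l2 g \<xi>)"
        by (simp add: cutoff_def elim norm_mult norm_inv_bracket indicator_def)
      then show ?case by (simp only: ennreal_mult[OF i0 norm_ge_zero])
    qed
  qed
  then have "(\<integral>\<^sup>+\<xi>. ennreal (cmod (cutoff A ?u \<xi>)) \<partial>lborel)\<^sup>2 \<le>
     (\<integral>\<^sup>+\<xi>. (ennreal (?i \<xi>))\<^sup>2 \<partial>lborel) * (\<integral>\<^sup>+\<xi>. (ennreal (cmod (rep_l2 g \<xi>)))\<^sup>2 \<partial>lborel)"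
    using Cauchy_Schwarz_nn_integral[of "\<lambda>\<xi>. ennreal (?i \<xi>)" lborel "\<lambda>\<xi>. ennreal (cmod (rep_l2 g \<xi>))"]
    by (simp only: im gm)
  also have "\<dots> = (\<integral>\<^sup>+\<xi>. ennreal ((?i \<xi>)\<^sup>2) \<partial>lborel) * ennreal ((norm g)\<^sup>2)"
    by (simp only: ennreal_power[OF i0] ennreal_power[OF norm_ge_zero] nn_norm_l2)
  also have "\<dots> \<le> ennreal ((2 * A powr \<beta> / \<beta>)\<^sup>2) * ennreal ((norm g)\<^sup>2)"
    by (intro mult_right_mono nn_integral_inverse_bracket_ball assms) auto
  also have "\<dots> = ennreal ((2 * A powr \<beta> / \<beta> * norm g)\<^sup>2)"
    by (simp only: power_mult_distrib ennreal_mult[OF zero_le_power2 zero_le_power2])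
  finally have "(\<integral>\<^sup>+\<xi>. ennreal (cmod (cutoff A ?u \<xi>)) \<partial>lborel)\<^sup>2 \<le> ennreal ((2 * A powr \<beta> / \<beta> * norm g)\<^sup>2)" .
  moreover have "(\<integral>\<^sup>+\<xi>. ennreal (cmod (cutoff A ?u \<xi>)) \<partial>lborel) = ennreal (LINT \<xi>|lborel. cmod (cutoff A ?u \<xi>))"
    using cutoff_integrable[of A ?u] by (intro nn_integral_eq_integral) auto
  ultimately have "ennreal ((LINT \<xi>|lborel. cmod (cutoff A ?u \<xi>))\<^sup>2) \<le> ennreal ((2 * A powr \<beta> / \<beta> * norm g)\<^sup>2)"
    by (simp only: ennreal_power[OF Bochner_Integration.integral_nonneg[OF norm_ge_zero]])
  then have "(LINT \<xi>|lborel. cmod (cutoff A ?u \<xi>))\<^sup>2 \<le> (2 * A powr \<beta> / \<beta> * norm g)\<^sup>2"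
    by (subst (asm) ennreal_le_iff) auto
  then show ?thesis by (rule power2_le_imp_le) (use assms in simp)
qed

text \<open>Where the function reaches \<open>l\<close> and its low frequency part stays below
  \<open>l / 2\<close>, the high frequency part is at least \<open>l / 2\<close>; Chebyshev's
  inequality and Plancherel then give the factor \<open>4 / l\<^sup>2\<close>. The indicator on the
  right describes the frequencies beyond the cut.\<close>

lemma level_set_bound:
  assumes "0 < \<beta>" "\<beta> \<le> 1" "l > 0" "norm g > 0"
  shows "emeasure lborel {x. l \<le> cmod (rep_l2 (of_freq g) x)} \<le>
    (\<integral>\<^sup>+\<xi>. ennreal (4 / l\<^sup>2 * (cmod (rep_l2 g \<xi>) / bracket \<xi>)\<^sup>2) * indicator {\<xi>. l \<le> 2 / \<beta> * norm g * (norm \<xi>) powr \<beta>} \<xi> \<partial>lborel)"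
proof -
  let ?u = "mult_l2 inv_bracket g"
  have [measurable]: "rep_l2 h \<in> borel_measurable borel" for h using rep_l2_measurable[of h] by simp
  \<comment> \<open>The radius that solves \<open>2 * A powr \<beta> / \<beta> * norm g = l\<close>;
    the factor \<open>1 / (2 * pi)\<close> of the transform then leaves room for
    \<open>l / 2\<close>.\<close>
  define A where "A = (l * \<beta> / (2 * norm g)) powr (1 / \<beta>)"
  have A: "A \<ge> 0" "A powr \<beta> = l * \<beta> / (2 * norm g)" using assms by (auto simp: A_def powr_powr)
  let ?c = "cutoff A ?u"
  let ?low = "reflect_l2 (l2_of (fourier_integral ?c))"
  have low_eq: "?low = ifourier (l2_of ?c)"
    by (simp add: ifourier_def fourier_l2_of cutoff_integrable square_integrable_cutoff)
  have "cmod (fourier_integral ?c x) \<le> l / 2" for x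
  proof -
    have "cmod (fourier_integral ?c x) \<le> 1 / (2 * pi) * (2 * A powr \<beta> / \<beta> * norm g)"
      using fourier_integral_bound[of ?c x] cutoff_L1_bound[OF A(1) assms(1,2), of g]
      by (meson divide_nonneg_pos mult_left_mono order_trans pi_gt_zero zero_le_one zero_less_mult_iff zero_less_numeral less_imp_le)
    also have "\<dots> = l / (2 * pi)" using A(2) assms by (simp add: field_simps)
    also have "\<dots> \<le> l / 2" using pi_ge_two assms by (intro divide_left_mono) auto
    finally show ?thesis .
  qed
  note fb = this
  have "AE x in lborel. rep_l2 ?low x = fourier_integral ?c (- x)"
    using rep_reflect_l2[of "l2_of (fourier_integral ?c)"]
      AE_affine_isometry[OF _ rep_l2_of[OF fourier_integral_contraction(1)[OF cutoff_integrable[of A ?u] square_integrable_cutoff]], where c="-1" and t=0, simplified]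
    by eventually_elim simp
  then have low: "AE x in lborel. cmod (rep_l2 ?low x) \<le> l / 2"
    by eventually_elim (simp only: fb)
  have "emeasure lborel {x. l \<le> cmod (rep_l2 (of_freq g) x)} = (\<integral>\<^sup>+x. indicator {x. l \<le> cmod (rep_l2 (of_freq g) x)} x \<partial>lborel)"
    by (rule nn_integral_indicator[symmetric]) measurable
  also have "\<dots> \<le> (\<integral>\<^sup>+x. ennreal (4 / l\<^sup>2) * ennreal ((cmod (rep_l2 (of_freq g - ?low) x))\<^sup>2) \<partial>lborel)"
  proof (rule nn_integral_mono_AE)
    show "AE x in lborel. indicator {x. l \<le> cmod (rep_l2 (of_freq g) x)} x \<le> ennreal (4 / l\<^sup>2) * ennreal ((cmod (rep_l2 (of_freq g - ?low) x))\<^sup>2)"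
      using low rep_l2_diff[of "of_freq g" ?low]
    proof eventually_elim
      case (elim x)
      show ?case
      proof (cases "l \<le> cmod (rep_l2 (of_freq g) x)")
        case True
        have "l / 2 \<le> cmod (rep_l2 (of_freq g - ?low) x)"
          using True elim(1) norm_triangle_ineq2[of "rep_l2 (of_freq g) x" "rep_l2 ?low x"]
          unfolding elim(2) by linarith
        then have "(l / 2)\<^sup>2 \<le> (cmod (rep_l2 (of_freq g - ?low) x))\<^sup>2" using assms by (intro power_mono) auto
        then have "1 \<le> 4 / l\<^sup>2 * (cmod (rep_l2 (of_freq g - ?low) x))\<^sup>2"
          using assms by (simp add: field_simps power2_eq_square)
        then have "ennreal 1 \<le> ennreal (4 / l\<^sup>2 * (cmod (rep_l2 (of_freq g - ?low) x))\<^sup>2)" by (rule ennreal_leI)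
        then have "1 \<le> ennreal (4 / l\<^sup>2) * ennreal ((cmod (rep_l2 (of_freq g - ?low) x))\<^sup>2)"
          by (subst ennreal_mult[symmetric]) auto
        then show ?thesis using True by simp
      qed simp
    qed
  qed
  also have "\<dots> = ennreal (4 / l\<^sup>2) * ennreal ((norm (of_freq g - ?low))\<^sup>2)"
    by (simp add: nn_integral_cmult nn_norm_l2)
  also have "norm (of_freq g - ?low) = norm (?u - l2_of ?c)"
    unfolding of_freq_def low_eq
    by (simp only: norm_ifourier linear_diff[OF bounded_linear.linear[OF bounded_linear_ifourier], symmetric])
  also have "ennreal ((norm (?u - l2_of ?c))\<^sup>2) = (\<integral>\<^sup>+\<xi>. ennreal ((cmod (rep_l2 (?u - l2_of ?c) \<xi>))\<^sup>2) \<partial>lborel)"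
    by (rule nn_norm_l2[symmetric])
  also have "ennreal (4 / l\<^sup>2) * \<dots> = (\<integral>\<^sup>+\<xi>. ennreal (4 / l\<^sup>2) * ennreal ((cmod (rep_l2 (?u - l2_of ?c) \<xi>))\<^sup>2) \<partial>lborel)"
    by (rule nn_integral_cmult[symmetric]) measurable
  also have "\<dots> \<le> (\<integral>\<^sup>+\<xi>. ennreal (4 / l\<^sup>2 * (cmod (rep_l2 g \<xi>) / bracket \<xi>)\<^sup>2) * indicator {\<xi>. l \<le> 2 / \<beta> * norm g * (norm \<xi>) powr \<beta>} \<xi> \<partial>lborel)"
  proof (rule nn_integral_mono_AE)
    show "AE \<xi> in lborel. ennreal (4 / l\<^sup>2) * ennreal ((cmod (rep_l2 (?u - l2_of ?c) \<xi>))\<^sup>2) \<le>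
       ennreal (4 / l\<^sup>2 * (cmod (rep_l2 g \<xi>) / bracket \<xi>)\<^sup>2) * indicator {\<xi>. l \<le> 2 / \<beta> * norm g * (norm \<xi>) powr \<beta>} \<xi>"
      using rep_l2_diff[of ?u "l2_of ?c"] rep_l2_of[OF square_integrable_cutoff[of A ?u]] rep_mult_l2[OF bounded_symbol_inv_bracket, of g]
    proof eventually_elim
      case (elim \<xi>)
      show ?case
      proof (cases "\<xi> \<in> cball 0 A")
        case True
        then show ?thesis by (simp add: elim(1,2) cutoff_def)
      next
        case False
        then have "A \<le> norm \<xi>" by simp
        then have "A powr \<beta> \<le> norm \<xi> powr \<beta>" using A(1) assms by (intro powr_mono2) auto
        then have mem: "l \<le> 2 / \<beta> * norm g * (norm \<xi>) powr \<beta>"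
          using assms unfolding A(2) by (simp add: field_simps)
        have "cmod (rep_l2 (?u - l2_of ?c) \<xi>) = cmod (rep_l2 g \<xi>) / bracket \<xi>"
          using False by (simp add: elim cutoff_def norm_mult norm_inv_bracket)
        then show ?thesis using mem by (subst ennreal_mult[symmetric]) auto
      qed
    qed
  qed
  finally show ?thesis .
qed

text \<open>
  The argument of Chemin and Xu: at height \<open>l\<close> the function is cut
  at the frequency where the low part is bounded by \<open>l/2\<close>, and the high part is estimated in \<open>L\<^sup>2\<close>.
\<close>

lemma sobolev_embedding:
  assumes "p > 2"
  obtains C where "C > 0" "\<And>g. (\<integral>\<^sup>+x. ennreal (cmod (rep_l2 (of_freq g) x) powr p) \<partial>lborel) \<le> ennreal (C * norm g powr p)"
proof -
  \<comment> \<open>\<open>\<beta> * (p - 2) \<le> 2\<close> lets the square of the bracket absorb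
    the power of |\<xi>| produced at the end, and \<open>\<beta> \<le> 1\<close> is the range of the
    line estimate.\<close>
  define \<beta> where "\<beta> = min 1 (2 / (p - 2))"
  have \<beta>: "0 < \<beta>" "\<beta> \<le> 1" "\<beta> * (p - 2) \<le> 2" using assms
    by (auto simp: \<beta>_def min_def field_simps)
  \<comment> \<open>\<open>4 * p\<close> combines the layer cake formula with the Chebyshev factor;
    the rest comes from integrating \<open>l powr (p - 3)\<close> up to
    \<open>?T \<xi>\<close>.\<close>
  define C where "C = 4 * p * (2 / \<beta>) powr (p - 2) / (p - 2)"
  have C: "C > 0" using assms \<beta> by (simp add: C_def)
  have "(\<integral>\<^sup>+x. ennreal (cmod (rep_l2 (of_freq g) x) powr p) \<partial>lborel) \<le> ennreal (C * norm g powr p)" for g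
  proof (cases "norm g > 0")
    case False
    then have "of_freq g = 0" using linear_0[OF bounded_linear.linear[OF bounded_linear_of_freq]] by simp
    then have "(\<integral>\<^sup>+x. ennreal (cmod (rep_l2 (of_freq g) x) powr p) \<partial>lborel) = (\<integral>\<^sup>+(x::real^2). 0 \<partial>lborel)"
      using rep_l2_0 assms by (intro nn_integral_cong_AE) (auto elim!: eventually_mono)
    then show ?thesis by simp
  next
    case True
    let ?f = "\<lambda>x. cmod (rep_l2 (of_freq g) x)" and ?v = "\<lambda>\<xi>. cmod (rep_l2 g \<xi>) / bracket \<xi>"
    let ?T = "\<lambda>\<xi>. 2 / \<beta> * norm g * (norm \<xi>) powr \<beta>"
    have [measurable]: "rep_l2 h \<in> borel_measurable borel" for h using rep_l2_measurable[of h] by simp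
    \<comment> \<open>Layer cake formula.\<close>
    have "(\<integral>\<^sup>+x. ennreal (?f x powr p) \<partial>lborel) = (\<integral>\<^sup>+x. \<integral>\<^sup>+l. ennreal (p * l powr (p - 1)) * indicator {0..?f x} l \<partial>lborel \<partial>lborel)"
    proof (intro nn_integral_cong)
      fix x
      have "(\<integral>\<^sup>+l. ennreal (p * l powr (p - 1)) * indicator {0..?f x} l \<partial>lborel) =
        (\<integral>\<^sup>+l. ennreal p * (ennreal (l powr (p - 1)) * indicator {0..?f x} l) \<partial>lborel)"
        using assms by (simp add: ennreal_mult mult.assoc)
      also have "\<dots> = ennreal p * ennreal (?f x powr (p - 1 + 1) / (p - 1 + 1))"
        using assms by (subst nn_integral_cmult) (auto simp: nn_integral_powr)
      also have "\<dots> = ennreal (?f x powr p)" using assms by (simp flip: ennreal_mult)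
      finally show "ennreal (?f x powr p) = (\<integral>\<^sup>+l. ennreal (p * l powr (p - 1)) * indicator {0..?f x} l \<partial>lborel)" ..
    qed
    also have "\<dots> = (\<integral>\<^sup>+x. \<integral>\<^sup>+l. ennreal (p * l powr (p - 1)) * indicator {(l, x). 0 \<le> l \<and> l \<le> ?f x} (l, x) \<partial>lborel \<partial>lborel)"
      by (intro nn_integral_cong arg_cong2[where f=times]) (auto simp: indicator_def)
    also have "\<dots> = (\<integral>\<^sup>+l. \<integral>\<^sup>+x. ennreal (p * l powr (p - 1)) * indicator {(l, x). 0 \<le> l \<and> l \<le> ?f x} (l, x) \<partial>lborel \<partial>lborel)"
      by (rule lborel_pair.Fubini') measurable
    \<comment> \<open>The factor \<open>1 / l\<^sup>2\<close> lowers the exponent to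
      \<open>p - 3\<close>, which is integrable at 0 since \<open>p > 2\<close>. After exchanging
      the order, \<open>l\<close> runs up to \<open>?T \<xi>\<close>.\<close>
    also have "\<dots> \<le> (\<integral>\<^sup>+l. \<integral>\<^sup>+\<xi>. ennreal (4 * p * l powr (p - 3) * (?v \<xi>)\<^sup>2) * indicator {(l, \<xi>). 0 \<le> l \<and> l \<le> ?T \<xi>} (l, \<xi>) \<partial>lborel \<partial>lborel)"
    proof (rule nn_integral_mono)
      fix l :: real
      show "(\<integral>\<^sup>+x. ennreal (p * l powr (p - 1)) * indicator {(l, x). 0 \<le> l \<and> l \<le> ?f x} (l, x) \<partial>lborel) \<le>
        (\<integral>\<^sup>+\<xi>. ennreal (4 * p * l powr (p - 3) * (?v \<xi>)\<^sup>2) * indicator {(l, \<xi>). 0 \<le> l \<and> l \<le> ?T \<xi>} (l, \<xi>) \<partial>lborel)"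
      proof (cases "l > 0")
        case False
        then have "ennreal (p * l powr (p - 1)) * indicator {(l, x). 0 \<le> l \<and> l \<le> ?f x} (l, x) = 0" for x
          by (cases "l = 0") (auto simp: indicator_def)
        then show ?thesis by (simp only: nn_integral_const mult_zero_left zero_le)
      next
        case pos: True
        have "(\<integral>\<^sup>+x. ennreal (p * l powr (p - 1)) * indicator {(l, x). 0 \<le> l \<and> l \<le> ?f x} (l, x) \<partial>lborel) =
           (\<integral>\<^sup>+x. ennreal (p * l powr (p - 1)) * indicator {x. l \<le> ?f x} x \<partial>lborel)"
          using pos by (intro nn_integral_cong arg_cong2[where f=times]) (auto simp: indicator_def)
        also have "\<dots> = ennreal (p * l powr (p - 1)) * emeasure lborel {x. l \<le> ?f x}"
          by (subst nn_integral_cmult_indicator) auto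
        also have "\<dots> \<le> ennreal (p * l powr (p - 1)) * (\<integral>\<^sup>+\<xi>. ennreal (4 / l\<^sup>2 * (?v \<xi>)\<^sup>2) * indicator {\<xi>. l \<le> ?T \<xi>} \<xi> \<partial>lborel)"
          by (intro mult_left_mono level_set_bound \<beta> pos True) auto
        also have "\<dots> = (\<integral>\<^sup>+\<xi>. ennreal (p * l powr (p - 1)) * (ennreal (4 / l\<^sup>2 * (?v \<xi>)\<^sup>2) * indicator {\<xi>. l \<le> ?T \<xi>} \<xi>) \<partial>lborel)"
          by (rule nn_integral_cmult[symmetric]) measurable
        also have "\<dots> = (\<integral>\<^sup>+\<xi>. ennreal (4 * p * l powr (p - 3) * (?v \<xi>)\<^sup>2) * indicator {(l, \<xi>). 0 \<le> l \<and> l \<le> ?T \<xi>} (l, \<xi>) \<partial>lborel)"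
        proof (intro nn_integral_cong)
          fix \<xi> :: "real^2"
          have "l powr (p - 1) = l powr (p - 3) * l powr 2" by (subst powr_add[symmetric]) simp
          then have "p * l powr (p - 1) * (4 / l\<^sup>2 * (?v \<xi>)\<^sup>2) = 4 * p * l powr (p - 3) * (?v \<xi>)\<^sup>2"
            using pos by (simp add: powr_numeral)
          then have "ennreal (p * l powr (p - 1)) * ennreal (4 / l\<^sup>2 * (?v \<xi>)\<^sup>2) = ennreal (4 * p * l powr (p - 3) * (?v \<xi>)\<^sup>2)"
            using assms by (subst ennreal_mult[symmetric]) auto
          moreover have "indicator {\<xi>. l \<le> ?T \<xi>} \<xi> = (indicator {(l, \<xi>). 0 \<le> l \<and> l \<le> ?T \<xi>} (l, \<xi>) :: ennreal)"
            using pos by (auto simp: indicator_def)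
          ultimately show "ennreal (p * l powr (p - 1)) * (ennreal (4 / l\<^sup>2 * (?v \<xi>)\<^sup>2) * indicator {\<xi>. l \<le> ?T \<xi>} \<xi>) =
             ennreal (4 * p * l powr (p - 3) * (?v \<xi>)\<^sup>2) * indicator {(l, \<xi>). 0 \<le> l \<and> l \<le> ?T \<xi>} (l, \<xi>)"
            by (simp only: mult.assoc[symmetric])
        qed
        finally show ?thesis .
      qed
    qed
    also have "\<dots> = (\<integral>\<^sup>+\<xi>. \<integral>\<^sup>+l. ennreal (4 * p * l powr (p - 3) * (?v \<xi>)\<^sup>2) * indicator {(l, \<xi>). 0 \<le> l \<and> l \<le> ?T \<xi>} (l, \<xi>) \<partial>lborel \<partial>lborel)"
      by (rule lborel_pair.Fubini'[symmetric]) measurable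
    also have "\<dots> = (\<integral>\<^sup>+\<xi>. ennreal (4 * p * (?v \<xi>)\<^sup>2 * (?T \<xi> powr (p - 2) / (p - 2))) \<partial>lborel)"
    proof (intro nn_integral_cong)
      fix \<xi> :: "real^2"
      have T0: "?T \<xi> \<ge> 0" using \<beta> by simp
      have "(\<integral>\<^sup>+l. ennreal (4 * p * l powr (p - 3) * (?v \<xi>)\<^sup>2) * indicator {(l, \<xi>). 0 \<le> l \<and> l \<le> ?T \<xi>} (l, \<xi>) \<partial>lborel) =
        (\<integral>\<^sup>+l. ennreal (4 * p * (?v \<xi>)\<^sup>2) * (ennreal (l powr (p - 3)) * indicator {0..?T \<xi>} l) \<partial>lborel)"
      proof (intro nn_integral_cong)
        fix l :: real
        have "ennreal (4 * p * l powr (p - 3) * (?v \<xi>)\<^sup>2) = ennreal (4 * p * (?v \<xi>)\<^sup>2) * ennreal (l powr (p - 3))"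
          using assms by (subst ennreal_mult[symmetric]) (auto simp: mult_ac)
        moreover have "indicator {(l, \<xi>). 0 \<le> l \<and> l \<le> ?T \<xi>} (l, \<xi>) = (indicator {0..?T \<xi>} l :: ennreal)"
          by (auto simp: indicator_def)
        ultimately show "ennreal (4 * p * l powr (p - 3) * (?v \<xi>)\<^sup>2) * indicator {(l, \<xi>). 0 \<le> l \<and> l \<le> ?T \<xi>} (l, \<xi>) =
            ennreal (4 * p * (?v \<xi>)\<^sup>2) * (ennreal (l powr (p - 3)) * indicator {0..?T \<xi>} l)"
          by (simp only: mult.assoc)
      qed
      also have "\<dots> = ennreal (4 * p * (?v \<xi>)\<^sup>2) * (\<integral>\<^sup>+l. ennreal (l powr (p - 3)) * indicator {0..?T \<xi>} l \<partial>lborel)"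
        by (rule nn_integral_cmult) measurable
      also have "\<dots> = ennreal (4 * p * (?v \<xi>)\<^sup>2) * ennreal (?T \<xi> powr (p - 2) / (p - 2))"
        using assms T0 nn_integral_powr[of "p - 3" "?T \<xi>"] by simp
      also have "\<dots> = ennreal (4 * p * (?v \<xi>)\<^sup>2 * (?T \<xi> powr (p - 2) / (p - 2)))"
        using assms by (subst ennreal_mult[symmetric]) auto
      finally show "(\<integral>\<^sup>+l. ennreal (4 * p * l powr (p - 3) * (?v \<xi>)\<^sup>2) * indicator {(l, \<xi>). 0 \<le> l \<and> l \<le> ?T \<xi>} (l, \<xi>) \<partial>lborel) =
        ennreal (4 * p * (?v \<xi>)\<^sup>2 * (?T \<xi> powr (p - 2) / (p - 2)))" .
    qed
    also have "\<dots> \<le> (\<integral>\<^sup>+\<xi>. ennreal (C * norm g powr (p - 2)) * ennreal ((cmod (rep_l2 g \<xi>))\<^sup>2) \<partial>lborel)"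
    proof (rule nn_integral_mono)
      fix \<xi> :: "real^2"
      have "norm \<xi> powr (\<beta> * (p - 2)) \<le> (bracket \<xi>) powr (\<beta> * (p - 2))"
        using \<beta> assms norm_le_bracket[of \<xi>] by (intro powr_mono2) auto
      also have "\<dots> \<le> bracket \<xi> powr 2" using \<beta> bracket_ge_1[of \<xi>] by (intro powr_mono) auto
      finally have b: "norm \<xi> powr (\<beta> * (p - 2)) \<le> (bracket \<xi>)\<^sup>2" using bracket_pos[of \<xi>] by (simp add: powr_numeral)
      have "4 * p * (?v \<xi>)\<^sup>2 * (?T \<xi> powr (p - 2) / (p - 2)) =
         C * norm g powr (p - 2) * ((?v \<xi>)\<^sup>2 * norm \<xi> powr (\<beta> * (p - 2)))"
      proof -
        have "?T \<xi> powr (p - 2) = (2 / \<beta>) powr (p - 2) * norm g powr (p - 2) * norm \<xi> powr (\<beta> * (p - 2))"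
          using \<beta> by (simp add: powr_mult powr_powr del: times_divide_eq_left)
        then show ?thesis unfolding C_def by (simp only: times_divide_eq_left times_divide_eq_right mult_ac)
      qed
      also have "\<dots> \<le> C * norm g powr (p - 2) * ((?v \<xi>)\<^sup>2 * (bracket \<xi>)\<^sup>2)"
        using C b by (intro mult_left_mono) auto
      also have "(?v \<xi>)\<^sup>2 * (bracket \<xi>)\<^sup>2 = (cmod (rep_l2 g \<xi>))\<^sup>2"
        using bracket_pos[of \<xi>] by (simp add: power_divide)
      finally show "ennreal (4 * p * (?v \<xi>)\<^sup>2 * (?T \<xi> powr (p - 2) / (p - 2))) \<le> ennreal (C * norm g powr (p - 2)) * ennreal ((cmod (rep_l2 g \<xi>))\<^sup>2)"
        using C by (subst ennreal_mult[symmetric]) (auto intro!: ennreal_leI)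
    qed
    also have "\<dots> = ennreal (C * norm g powr (p - 2)) * ennreal ((norm g)\<^sup>2)"
      by (subst nn_integral_cmult) (auto simp: nn_norm_l2)
    also have "\<dots> = ennreal (C * norm g powr (p - 2) * (norm g)\<^sup>2)"
      using C by (subst ennreal_mult[symmetric]) auto
    also have "C * norm g powr (p - 2) * (norm g)\<^sup>2 = C * norm g powr p"
    proof -
      have "norm g powr p = norm g powr (p - 2) * norm g powr 2" by (subst powr_add[symmetric]) simp
      then show ?thesis using True by (simp add: powr_numeral)
    qed
    finally show ?thesis .
  qed
  with C show thesis by (rule that)
qed

section \<open>Global flows of conservative vector fields\<close>

text \<open>At most one of the two intervals is nondegenerate, so this is the signed primitive from
  0 on the whole line.\<close>

definition primitive :: "(real \<Rightarrow> 'a::banach) \<Rightarrow> real \<Rightarrow> 'a" where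
  "primitive h t = integral {0..t} h - integral {t..0} h"

lemma primitive_0: "primitive h 0 = 0"
  by (simp add: primitive_def)

text \<open>On a bounded interval around \<open>t\<close> and 0 the primitive differs by a constant
  from an integral with fixed lower endpoint, so the change of formula at 0 disappears.\<close>

lemma primitive_has_vector_derivative:
  fixes h :: "real \<Rightarrow> 'a::banach"
  assumes "continuous_on UNIV h"
  shows "(primitive h has_vector_derivative h t) (at t)"
proof -
  define T where "T = \<bar>t\<bar> + 1"
  have T: "-T < t" "t < T" "0 \<le> T" by (auto simp: T_def)
  have int: "h integrable_on {a..b}" for a b
    by (intro integrable_continuous_real continuous_on_subset[OF assms]) auto
  have eq: "primitive h s = integral {-T..s} h - integral {-T..0} h" if "s \<in> {-T..T}" for s
  proof (cases "s \<ge> 0")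
    case True
    then have "integral {-T..0} h + integral {0..s} h = integral {-T..s} h"
      using T by (intro Henstock_Kurzweil_Integration.integral_combine int) auto
    moreover have "integral {s..0} h = 0" using True by (cases "s = 0") auto
    ultimately show ?thesis by (simp add: primitive_def algebra_simps)
  next
    case False
    then have "integral {-T..s} h + integral {s..0} h = integral {-T..0} h"
      using that by (intro Henstock_Kurzweil_Integration.integral_combine int) auto
    moreover have "integral {0..s} h = 0" using False by simp
    ultimately show ?thesis by (simp add: primitive_def algebra_simps)
  qed
  have "((\<lambda>s. integral {-T..s} h) has_vector_derivative h t) (at t within {-T..T})"
    using T by (intro integral_has_vector_derivative continuous_on_subset[OF assms]) auto
  then have "((\<lambda>s. integral {-T..s} h - integral {-T..0} h) has_vector_derivative h t - 0) (at t within {-T..T})"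
    by (intro has_vector_derivative_diff has_vector_derivative_const)
  then have D: "((\<lambda>s. integral {-T..s} h - integral {-T..0} h) has_vector_derivative h t) (at t within {-T..T})"
    unfolding diff_zero .
  have "(primitive h has_vector_derivative h t) (at t within {-T..T})"
  proof (rule has_vector_derivative_transform)
    show "t \<in> {-T..T}" using T by simp
  qed (rule eq, assumption, rule D)
  then have "(primitive h has_vector_derivative h t) (at t within {-T<..<T})"
    by (rule has_vector_derivative_within_subset) auto
  moreover have "at t within {-T<..<T} = at t" using T by (intro at_within_open) auto
  ultimately show ?thesis by (simp only:)
qed

lemma has_oriented_integral_FTC:
  fixes H :: "real \<Rightarrow> 'a::banach"
  assumes "\<And>t. (H has_vector_derivative h t) (at t)"
  shows "has_oriented_integral h (H b - H a) a b"
proof -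
  have "(h has_integral H d - H c) {c..d}" if "c \<le> d" for c d
    using that assms by (intro fundamental_theorem_of_calculus) (auto intro: has_vector_derivative_at_within)
  from this[of a b] this[of b a] show ?thesis by (auto simp: has_oriented_integral_def)
qed

lemma has_oriented_integral_unique:
  "has_oriented_integral h I a b \<Longrightarrow> has_oriented_integral h J a b \<Longrightarrow> I = J"
  unfolding has_oriented_integral_def
  by (metis has_integral_unique minus_minus)

lemma has_oriented_integral_linear:
  assumes "has_oriented_integral h I a b" "bounded_linear L"
  shows "has_oriented_integral (\<lambda>s. L (h s)) (L I) a b"
  using assms has_integral_linear[of h I _ L] has_integral_linear[of h "- I" _ L]
    linear_neg[OF bounded_linear.linear[OF assms(2)], of I]
  by (auto simp: has_oriented_integral_def o_def split: if_splits)

text \<open>Integration against the exponential weight gains the factor \<open>1 / k\<close>, the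
  source of every contraction below. Negative times follow by reflecting the curve.\<close>

lemma primitive_exp_bound:
  fixes H :: "real \<Rightarrow> 'a::banach"
  assumes "H 0 = 0" "\<And>t. (H has_vector_derivative h t) (at t)"
    and "\<And>t. norm (h t) \<le> B * exp (k * \<bar>t\<bar>)" "k > 0"
  shows "norm (H t) \<le> B / k * exp (k * \<bar>t\<bar>)"
proof -
  have B: "B \<ge> 0" using order_trans[OF norm_ge_zero assms(3)[of 0]] by simp
  have pos: "norm (G t) \<le> B / k * exp (k * t)"
    if G: "G 0 = 0" "\<And>t. (G has_vector_derivative g t) (at t)" "\<And>t. norm (g t) \<le> B * exp (k * \<bar>t\<bar>)" and "t \<ge> 0"
    for g and t :: real and G :: "real \<Rightarrow> 'a"
  proof -
    have g: "(g has_integral G t) {0..t}"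
      using has_oriented_integral_FTC[of G g t 0, OF G(2)] G(1) that by (simp add: has_oriented_integral_def)
    have e: "((\<lambda>s. B * exp (k * s)) has_integral B / k * exp (k * t) - B / k * exp (k * 0)) {0..t}"
      using that \<open>k > 0\<close> by (intro fundamental_theorem_of_calculus)
        (auto intro!: derivative_eq_intros simp: has_real_derivative_iff_has_vector_derivative[symmetric])
    have "norm (integral {0..t} g) \<le> integral {0..t} (\<lambda>s. B * exp (k * s))"
    proof (rule integral_norm_bound_integral)
      show "norm (g s) \<le> B * exp (k * s)" if "s \<in> {0..t}" for s using G(3)[of s] that by simp
    qed (use g e in \<open>blast intro: has_integral_integrable\<close>)+
    also have "integral {0..t} (\<lambda>s. B * exp (k * s)) = B / k * exp (k * t) - B / k * exp (k * 0)"
      using e by (rule integral_unique)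
    also have "\<dots> \<le> B / k * exp (k * t)" using B \<open>k > 0\<close> by simp
    finally show ?thesis using integral_unique[OF g] by simp
  qed
  show ?thesis
  proof (cases "t \<ge> 0")
    case True
    then show ?thesis using pos[of H h t] assms by simp
  next
    case False
    have "((\<lambda>s. H (- s)) has_vector_derivative - h (- s)) (at s)" for s
    proof -
      have "((H \<circ> uminus) has_vector_derivative (-1) *\<^sub>R h (- s)) (at s)"
        by (rule vector_diff_chain_at) (auto intro!: derivative_eq_intros assms(2) simp: has_real_derivative_iff_has_vector_derivative[symmetric])
      then show ?thesis by (simp add: o_def)
    qed
    then show ?thesis using pos[of "\<lambda>s. H (- s)" "\<lambda>s. - h (- s)" "- t"] assms(1) assms(3)[of "- _"] False by simp
  qed
qed

section \<open>Globally Lipschitz fields\<close>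

text \<open>Continuity is stated along continuous curves, the form available for a field conjugated
  by a strongly continuous group. Vanishing at 0 supplies the growth bounds.\<close>

locale lipschitz_field =
  fixes f :: "real \<Rightarrow> 'a::banach \<Rightarrow> 'a" and L :: real
  assumes L_pos: "L > 0"
    and f_cont: "\<And>v. continuous_on UNIV v \<Longrightarrow> continuous_on UNIV (\<lambda>s. f s (v s))"
    and f_lipschitz: "\<And>s x y. norm (f s x - f s y) \<le> L * norm (x - y)"
    and f_0: "\<And>s. f s 0 = 0"
begin

definition integral_curve :: "(real \<Rightarrow> 'a) \<Rightarrow> bool" where
  "integral_curve v \<longleftrightarrow> (\<forall>t. (v has_vector_derivative f t (v t)) (at t))"

text \<open>
  In the weighted space of curves \<open>v\<close> with \<open>e\<^sup>-\<^sup>2\<^sup>L\<^sup>|\<^sup>t\<^sup>| v(t)\<close> bounded the integral operator is a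
  contraction on all of \<open>\<real>\<close> at once, so that no continuation argument is needed.
\<close>

lemma integral_curve_exists:
  "\<exists>v. v 0 = x \<and> integral_curve v \<and> (\<exists>K. \<forall>t. norm (v t) \<le> K * exp (2 * L * \<bar>t\<bar>))"
proof -
  \<comment> \<open>Twice the Lipschitz constant: the contraction factor becomes
    \<open>L / ?k = 1/2\<close>.\<close>
  let ?k = "2 * L"
  have k: "?k > 0" using L_pos by simp
  \<comment> \<open>\<open>w\<close> is the bounded curve obtained from \<open>v\<close> by dividing
    out the weight; \<open>h w\<close> is the field along \<open>v\<close>.\<close>
  define h :: "(real \<Rightarrow>\<^sub>C 'a) \<Rightarrow> real \<Rightarrow> 'a" where "h w s = f s (exp (?k * \<bar>s\<bar>) *\<^sub>R apply_bcontfun w s)" for w s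
  have hc: "continuous_on UNIV (h w)" for w
    unfolding h_def by (intro f_cont continuous_intros continuous_on_apply_bcontfun)
  note hd = primitive_has_vector_derivative[OF hc]
  have pc: "continuous_on UNIV (primitive (h w))" for w
    using hd by (meson continuous_at_imp_continuous_on has_vector_derivative_continuous)
  have hdiff: "norm (h w s - h w' s) \<le> (L * dist w w') * exp (?k * \<bar>s\<bar>)" for w w' s
  proof -
    have "norm (h w s - h w' s) \<le> L * norm (exp (?k * \<bar>s\<bar>) *\<^sub>R apply_bcontfun w s - exp (?k * \<bar>s\<bar>) *\<^sub>R apply_bcontfun w' s)"
      unfolding h_def by (rule f_lipschitz)
    also have "\<dots> = L * (exp (?k * \<bar>s\<bar>) * dist (apply_bcontfun w s) (apply_bcontfun w' s))"
      by (simp add: dist_norm flip: scaleR_diff_right)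
    also have "\<dots> \<le> L * (exp (?k * \<bar>s\<bar>) * dist w w')"
      using L_pos by (intro mult_left_mono dist_bounded) auto
    finally show ?thesis by (simp add: mult_ac)
  qed
  have h0: "h 0 s = 0" for s by (simp add: h_def f_0)
  have pd: "norm (primitive (h w) t - primitive (h w') t) \<le> dist w w' / 2 * exp (?k * \<bar>t\<bar>)" for w w' t
  proof -
    have "norm (primitive (h w) t - primitive (h w') t) \<le> (L * dist w w') / ?k * exp (?k * \<bar>t\<bar>)"
      by (rule primitive_exp_bound[where h="\<lambda>s. h w s - h w' s"])
        (auto simp: primitive_0 L_pos intro!: has_vector_derivative_diff hd hdiff)
    then show ?thesis using L_pos by simp
  qed
  \<comment> \<open>The zero curve has zero primitive, so comparison with it bounds the primitive of
    every other curve.\<close>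
  have p0: "primitive (h 0) t = 0" for t by (simp add: primitive_def h0[abs_def] h_def f_0)
  define \<Phi> where "\<Phi> w = Bcontfun (\<lambda>t. exp (- (?k * \<bar>t\<bar>)) *\<^sub>R (x + primitive (h w) t))" for w
  have mem: "(\<lambda>t. exp (- (?k * \<bar>t\<bar>)) *\<^sub>R (x + primitive (h w) t)) \<in> bcontfun" for w
  proof (rule bcontfun_normI)
    show "continuous_on UNIV (\<lambda>t. exp (- (?k * \<bar>t\<bar>)) *\<^sub>R (x + primitive (h w) t))"
      by (intro continuous_intros pc)
    fix t
    have "norm (x + primitive (h w) t) \<le> norm x + norm (primitive (h w) t)" by (rule norm_triangle_ineq)
    also have "norm (primitive (h w) t) \<le> dist w 0 / 2 * exp (?k * \<bar>t\<bar>)" using pd[of w t 0] by (simp add: p0)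
    also have "norm x \<le> norm x * exp (?k * \<bar>t\<bar>)" using L_pos by (simp add: mult_le_cancel_left1)
    finally have "norm (x + primitive (h w) t) \<le> (norm x + dist w 0 / 2) * exp (?k * \<bar>t\<bar>)"
      by (simp add: algebra_simps)
    then have "exp (- (?k * \<bar>t\<bar>)) * norm (x + primitive (h w) t) \<le> exp (- (?k * \<bar>t\<bar>)) * ((norm x + dist w 0 / 2) * exp (?k * \<bar>t\<bar>))"
      by (intro mult_left_mono) auto
    also have "\<dots> = norm x + dist w 0 / 2" by (simp add: exp_minus)
    finally show "norm (exp (- (?k * \<bar>t\<bar>)) *\<^sub>R (x + primitive (h w) t)) \<le> norm x + dist w 0 / 2" by simp
  qed
  have ap: "apply_bcontfun (\<Phi> w) t = exp (- (?k * \<bar>t\<bar>)) *\<^sub>R (x + primitive (h w) t)" for w t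
    unfolding \<Phi>_def using Bcontfun_inverse[OF mem] by simp
  have "\<exists>!w. \<Phi> w = w"
  proof (rule banach_fix_type[of "1/2"], simp, simp, intro allI dist_bound)
    fix w w' t
    have "dist (apply_bcontfun (\<Phi> w) t) (apply_bcontfun (\<Phi> w') t) = exp (- (?k * \<bar>t\<bar>)) * norm (primitive (h w) t - primitive (h w') t)"
      unfolding ap dist_norm scaleR_diff_right[symmetric] by simp
    also have "\<dots> \<le> exp (- (?k * \<bar>t\<bar>)) * (dist w w' / 2 * exp (?k * \<bar>t\<bar>))"
      by (intro mult_left_mono pd) auto
    also have "\<dots> = 1/2 * dist w w'" by (simp add: exp_minus)
    finally show "dist (apply_bcontfun (\<Phi> w) t) (apply_bcontfun (\<Phi> w') t) \<le> 1/2 * dist w w'" .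
  qed
  then obtain w where w: "\<Phi> w = w" by blast
  define v where "v t = x + primitive (h w) t" for t
  have vw: "v t = exp (?k * \<bar>t\<bar>) *\<^sub>R apply_bcontfun w t" for t
    using ap[of w t] unfolding w v_def by (simp add: exp_minus)
  have "(v has_vector_derivative f t (v t)) (at t)" for t
  proof -
    have "(v has_vector_derivative 0 + h w t) (at t)"
      unfolding v_def by (intro has_vector_derivative_add has_vector_derivative_const hd)
    then show ?thesis by (simp add: h_def vw)
  qed
  moreover have "v 0 = x" by (simp add: v_def primitive_0)
  moreover have "norm (v t) \<le> norm w * exp (?k * \<bar>t\<bar>)" for t
    unfolding vw using norm_bounded[of w t] by simp
  ultimately show ?thesis unfolding integral_curve_def by blast
qed

text \<open>A Gronwall estimate by absorption: the weighted supremum D of the distance is finite by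
  the growth assumptions, and the integral equation gives D \<le> |v(0) - w(0)| + D/2, hence the
  factor 2.\<close>

lemma integral_curves_distance:
  assumes "integral_curve v" "integral_curve w"
    and "\<And>t. norm (v t) \<le> K * exp (2 * L * \<bar>t\<bar>)" "\<And>t. norm (w t) \<le> K' * exp (2 * L * \<bar>t\<bar>)"
  shows "norm (v t - w t) \<le> 2 * norm (v 0 - w 0) * exp (2 * L * \<bar>t\<bar>)"
proof -
  let ?k = "2 * L" and ?d = "\<lambda>t. norm (v t - w t) * exp (- (2 * L * \<bar>t\<bar>))"
  have expc: "a * exp (- (?k * \<bar>t\<bar>)) \<le> b \<longleftrightarrow> a \<le> b * exp (?k * \<bar>t\<bar>)" for a b t :: real
    by (simp add: exp_minus field_simps)
  have bdd: "bdd_above (range ?d)"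
  proof (rule bdd_aboveI2)
    fix t
    have "norm (v t - w t) \<le> norm (v t) + norm (w t)" by (rule norm_triangle_ineq4)
    also have "\<dots> \<le> (K + K') * exp (?k * \<bar>t\<bar>)" unfolding distrib_right by (intro add_mono assms(3,4))
    finally show "?d t \<le> K + K'" by (simp add: expc)
  qed
  define D where "D = (SUP t. ?d t)"
  have D: "norm (v t - w t) \<le> D * exp (?k * \<bar>t\<bar>)" for t
    using cSUP_upper[OF _ bdd, of t] by (simp add: expc D_def)
  have "?d t \<le> norm (v 0 - w 0) + D / 2" for t
  proof -
    let ?H = "\<lambda>t. (v t - w t) - (v 0 - w 0)"
    have "norm (?H t) \<le> (L * D) / ?k * exp (?k * \<bar>t\<bar>)"
    proof (rule primitive_exp_bound)
      show "(?H has_vector_derivative f t (v t) - f t (w t)) (at t)" for t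
      proof -
        have "(?H has_vector_derivative f t (v t) - f t (w t) - 0) (at t)"
          using assms(1,2) unfolding integral_curve_def by (intro has_vector_derivative_diff has_vector_derivative_const) auto
        then show ?thesis by simp
      qed
      show "norm (f t (v t) - f t (w t)) \<le> (L * D) * exp (?k * \<bar>t\<bar>)" for t
        using order_trans[OF f_lipschitz mult_left_mono[OF D]] L_pos by (simp add: mult.assoc)
    qed (use L_pos in auto)
    then have "norm (?H t) \<le> D / 2 * exp (?k * \<bar>t\<bar>)" using L_pos by simp
    moreover have "norm (v t - w t) \<le> norm (?H t) + norm (v 0 - w 0)"
      using norm_triangle_ineq[of "?H t" "v 0 - w 0"] by simp
    moreover have "norm (v 0 - w 0) \<le> norm (v 0 - w 0) * exp (?k * \<bar>t\<bar>)"
      using L_pos by (simp add: mult_le_cancel_left1)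
    ultimately have "norm (v t - w t) \<le> (norm (v 0 - w 0) + D / 2) * exp (?k * \<bar>t\<bar>)"
      by (simp add: algebra_simps)
    then show ?thesis by (simp add: expc)
  qed
  then have "D \<le> norm (v 0 - w 0) + D / 2" unfolding D_def by (intro cSUP_least) auto
  then have "D \<le> 2 * norm (v 0 - w 0)" by simp
  then have "D * exp (?k * \<bar>t\<bar>) \<le> 2 * norm (v 0 - w 0) * exp (?k * \<bar>t\<bar>)" by (rule mult_right_mono) simp
  with D[of t] show ?thesis by linarith
qed

end

section \<open>Radial truncation\<close>

text \<open>The retraction onto the ball of radius \<open>M\<close> along rays. For
  \<open>M > 0\<close> its value is a positive multiple of the argument, which is what makes it
  compatible with orthogonality relations.\<close>

definition radial_truncation :: "real \<Rightarrow> 'a::real_normed_vector \<Rightarrow> 'a" where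
  "radial_truncation M x = (M / max M (norm x)) *\<^sub>R x"

lemma radial_truncation_id: "M > 0 \<Longrightarrow> norm x \<le> M \<Longrightarrow> radial_truncation M x = x"
  by (simp add: radial_truncation_def max_def)

lemma norm_radial_truncation: "M > 0 \<Longrightarrow> norm (radial_truncation M x) \<le> M"
  by (auto simp: radial_truncation_def max_def field_simps)

text \<open>Moving the point and changing the scaling factor each cost at most
  \<open>norm (x - y)\<close>, in any normed space.\<close>

lemma radial_truncation_lipschitz:
  assumes "M > 0"
  shows "norm (radial_truncation M x - radial_truncation M y) \<le> 2 * norm (x - y)"
proof -
  let ?m = "\<lambda>x. max M (norm x)"
  let ?a = "\<lambda>x. M / ?m x"
  have mp: "?m x > 0" "?m x \<ge> M" "?m x \<ge> norm x" for x :: 'a using assms by auto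
  have "radial_truncation M x - radial_truncation M y = ?a x *\<^sub>R (x - y) + (?a x - ?a y) *\<^sub>R y"
    by (simp add: radial_truncation_def algebra_simps)
  then have "norm (radial_truncation M x - radial_truncation M y) \<le> \<bar>?a x\<bar> * norm (x - y) + \<bar>?a x - ?a y\<bar> * norm y"
    by (metis norm_scaleR norm_triangle_ineq)
  moreover have "\<bar>?a x\<bar> * norm (x - y) \<le> 1 * norm (x - y)"
    using assms mp[of x] by (intro mult_right_mono) auto
  moreover have "\<bar>?a x - ?a y\<bar> * norm y \<le> norm (x - y)"
  proof -
    have "?a x - ?a y = (M / ?m x) * ((?m y - ?m x) / ?m y)"
      using mp(1)[of x] mp(1)[of y] by (simp add: field_simps)
    then have "\<bar>?a x - ?a y\<bar> * norm y = (M / ?m x) * (\<bar>?m y - ?m x\<bar> * (norm y / ?m y))"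
      using mp(1)[of x] mp(1)[of y] assms by (simp add: abs_mult)
    also have "\<dots> \<le> 1 * (\<bar>?m y - ?m x\<bar> * 1)"
      using mp[of x] mp[of y] assms by (intro mult_mono mult_nonneg_nonneg) auto
    also have "\<dots> \<le> norm (x - y)" using norm_triangle_ineq3[of x y] by (auto simp: max_def)
    finally show ?thesis .
  qed
  ultimately show ?thesis by simp
qed

section \<open>Semilinear flows with a conserved quadratic energy\<close>

text \<open>\<open>S\<close> stands for the propagator, \<open>V\<close> for the nonlinear term, and
  \<open>W\<close> for the operator of the energy \<open>x \<bullet> W x\<close>. \<open>W_S\<close>
  says that the group preserves the energy, \<open>V_W\<close> that the field is tangent to its
  level sets, and \<open>c1\<close>, \<open>c2\<close> compare it with the norm.\<close>

locale conservative_flow =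
  fixes S :: "real \<Rightarrow> 'a::{real_inner,banach} \<Rightarrow> 'a" and V W :: "'a \<Rightarrow> 'a" and c1 c2 :: real
  assumes S_linear: "bounded_linear (S t)" and S_norm: "norm (S t x) = norm x"
    and S_0: "S 0 x = x" and S_add: "S (s + t) x = S s (S t x)"
    and S_cont: "continuous_on UNIV (\<lambda>t. S t x)"
    and V_lipschitz: "\<exists>L. \<forall>x y. norm x \<le> M \<longrightarrow> norm y \<le> M \<longrightarrow> norm (V x - V y) \<le> L * norm (x - y)"
    and V_0: "V 0 = 0"
    and W_linear: "bounded_linear W" and W_sym: "W x \<bullet> y = x \<bullet> W y"
    and W_S: "S t x \<bullet> W (S t y) = x \<bullet> W y"
    and c1_pos: "c1 > 0" and W_lower: "c1 * (norm x)\<^sup>2 \<le> x \<bullet> W x" and W_upper: "x \<bullet> W x \<le> c2 * (norm x)\<^sup>2"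
    and V_W: "V x \<bullet> W x = 0"
begin

definition mild_solution :: "'a \<Rightarrow> (real \<Rightarrow> 'a) \<Rightarrow> bool" where
  "mild_solution x u \<longleftrightarrow> continuous_on UNIV u \<and>
     (\<forall>t. has_oriented_integral (\<lambda>s. S (t - s) (V (u s))) (u t - S t x) 0 t)"

text \<open>The field in the interaction picture, that is, as seen by
  \<open>S (- t) (u t)\<close>.\<close>

definition pullback :: "('a \<Rightarrow> 'a) \<Rightarrow> real \<Rightarrow> 'a \<Rightarrow> 'a" where
  "pullback X t v = S (- t) (X (S t v))"

lemma S_diff: "S t (x - y) = S t x - S t y"
  by (rule linear_diff[OF bounded_linear.linear[OF S_linear]])

lemma S_inv: "S (- t) (S t x) = x" "S t (S (- t) x) = x"
  using S_add[of "-t" t x] S_add[of t "-t" x] by (simp_all add: S_0)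

text \<open>Strong continuity in time and the isometry property in space together control both
  moving arguments.\<close>

lemma continuous_on_S:
  assumes "continuous_on UNIV x"
  shows "continuous_on UNIV (\<lambda>s. S s (x s))" "continuous_on UNIV (\<lambda>s. S (- s) (x s))"
proof -
  have *: "continuous_on UNIV (\<lambda>s. S (a s) (x s))" if a: "continuous_on UNIV a" for a
    unfolding continuous_on_def
  proof
    fix s0 :: real
    have x: "(x \<longlongrightarrow> x s0) (at s0)" and S: "((\<lambda>s. S (a s) (x s0)) \<longlongrightarrow> S (a s0) (x s0)) (at s0)"
      using assms continuous_on_compose2[OF S_cont[of "x s0"] a] by (auto simp: continuous_on_def)
    have "((\<lambda>s. S (a s) (x s) - S (a s0) (x s0)) \<longlongrightarrow> 0) (at s0)"
    proof (rule Lim_null_comparison)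
      show "\<forall>\<^sub>F s in at s0. norm (S (a s) (x s) - S (a s0) (x s0)) \<le> norm (x s - x s0) + norm (S (a s) (x s0) - S (a s0) (x s0))"
      proof (intro always_eventually allI)
        fix s
        have "S (a s) (x s) - S (a s0) (x s0) = S (a s) (x s - x s0) + (S (a s) (x s0) - S (a s0) (x s0))"
          by (simp add: S_diff)
        then show "norm (S (a s) (x s) - S (a s0) (x s0)) \<le> norm (x s - x s0) + norm (S (a s) (x s0) - S (a s0) (x s0))"
          by (metis S_norm norm_triangle_ineq)
      qed
      show "((\<lambda>s. norm (x s - x s0) + norm (S (a s) (x s0) - S (a s0) (x s0))) \<longlongrightarrow> 0) (at s0)"
        using tendsto_add[OF tendsto_norm_zero[OF LIM_zero[OF x]] tendsto_norm_zero[OF LIM_zero[OF S]]] by simp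
    qed
    then show "((\<lambda>s. S (a s) (x s)) \<longlongrightarrow> S (a s0) (x s0)) (at s0 within UNIV)" by (rule LIM_zero_cancel)
  qed
  show "continuous_on UNIV (\<lambda>s. S s (x s))" "continuous_on UNIV (\<lambda>s. S (- s) (x s))"
    by (intro *[of "\<lambda>s. s"] *[of "\<lambda>s. - s"] continuous_intros)+
qed

lemma continuous_V: "continuous_on UNIV V"
  unfolding continuous_on_def
proof
  fix x :: 'a
  obtain L where L: "\<And>y z. norm y \<le> norm x + 1 \<Longrightarrow> norm z \<le> norm x + 1 \<Longrightarrow> norm (V y - V z) \<le> L * norm (y - z)"
    using V_lipschitz[of "norm x + 1"] by blast
  have "((\<lambda>y. V y - V x) \<longlongrightarrow> 0) (at x)"
  proof (rule Lim_null_comparison)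
    have "\<forall>\<^sub>F y in at x. dist y x < 1" by (auto simp: eventually_at intro!: exI[of _ 1])
    then show "\<forall>\<^sub>F y in at x. norm (V y - V x) \<le> L * norm (y - x)"
    proof eventually_elim
      case (elim y)
      then have "norm y \<le> norm x + 1" using norm_triangle_ineq2[of y x] by (simp add: dist_norm)
      then show ?case by (intro L) auto
    qed
    have "((\<lambda>y. L * norm (y - x)) \<longlongrightarrow> L * norm (x - x)) (at x)" by (intro tendsto_intros)
    then show "((\<lambda>y. L * norm (y - x)) \<longlongrightarrow> 0) (at x)" by simp
  qed
  then show "(V \<longlongrightarrow> V x) (at x within UNIV)" by (rule LIM_zero_cancel)
qed

text \<open>Needed when Duhamel's formula is given only in a weaker norm: the integral there is then
  identified as the image of this one.\<close>

lemma duhamel_integral_exists: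
  assumes "continuous_on UNIV u"
  shows "\<exists>J. has_oriented_integral (\<lambda>s. S (t - s) (V (u s))) J 0 t"
proof -
  have "continuous_on UNIV (\<lambda>s. V (u s))"
    by (rule continuous_on_compose2[OF continuous_V assms]) simp
  note H = primitive_has_vector_derivative[OF continuous_on_S(2)[OF this]]
  let ?H = "primitive (\<lambda>s. S (- s) (V (u s)))"
  have "has_oriented_integral (\<lambda>s. S t (S (- s) (V (u s)))) (S t (?H t - ?H 0)) 0 t"
    by (rule has_oriented_integral_linear[OF has_oriented_integral_FTC[OF H] S_linear])
  then show ?thesis by (intro exI[of _ "S t (?H t - ?H 0)"]) (simp flip: S_add)
qed

text \<open>Writing \<open>S (t - s)\<close> as \<open>S t\<close> after \<open>S (- s)\<close>
  takes the outer factor out of the integral, and the fundamental theorem of calculus turns what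
  remains into a differential equation.\<close>

lemma mild_solution_iff:
  "mild_solution x u \<longleftrightarrow>
    (\<exists>v. v 0 = x \<and> (\<forall>t. (v has_vector_derivative pullback V t (v t)) (at t)) \<and> u = (\<lambda>t. S t (v t)))"
proof
  assume u: "mild_solution x u"
  let ?h = "\<lambda>s. S (- s) (V (u s))"
  have uc: "continuous_on UNIV u" using u by (simp add: mild_solution_def)
  have hc: "continuous_on UNIV ?h"
    by (intro continuous_on_S continuous_on_compose2[OF continuous_V uc]) auto
  note H = primitive_has_vector_derivative[OF hc]
  have eq: "S (- t) (u t) = x + primitive ?h t" for t
  proof -
    have "has_oriented_integral (\<lambda>s. S t (?h s)) (S t (primitive ?h t - primitive ?h 0)) 0 t"
      by (rule has_oriented_integral_linear[OF has_oriented_integral_FTC[OF H] S_linear])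
    then have "has_oriented_integral (\<lambda>s. S (t - s) (V (u s))) (S t (primitive ?h t)) 0 t"
      by (simp add: primitive_0 flip: S_add)
    moreover have "has_oriented_integral (\<lambda>s. S (t - s) (V (u s))) (u t - S t x) 0 t"
      using u by (simp add: mild_solution_def)
    ultimately have "u t - S t x = S t (primitive ?h t)"
      using has_oriented_integral_unique by blast
    then have "S (- t) (u t - S t x) = primitive ?h t" by (simp add: S_inv)
    then show ?thesis by (simp add: S_diff S_inv algebra_simps)
  qed
  show "\<exists>v. v 0 = x \<and> (\<forall>t. (v has_vector_derivative pullback V t (v t)) (at t)) \<and> u = (\<lambda>t. S t (v t))"
  proof (intro exI[of _ "\<lambda>t. x + primitive ?h t"] conjI allI)
    show uS: "u = (\<lambda>t. S t (x + primitive ?h t))" by (simp add: S_inv flip: eq)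
    fix t
    have "((\<lambda>t. x + primitive ?h t) has_vector_derivative 0 + ?h t) (at t)"
      by (intro has_vector_derivative_add has_vector_derivative_const H)
    moreover have "pullback V t (x + primitive ?h t) = ?h t"
      by (simp add: pullback_def S_inv flip: eq)
    ultimately show "((\<lambda>t. x + primitive ?h t) has_vector_derivative pullback V t (x + primitive ?h t)) (at t)" by simp
  qed (simp add: primitive_0)
next
  assume "\<exists>v. v 0 = x \<and> (\<forall>t. (v has_vector_derivative pullback V t (v t)) (at t)) \<and> u = (\<lambda>t. S t (v t))"
  then obtain v where v: "v 0 = x" "\<And>t. (v has_vector_derivative pullback V t (v t)) (at t)" "u = (\<lambda>t. S t (v t))"
    by blast
  have "continuous_on UNIV v" using v(2) by (meson continuous_at_imp_continuous_on has_vector_derivative_continuous)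
  then have "continuous_on UNIV u" unfolding v(3) by (rule continuous_on_S)
  moreover have "has_oriented_integral (\<lambda>s. S (t - s) (V (u s))) (u t - S t x) 0 t" for t
  proof -
    have "has_oriented_integral (\<lambda>s. S t (pullback V s (v s))) (S t (v t - v 0)) 0 t"
      by (rule has_oriented_integral_linear[OF has_oriented_integral_FTC[OF v(2)] S_linear])
    then show ?thesis by (simp add: pullback_def v(1,3) S_diff flip: S_add)
  qed
  ultimately show "mild_solution x u" by (simp add: mild_solution_def)
qed

text \<open>\<open>W_S\<close> carries the pairing from \<open>v t\<close> to
  \<open>S t (v t)\<close>, where the field is orthogonal to the energy gradient. The field
  \<open>X\<close> is left general so that the truncated equation is covered too.\<close>

lemma energy_conserved:
  assumes X: "\<And>x. X x \<bullet> W x = 0" and v: "\<And>t. (v has_vector_derivative pullback X t (v t)) (at t)"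
  shows "v t \<bullet> W (v t) = v 0 \<bullet> W (v 0)"
proof -
  have "((\<lambda>t. v t \<bullet> W (v t)) has_real_derivative 0) (at t)" for t
  proof -
    have "pullback X t (v t) \<bullet> W (v t) = S (- t) (X (S t (v t))) \<bullet> W (S (- t) (S t (v t)))"
      by (simp add: pullback_def S_inv)
    then have 0: "pullback X t (v t) \<bullet> W (v t) = 0" by (simp add: W_S X)
    then have 1: "v t \<bullet> W (pullback X t (v t)) = 0" by (simp add: inner_commute flip: W_sym)
    have "((\<lambda>t. v t \<bullet> W (v t)) has_vector_derivative v t \<bullet> W (pullback X t (v t)) + pullback X t (v t) \<bullet> W (v t)) (at t)"
      by (intro bounded_bilinear.has_vector_derivative[OF bounded_bilinear_inner] v
          bounded_linear.has_vector_derivative[OF W_linear])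
    then show ?thesis by (simp add: 0 1 has_real_derivative_iff_has_vector_derivative)
  qed
  then show ?thesis by (intro DERIV_isconst_all[rule_format]) auto
qed

text \<open>The constant involves only the energy form and not \<open>X\<close>, which allows the
  truncation radius to be fixed in advance.\<close>

lemma energy_bound:
  assumes X: "\<And>x. X x \<bullet> W x = 0" and v: "\<And>t. (v has_vector_derivative pullback X t (v t)) (at t)"
  shows "norm (v t) \<le> sqrt (c2 / c1) * norm (v 0)"
proof -
  have "c1 * (norm (v t))\<^sup>2 \<le> c2 * (norm (v 0))\<^sup>2"
    using W_lower[of "v t"] W_upper[of "v 0"] energy_conserved[OF X v, where t=t] by linarith
  then have "(norm (v t))\<^sup>2 \<le> c2 / c1 * (norm (v 0))\<^sup>2" using c1_pos by (simp add: field_simps)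
  then have "sqrt ((norm (v t))\<^sup>2) \<le> sqrt (c2 / c1 * (norm (v 0))\<^sup>2)" by (rule real_sqrt_le_mono)
  then show ?thesis by (simp only: real_sqrt_mult real_sqrt_abs abs_norm_cancel)
qed

lemma mild_solution_bound:
  assumes "mild_solution x u"
  shows "norm (u t) \<le> sqrt (c2 / c1) * norm x"
proof -
  obtain v where v: "v 0 = x" "\<And>t. (v has_vector_derivative pullback V t (v t)) (at t)" "u = (\<lambda>t. S t (v t))"
    using assms unfolding mild_solution_iff by blast
  show ?thesis using energy_bound[OF V_W v(2), of t] by (simp add: v(1,3) S_norm)
qed

lemma truncated_field:
  assumes "M > 0"
  shows "\<exists>L. lipschitz_field (pullback (\<lambda>x. V (radial_truncation M x))) L"
    and "V (radial_truncation M x) \<bullet> W x = 0"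
proof -
  let ?V = "\<lambda>x. V (radial_truncation M x)"
  obtain L where L: "\<And>y z. norm y \<le> M \<Longrightarrow> norm z \<le> M \<Longrightarrow> norm (V y - V z) \<le> L * norm (y - z)"
    using V_lipschitz[of M] by blast
  \<comment> \<open>The 2 comes from the truncation, \<open>max L 0\<close> guards against a
    negative \<open>L\<close>, and the added 1 makes \<open>K\<close> strictly positive.\<close>
  define K where "K = 2 * max L 0 + 1"
  have K: "norm (?V y - ?V z) \<le> K * norm (y - z)" for y z
  proof -
    have "norm (?V y - ?V z) \<le> L * norm (radial_truncation M y - radial_truncation M z)"
      by (intro L norm_radial_truncation assms)
    also have "\<dots> \<le> max L 0 * norm (radial_truncation M y - radial_truncation M z)"
      by (intro mult_right_mono) auto
    also have "\<dots> \<le> max L 0 * (2 * norm (y - z))"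
      by (intro mult_left_mono radial_truncation_lipschitz assms) auto
    also have "\<dots> \<le> K * norm (y - z)" by (simp add: K_def algebra_simps)
    finally show ?thesis .
  qed
  have "lipschitz_field (pullback ?V) K"
  proof
    show "0 < K" by (simp add: K_def)
    show "pullback ?V s 0 = 0" for s
      using linear_0[OF bounded_linear.linear[OF S_linear]] by (simp add: pullback_def radial_truncation_def V_0)
    show "norm (pullback ?V s x - pullback ?V s y) \<le> K * norm (x - y)" for s x y
      using K[of "S s x" "S s y"] by (simp add: pullback_def S_norm flip: S_diff)
    fix v :: "real \<Rightarrow> 'a" assume v: "continuous_on UNIV v"
    have "K-lipschitz_on UNIV ?V" using K by (intro lipschitz_onI) (auto simp: dist_norm K_def)
    then have "continuous_on UNIV ?V" by (rule lipschitz_on_continuous_on)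
    then have "continuous_on UNIV (\<lambda>s. ?V (S s (v s)))"
      by (rule continuous_on_compose2[OF _ continuous_on_S(1)[OF v]]) simp
    then show "continuous_on UNIV (\<lambda>s. pullback ?V s (v s))"
      unfolding pullback_def by (rule continuous_on_S(2))
  qed
  then show "\<exists>L. lipschitz_field (pullback ?V) L" ..
  let ?a = "M / max M (norm x)"
  have a: "?a > 0" using assms by simp
  have "?V x \<bullet> W (?a *\<^sub>R x) = 0" using V_W[of "radial_truncation M x"] by (simp add: radial_truncation_def)
  then show "?V x \<bullet> W x = 0"
    using a by (simp only: linear_scale[OF bounded_linear.linear[OF W_linear]] inner_scaleR_right) auto
qed

lemma truncation_inactive:
  assumes "M > 0" "norm (S t v) \<le> M"
  shows "pullback (\<lambda>x. V (radial_truncation M x)) t v = pullback V t v"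
  using assms by (simp add: pullback_def radial_truncation_id)

lemma mild_solution_exists: "\<exists>u. mild_solution x u"
proof -
  \<comment> \<open>The a priori bound holds for the truncated flow as well, so its solution never
    leaves this ball; the added 1 covers \<open>x = 0\<close>.\<close>
  define M where "M = sqrt (c2 / c1) * norm x + 1"
  \<comment> \<open>The sign of \<open>c2\<close> is inferred from the energy bounds at a nonzero
    vector, which give \<open>c1 \<le> c2\<close>.\<close>
  have M: "M > 0"
  proof -
    have "c1 * (norm x)\<^sup>2 \<le> c2 * (norm x)\<^sup>2" using W_lower[of x] W_upper[of x] by linarith
    then show ?thesis using c1_pos
      by (cases "x = 0") (auto simp: M_def intro!: add_nonneg_pos mult_nonneg_nonneg divide_nonneg_pos)
  qed
  obtain L where "lipschitz_field (pullback (\<lambda>x. V (radial_truncation M x))) L" using truncated_field(1)[OF M] by blast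
  then interpret F: lipschitz_field "pullback (\<lambda>x. V (radial_truncation M x))" L .
  obtain v where v: "v 0 = x" "F.integral_curve v" using F.integral_curve_exists[of x] by blast
  have d: "(v has_vector_derivative pullback (\<lambda>x. V (radial_truncation M x)) t (v t)) (at t)" for t
    using v(2) by (simp add: F.integral_curve_def)
  have "norm (S t (v t)) \<le> M" for t
    using energy_bound[OF truncated_field(2)[OF M] d, of t] v(1) by (simp add: S_norm M_def)
  then have "(v has_vector_derivative pullback V t (v t)) (at t)" for t
    using d[of t] by (simp add: truncation_inactive[OF M])
  then show ?thesis using v(1) unfolding mild_solution_iff by blast
qed

text \<open>All solutions with data in the ball of radius \<open>r\<close> stay in a common ball,
  hence solve one and the same globally Lipschitz truncated equation, to which
  \<open>integral_curves_distance\<close> applies.\<close>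

lemma mild_solution_dependence:
  "\<exists>k. \<forall>x y u w t. norm x \<le> r \<longrightarrow> norm y \<le> r \<longrightarrow> mild_solution x u \<longrightarrow> mild_solution y w \<longrightarrow>
     norm (u t - w t) \<le> 2 * norm (x - y) * exp (k * \<bar>t\<bar>)"
proof -
  \<comment> \<open>The absolute value keeps \<open>M\<close> positive for every real
    \<open>r\<close>.\<close>
  define M where "M = \<bar>sqrt (c2 / c1) * r\<bar> + 1"
  have M: "M > 0" by (simp add: M_def)
  obtain L where "lipschitz_field (pullback (\<lambda>x. V (radial_truncation M x))) L" using truncated_field(1)[OF M] by blast
  then interpret F: lipschitz_field "pullback (\<lambda>x. V (radial_truncation M x))" L .
  have curve: "\<exists>v. v 0 = x \<and> F.integral_curve v \<and> (\<forall>t. norm (v t) \<le> M * exp (2 * L * \<bar>t\<bar>)) \<and> u = (\<lambda>t. S t (v t))"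
    if x: "norm x \<le> r" and u: "mild_solution x u" for x u
  proof -
    obtain v where v: "v 0 = x" "\<And>t. (v has_vector_derivative pullback V t (v t)) (at t)" "u = (\<lambda>t. S t (v t))"
      using u unfolding mild_solution_iff by blast
    have b: "norm (v t) \<le> M" for t
    proof -
      have "norm (v t) \<le> sqrt (c2 / c1) * norm x" using energy_bound[OF V_W v(2), of t] v(1) by simp
      also have "\<dots> \<le> \<bar>sqrt (c2 / c1)\<bar> * r" using x by (intro mult_mono) auto
      also have "\<dots> \<le> M" using order_trans[OF norm_ge_zero x] by (simp add: M_def abs_mult)
      finally show ?thesis .
    qed
    moreover have "M \<le> M * exp (2 * L * \<bar>t\<bar>)" for t
      using M F.L_pos by (simp add: mult_le_cancel_left1)
    ultimately have "norm (v t) \<le> M * exp (2 * L * \<bar>t\<bar>)" for t by (meson order_trans)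
    moreover have "F.integral_curve v"
      unfolding F.integral_curve_def using v(2) truncation_inactive[OF M] b by (simp add: S_norm)
    ultimately show ?thesis using v(1,3) by blast
  qed
  show ?thesis
  proof (intro exI[of _ "2 * L"] allI impI)
    fix x y u w t assume xy: "norm x \<le> r" "norm y \<le> r" "mild_solution x u" "mild_solution y w"
    obtain v where v: "v 0 = x" "F.integral_curve v" "\<And>t. norm (v t) \<le> M * exp (2 * L * \<bar>t\<bar>)" "u = (\<lambda>t. S t (v t))"
      using curve[OF xy(1,3)] by blast
    obtain z where z: "z 0 = y" "F.integral_curve z" "\<And>t. norm (z t) \<le> M * exp (2 * L * \<bar>t\<bar>)" "w = (\<lambda>t. S t (z t))"
      using curve[OF xy(2,4)] by blast
    show "norm (u t - w t) \<le> 2 * norm (x - y) * exp (2 * L * \<bar>t\<bar>)"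
      using F.integral_curves_distance[OF v(2) z(2) v(3) z(3), of t] by (simp add: v(1,4) z(1,4) S_norm flip: S_diff)
  qed
qed

lemma mild_solution_unique:
  assumes "mild_solution x u" "mild_solution x w"
  shows "u = w"
proof
  fix t
  obtain k where k: "\<And>x' y u w t. norm x' \<le> norm x \<Longrightarrow> norm y \<le> norm x \<Longrightarrow> mild_solution x' u \<Longrightarrow> mild_solution y w \<Longrightarrow>
     norm (u t - w t) \<le> 2 * norm (x' - y) * exp (k * \<bar>t\<bar>)"
    using mild_solution_dependence[of "norm x"] by blast
  show "u t = w t" using k[OF order_refl order_refl assms, of t] by simp
qed

end

section \<open>The nonlinearity\<close>

text \<open>The factor \<open>r\<close> tames the derivative, which is unbounded near 0 when
  \<open>a < 1\<close>: at the mean value point \<open>z > r\<close> one has r z^(a-1) \<le> z^a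
  \<le> R^a.\<close>

lemma power_difference_bound:
  fixes a r R :: real
  assumes "a > 0" "0 \<le> r" "r \<le> R"
  shows "(R powr a - r powr a) * r \<le> a * R powr a * (R - r)"
proof (cases "r = 0 \<or> r = R")
  case False
  then have r: "0 < r" "r < R" using assms by auto
  have "\<exists>z>r. z < R \<and> R powr a - r powr a = (R - r) * (a * z powr (a - 1))"
    using r by (intro MVT2) (auto intro!: derivative_eq_intros simp: powr_diff field_simps)
  then obtain z where z: "r < z" "z < R" "R powr a - r powr a = (R - r) * (a * z powr (a - 1))" by blast
  have "z powr (a - 1) * r \<le> z powr (a - 1) * z" using z by (intro mult_left_mono) auto
  also have "\<dots> = z powr a" using z r by (simp add: powr_diff)
  also have "\<dots> \<le> R powr a" using z r assms by (intro powr_mono2) auto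
  finally have "(R - r) * a * (z powr (a - 1) * r) \<le> (R - r) * a * R powr a"
    using r assms by (intro mult_left_mono) auto
  then show ?thesis unfolding z(3) by (simp add: mult_ac)
qed (use assms in auto)

definition power_nonlinearity :: "real \<Rightarrow> complex \<Rightarrow> complex" where
  "power_nonlinearity \<sigma> z = complex_of_real (cmod z powr (2 * \<sigma>)) * z"

lemma power_nonlinearity_measurable [measurable]: "power_nonlinearity \<sigma> \<in> borel_measurable borel"
  unfolding power_nonlinearity_def by measurable

text \<open>The difference is split so that the difference of powers multiplies the argument of
  smaller modulus, as \<open>power_difference_bound\<close> requires; the other case is
  symmetric.\<close>

lemma power_nonlinearity_lipschitz:
  assumes "\<sigma> > 0"
  shows "cmod (power_nonlinearity \<sigma> z - power_nonlinearity \<sigma> w) \<le>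
    (2 * \<sigma> + 1) * (cmod z powr (2 * \<sigma>) + cmod w powr (2 * \<sigma>)) * cmod (z - w)"
proof -
  have *: "cmod (power_nonlinearity \<sigma> z - power_nonlinearity \<sigma> w) \<le> (2 * \<sigma> + 1) * cmod z powr (2 * \<sigma>) * cmod (z - w)"
    if le: "cmod w \<le> cmod z" for z w
  proof -
    let ?R = "cmod z powr (2 * \<sigma>)" and ?r = "cmod w powr (2 * \<sigma>)"
    have rR: "?r \<le> ?R" using le assms by (intro powr_mono2) auto
    have "power_nonlinearity \<sigma> z - power_nonlinearity \<sigma> w = complex_of_real ?R * (z - w) + complex_of_real (?R - ?r) * w"
      by (simp add: power_nonlinearity_def algebra_simps)
    then have "cmod (power_nonlinearity \<sigma> z - power_nonlinearity \<sigma> w) \<le> ?R * cmod (z - w) + (?R - ?r) * cmod w"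
      using norm_triangle_ineq[of "complex_of_real ?R * (z - w)" "complex_of_real (?R - ?r) * w"] rR
      by (simp add: norm_mult del: of_real_diff)
    also have "(?R - ?r) * cmod w \<le> 2 * \<sigma> * ?R * (cmod z - cmod w)"
      using assms le by (intro power_difference_bound) auto
    also have "\<dots> \<le> 2 * \<sigma> * ?R * cmod (z - w)"
      using assms norm_triangle_ineq2[of z w] by (intro mult_left_mono) auto
    finally show ?thesis by (simp add: algebra_simps)
  qed
  show ?thesis
  proof (cases "cmod w \<le> cmod z")
    case True
    note *[OF True]
    also have "(2 * \<sigma> + 1) * cmod z powr (2 * \<sigma>) * cmod (z - w) \<le> (2 * \<sigma> + 1) * (cmod z powr (2 * \<sigma>) + cmod w powr (2 * \<sigma>)) * cmod (z - w)"
      using assms by (intro mult_right_mono mult_left_mono) auto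
    finally show ?thesis .
  next
    case False
    then have "cmod (power_nonlinearity \<sigma> w - power_nonlinearity \<sigma> z) \<le> (2 * \<sigma> + 1) * cmod w powr (2 * \<sigma>) * cmod (w - z)"
      by (intro *) simp
    also have "\<dots> \<le> (2 * \<sigma> + 1) * (cmod z powr (2 * \<sigma>) + cmod w powr (2 * \<sigma>)) * cmod (w - z)"
      using assms by (intro mult_right_mono mult_left_mono) auto
    finally show ?thesis by (simp add: norm_minus_commute)
  qed
qed

text \<open>
  Convexity of \<open>|z|\<^sup>2\<^sup>\<sigma>\<^sup>+\<^sup>2 / (2\<sigma> + 2)\<close>, whose gradient is the nonlinearity, in the form of Young's inequality.
\<close>

lemma power_nonlinearity_convexity:
  assumes "\<sigma> > 0"
  shows "(w - z) \<bullet> power_nonlinearity \<sigma> z \<le>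
    (cmod w powr (2 * \<sigma> + 2) - cmod z powr (2 * \<sigma> + 2)) / (2 * \<sigma> + 2)"
proof -
  let ?p = "2 * \<sigma> + 2"
  \<comment> \<open>The exponent conjugate to \<open>?p\<close>.\<close>
  let ?q = "?p / (2 * \<sigma> + 1)"
  have "w \<bullet> power_nonlinearity \<sigma> z \<le> cmod w * cmod z powr (2 * \<sigma> + 1)"
  proof -
    have "w \<bullet> power_nonlinearity \<sigma> z \<le> cmod w * cmod (power_nonlinearity \<sigma> z)" by (rule norm_cauchy_schwarz)
    also have "cmod (power_nonlinearity \<sigma> z) = cmod z powr (2 * \<sigma> + 1)"
      by (simp add: power_nonlinearity_def norm_mult powr_add)
    finally show ?thesis .
  qed
  also have "\<dots> \<le> cmod w powr ?p / ?p + (cmod z powr (2 * \<sigma> + 1)) powr ?q / ?q"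
    using assms by (intro Youngs_inequality) (auto simp: field_simps)
  also have "(cmod z powr (2 * \<sigma> + 1)) powr ?q = cmod z powr ?p"
    using assms by (simp add: powr_powr)
  finally have 1: "w \<bullet> power_nonlinearity \<sigma> z \<le> cmod w powr ?p / ?p + cmod z powr ?p / ?q" .
  have "z \<bullet> power_nonlinearity \<sigma> z = cmod z powr (2 * \<sigma>) * (z \<bullet> z)"
    by (simp add: power_nonlinearity_def inner_complex_def algebra_simps)
  also have "\<dots> = cmod z powr ?p"
    by (simp add: powr_add powr_numeral flip: power2_norm_eq_inner)
  finally have 2: "z \<bullet> power_nonlinearity \<sigma> z = cmod z powr ?p" .
  have "cmod z powr ?p / ?q - cmod z powr ?p = - (cmod z powr ?p / ?p)"
    using assms by (simp add: field_simps)
  then show ?thesis using 1 2 by (simp add: inner_diff_left diff_divide_distrib)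
qed

section \<open>Mapping properties of the nonlinearity\<close>

lemma rep_of_freq_diff: "AE x in lborel. rep_l2 (of_freq (g - h)) x = rep_l2 (of_freq g) x - rep_l2 (of_freq h) x"
  using rep_l2_diff[of "of_freq g" "of_freq h"]
  by (simp add: linear_diff[OF bounded_linear.linear[OF bounded_linear_of_freq]])

lemma ennreal_power2_le_imp_le:
  assumes "x\<^sup>2 \<le> (ennreal B)\<^sup>2" "B \<ge> 0"
  shows "x \<le> ennreal B"
proof (cases x rule: ennreal_cases)
  case (real r)
  then have "r\<^sup>2 \<le> B\<^sup>2" using assms by (simp add: ennreal_power)
  then have "r \<le> B" using assms(2) by (rule power2_le_imp_le)
  then show ?thesis using real by (simp add: ennreal_leI)
next
  case top
  then show ?thesis using assms by (simp add: ennreal_power power2_eq_square top_unique flip: ennreal_mult)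
qed

text \<open>Cauchy-Schwarz squares both factors, leaving powers \<open>8 * \<sigma>\<close> and 4,
  both in the range of the embedding. With \<open>h = g\<close> it shows that the nonlinearity is
  square integrable, with a difference in place of \<open>h\<close> that it is locally
  Lipschitz.\<close>

lemma holder_of_freq:
  assumes "\<sigma> > 1/4"
  obtains K where "K \<ge> 0" "\<And>g h. (\<integral>\<^sup>+x. ennreal (cmod (rep_l2 (of_freq g) x) powr (4 * \<sigma>) * (cmod (rep_l2 (of_freq h) x))\<^sup>2) \<partial>lborel)
      \<le> ennreal (K * norm g powr (4 * \<sigma>) * (norm h)\<^sup>2)"
proof -
  have "8 * \<sigma> > 2" using assms by simp
  then obtain C1 where C1: "C1 > 0" "\<And>g. (\<integral>\<^sup>+x. ennreal (cmod (rep_l2 (of_freq g) x) powr (8 * \<sigma>)) \<partial>lborel) \<le> ennreal (C1 * norm g powr (8 * \<sigma>))"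
    using sobolev_embedding by blast
  have "(4::real) > 2" by simp
  then obtain C2 where C2: "C2 > 0" "\<And>g. (\<integral>\<^sup>+x. ennreal (cmod (rep_l2 (of_freq g) x) powr 4) \<partial>lborel) \<le> ennreal (C2 * norm g powr 4)"
    using sobolev_embedding by blast
  define K where "K = sqrt (C1 * C2)"
  have "(\<integral>\<^sup>+x. ennreal (cmod (rep_l2 (of_freq g) x) powr (4 * \<sigma>) * (cmod (rep_l2 (of_freq h) x))\<^sup>2) \<partial>lborel)
      \<le> ennreal (K * norm g powr (4 * \<sigma>) * (norm h)\<^sup>2)" (is "?I \<le> ennreal ?B") for g h
  proof -
    have [measurable]: "rep_l2 f \<in> borel_measurable borel" for f using rep_l2_measurable[of f] by simp
    let ?a = "\<lambda>x. cmod (rep_l2 (of_freq g) x) powr (4 * \<sigma>)" and ?b = "\<lambda>x. (cmod (rep_l2 (of_freq h) x))\<^sup>2"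
    have "?I = (\<integral>\<^sup>+x. ennreal (?a x) * ennreal (?b x) \<partial>lborel)" by (simp add: ennreal_mult)
    then have "?I\<^sup>2 \<le> (\<integral>\<^sup>+x. (ennreal (?a x))\<^sup>2 \<partial>lborel) * (\<integral>\<^sup>+x. (ennreal (?b x))\<^sup>2 \<partial>lborel)"
      using Cauchy_Schwarz_nn_integral[of "\<lambda>x. ennreal (?a x)" lborel "\<lambda>x. ennreal (?b x)"] by simp
    also have "(\<lambda>x. (ennreal (?a x))\<^sup>2) = (\<lambda>x. ennreal (cmod (rep_l2 (of_freq g) x) powr (8 * \<sigma>)))"
    proof
      fix x
      have "(?a x)\<^sup>2 = cmod (rep_l2 (of_freq g) x) powr (8 * \<sigma>)"
        by (simp add: power2_eq_square flip: powr_add)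
      then show "(ennreal (?a x))\<^sup>2 = ennreal (cmod (rep_l2 (of_freq g) x) powr (8 * \<sigma>))"
        by (simp add: ennreal_power)
    qed
    also have "(\<lambda>x. (ennreal (?b x))\<^sup>2) = (\<lambda>x. ennreal (cmod (rep_l2 (of_freq h) x) powr 4))"
    proof
      fix x
      have "((cmod (rep_l2 (of_freq h) x))\<^sup>2)\<^sup>2 = cmod (rep_l2 (of_freq h) x) ^ 4" by (simp flip: power_mult)
      then show "(ennreal (?b x))\<^sup>2 = ennreal (cmod (rep_l2 (of_freq h) x) powr 4)"
        by (simp add: ennreal_power powr_numeral)
    qed
    also have "(\<integral>\<^sup>+x. ennreal (cmod (rep_l2 (of_freq g) x) powr (8 * \<sigma>)) \<partial>lborel) * (\<integral>\<^sup>+x. ennreal (cmod (rep_l2 (of_freq h) x) powr 4) \<partial>lborel)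
      \<le> ennreal (C1 * norm g powr (8 * \<sigma>)) * ennreal (C2 * norm h powr 4)"
      by (intro mult_mono C1 C2) auto
    also have "\<dots> = ennreal (?B\<^sup>2)"
    proof -
      have "(norm g powr (4 * \<sigma>))\<^sup>2 = norm g powr (8 * \<sigma>)" by (simp add: power2_eq_square flip: powr_add)
      moreover have "((norm h)\<^sup>2)\<^sup>2 = norm h powr 4" by (simp add: powr_numeral flip: power_mult)
      ultimately have "?B\<^sup>2 = (C1 * norm g powr (8 * \<sigma>)) * (C2 * norm h powr 4)"
        using C1(1) C2(1) by (simp add: power_mult_distrib K_def)
      then show ?thesis using C1(1) C2(1) by (simp add: ennreal_mult)
    qed
    also have "\<dots> = (ennreal ?B)\<^sup>2" using C1(1) C2(1) by (subst ennreal_power) (auto simp: K_def)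
    finally have "?I\<^sup>2 \<le> (ennreal ?B)\<^sup>2" .
    then show ?thesis by (rule ennreal_power2_le_imp_le) (use C1(1) C2(1) in \<open>simp add: K_def\<close>)
  qed
  then show thesis using C1(1) C2(1) by (intro that[of K]) (auto simp: K_def)
qed


definition freq_nonlinearity :: "real \<Rightarrow> l2 \<Rightarrow> l2" where
  "freq_nonlinearity \<sigma> g = l2_of (\<lambda>x. power_nonlinearity \<sigma> (rep_l2 (of_freq g) x))"

lemma norm_power_nonlinearity_sq:
  "(cmod (power_nonlinearity \<sigma> z))\<^sup>2 = cmod z powr (4 * \<sigma>) * (cmod z)\<^sup>2"
proof -
  have "(cmod z powr (2 * \<sigma>))\<^sup>2 = cmod z powr (4 * \<sigma>)" by (simp add: power2_eq_square flip: powr_add)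
  then show ?thesis by (simp add: power_nonlinearity_def norm_mult power_mult_distrib)
qed

lemma square_integrable_power_nonlinearity:
  assumes "\<sigma> > 1/4"
  shows "square_integrable (\<lambda>x. power_nonlinearity \<sigma> (rep_l2 (of_freq g) x))"
proof (rule square_integrableI)
  have [measurable]: "rep_l2 f \<in> borel_measurable borel" for f using rep_l2_measurable[of f] by simp
  show "(\<lambda>x. power_nonlinearity \<sigma> (rep_l2 (of_freq g) x)) \<in> borel_measurable lborel" by measurable
  obtain K where "(\<integral>\<^sup>+x. ennreal (cmod (rep_l2 (of_freq g) x) powr (4 * \<sigma>) * (cmod (rep_l2 (of_freq g) x))\<^sup>2) \<partial>lborel)
      \<le> ennreal (K * norm g powr (4 * \<sigma>) * (norm g)\<^sup>2)"
    using holder_of_freq[OF assms] by blast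
  then show "(\<integral>\<^sup>+x. ennreal ((cmod (power_nonlinearity \<sigma> (rep_l2 (of_freq g) x)))\<^sup>2) \<partial>lborel) < \<infinity>"
    unfolding norm_power_nonlinearity_sq by (rule le_less_trans) simp
qed

lemma rep_freq_nonlinearity:
  "\<sigma> > 1/4 \<Longrightarrow> AE x in lborel. rep_l2 (freq_nonlinearity \<sigma> g) x = power_nonlinearity \<sigma> (rep_l2 (of_freq g) x)"
  unfolding freq_nonlinearity_def by (intro rep_l2_of square_integrable_power_nonlinearity)

lemma freq_nonlinearity_lipschitz:
  assumes "\<sigma> > 1/4"
  shows "\<exists>L. \<forall>g h. norm g \<le> M \<longrightarrow> norm h \<le> M \<longrightarrow>
    norm (freq_nonlinearity \<sigma> g - freq_nonlinearity \<sigma> h) \<le> L * norm (g - h)"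
proof -
  obtain K where K: "K \<ge> 0" "\<And>g h. (\<integral>\<^sup>+x. ennreal (cmod (rep_l2 (of_freq g) x) powr (4 * \<sigma>) * (cmod (rep_l2 (of_freq h) x))\<^sup>2) \<partial>lborel)
      \<le> ennreal (K * norm g powr (4 * \<sigma>) * (norm h)\<^sup>2)"
    using holder_of_freq[OF assms] by blast
  \<comment> \<open>The square of the pointwise Lipschitz constant, doubled by (a + b)^2 \<le> 2 a^2
    + 2 b^2.\<close>
  define c where "c = 2 * (2 * \<sigma> + 1)\<^sup>2"
  have c: "c \<ge> 0" by (simp add: c_def)
  \<comment> \<open>The 2 under the root counts the two equal bounds, one for each of
    \<open>g\<close> and \<open>h\<close>.\<close>
  let ?L = "sqrt (2 * c * K * M powr (4 * \<sigma>))"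
  have [measurable]: "rep_l2 f \<in> borel_measurable borel" for f using rep_l2_measurable[of f] by simp
  have "norm (freq_nonlinearity \<sigma> g - freq_nonlinearity \<sigma> h) \<le> ?L * norm (g - h)"
    if M: "norm g \<le> M" "norm h \<le> M" for g h
  proof -
    let ?f = "\<lambda>g x. rep_l2 (of_freq g) x"
    let ?N = "\<lambda>g x. power_nonlinearity \<sigma> (?f g x)"
    let ?A = "\<lambda>g x. ennreal (cmod (?f g x) powr (4 * \<sigma>) * (cmod (?f (g - h) x))\<^sup>2)"
    let ?A' = "\<lambda>x. ennreal (cmod (?f h x) powr (4 * \<sigma>) * (cmod (?f (g - h) x))\<^sup>2)"
    note sq = square_integrable_power_nonlinearity[OF assms]
    have pw: "(cmod (power_nonlinearity \<sigma> z - power_nonlinearity \<sigma> w))\<^sup>2 \<le>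
       c * (cmod z powr (4 * \<sigma>) * (cmod (z - w))\<^sup>2 + cmod w powr (4 * \<sigma>) * (cmod (z - w))\<^sup>2)" for z w
    proof -
      have "(cmod (power_nonlinearity \<sigma> z - power_nonlinearity \<sigma> w))\<^sup>2 \<le>
        ((2 * \<sigma> + 1) * (cmod z powr (2 * \<sigma>) + cmod w powr (2 * \<sigma>)) * cmod (z - w))\<^sup>2"
        using assms by (intro power_mono power_nonlinearity_lipschitz) auto
      also have "\<dots> = (2 * \<sigma> + 1)\<^sup>2 * (cmod z powr (2 * \<sigma>) + cmod w powr (2 * \<sigma>))\<^sup>2 * (cmod (z - w))\<^sup>2"
        by (simp add: power_mult_distrib)
      also have "\<dots> \<le> (2 * \<sigma> + 1)\<^sup>2 * (2 * (cmod z powr (2 * \<sigma>))\<^sup>2 + 2 * (cmod w powr (2 * \<sigma>))\<^sup>2) * (cmod (z - w))\<^sup>2"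
        using zero_le_power2[of "cmod z powr (2 * \<sigma>) - cmod w powr (2 * \<sigma>)"]
        by (intro mult_right_mono mult_left_mono zero_le_power2) (auto simp: power2_sum power2_diff)
      also have "(cmod z powr (2 * \<sigma>))\<^sup>2 = cmod z powr (4 * \<sigma>)" by (simp add: power2_eq_square flip: powr_add)
      also have "(cmod w powr (2 * \<sigma>))\<^sup>2 = cmod w powr (4 * \<sigma>)" by (simp add: power2_eq_square flip: powr_add)
      finally show ?thesis by (simp add: c_def algebra_simps)
    qed
    have "ennreal ((norm (freq_nonlinearity \<sigma> g - freq_nonlinearity \<sigma> h))\<^sup>2) = (\<integral>\<^sup>+x. ennreal ((cmod (?N g x - ?N h x))\<^sup>2) \<partial>lborel)"
      unfolding freq_nonlinearity_def l2_of_diff[OF sq sq, symmetric]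
      by (rule nn_norm_l2_of[OF square_integrable_diff[OF sq sq], symmetric])
    also have "\<dots> \<le> (\<integral>\<^sup>+x. ennreal c * (?A g x + ?A' x) \<partial>lborel)"
    proof (rule nn_integral_mono_AE)
      show "AE x in lborel. ennreal ((cmod (?N g x - ?N h x))\<^sup>2) \<le> ennreal c * (?A g x + ?A' x)"
        using rep_of_freq_diff[of g h]
      proof eventually_elim
        case (elim x)
        have "ennreal ((cmod (?N g x - ?N h x))\<^sup>2) \<le> ennreal (c * (cmod (?f g x) powr (4 * \<sigma>) * (cmod (?f (g - h) x))\<^sup>2 + cmod (?f h x) powr (4 * \<sigma>) * (cmod (?f (g - h) x))\<^sup>2))"
          unfolding elim by (intro ennreal_leI pw)
        then show ?case using c by (simp add: ennreal_mult ennreal_plus)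
      qed
    qed
    also have "\<dots> = ennreal c * ((\<integral>\<^sup>+x. ?A g x \<partial>lborel) + (\<integral>\<^sup>+x. ?A' x \<partial>lborel))"
      by (subst nn_integral_cmult, measurable) (subst nn_integral_add; measurable)
    also have "\<dots> \<le> ennreal c * (ennreal (K * norm g powr (4 * \<sigma>) * (norm (g - h))\<^sup>2) + ennreal (K * norm h powr (4 * \<sigma>) * (norm (g - h))\<^sup>2))"
      by (intro mult_left_mono add_mono K) auto
    also have "\<dots> \<le> ennreal c * (ennreal (K * M powr (4 * \<sigma>) * (norm (g - h))\<^sup>2) + ennreal (K * M powr (4 * \<sigma>) * (norm (g - h))\<^sup>2))"
      using assms K(1) M by (intro mult_left_mono add_mono ennreal_leI mult_right_mono powr_mono2) auto
    also have "\<dots> = ennreal (2 * c * K * M powr (4 * \<sigma>) * (norm (g - h))\<^sup>2)"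
      using c K(1) by (simp flip: ennreal_mult ennreal_plus)
    finally have "(norm (freq_nonlinearity \<sigma> g - freq_nonlinearity \<sigma> h))\<^sup>2 \<le> 2 * c * K * M powr (4 * \<sigma>) * (norm (g - h))\<^sup>2"
      using c K(1) by (subst (asm) ennreal_le_iff) auto
    then have "sqrt ((norm (freq_nonlinearity \<sigma> g - freq_nonlinearity \<sigma> h))\<^sup>2) \<le> sqrt (2 * c * K * M powr (4 * \<sigma>) * (norm (g - h))\<^sup>2)"
      by (rule real_sqrt_le_mono)
    then show ?thesis by (simp only: real_sqrt_mult real_sqrt_abs abs_norm_cancel)
  qed
  then show ?thesis by blast
qed

section \<open>Orthogonality of the gradient and the nonlinearity\<close>

text \<open>The symbol of \<open>\<delta> \<bullet> \<nabla>\<close> after \<open>of_freq\<close>: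
  the one derivative is compensated by the inverse bracket.\<close>

definition grad_symbol :: "real^2 \<Rightarrow> real^2 \<Rightarrow> complex" where
  "grad_symbol \<delta> \<xi> = \<i> * complex_of_real (\<delta> \<bullet> \<xi>) * inv_bracket \<xi>"

lemma bounded_symbol_grad: "bounded_symbol (grad_symbol \<delta>)"
proof (rule bounded_symbolI[where C="norm \<delta>"])
  show "grad_symbol \<delta> \<in> borel_measurable lborel" unfolding grad_symbol_def by measurable
  show "cmod (grad_symbol \<delta> \<xi>) \<le> norm \<delta>" for \<xi>
  proof -
    have "\<bar>\<delta> \<bullet> \<xi>\<bar> \<le> norm \<delta> * norm \<xi>" by (rule Cauchy_Schwarz_ineq2)
    also have "\<dots> \<le> norm \<delta> * bracket \<xi>" by (intro mult_left_mono norm_le_bracket) simp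
    finally show ?thesis using bracket_pos[of \<xi>]
      by (simp add: grad_symbol_def norm_mult norm_inv_bracket divide_le_eq)
  qed
qed

text \<open>
  The difference quotient of translations: pairing it with the nonlinearity is nonpositive by convexity and
  translation invariance, for increments of either sign, so the derivative is orthogonal to the nonlinearity.
\<close>

lemma translation_pairing_nonpos:
  assumes "\<sigma> > 1/4"
  shows "(translate_l2 a (of_freq g) - of_freq g) \<bullet> freq_nonlinearity \<sigma> g \<le> 0"
proof -
  let ?p = "2 * \<sigma> + 2" and ?f = "rep_l2 (of_freq g)"
  have [measurable]: "rep_l2 f \<in> borel_measurable borel" for f using rep_l2_measurable[of f] by simp
  \<comment> \<open>The embedding at this exponent makes the potential integrable, so that its
    translate and itself can be integrated separately and cancel.\<close>
  have "?p > 2" using assms by simp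
  then obtain C where C: "(\<integral>\<^sup>+x. ennreal (cmod (?f x) powr ?p) \<partial>lborel) \<le> ennreal (C * norm g powr ?p)"
    using sobolev_embedding by blast
  have int: "integrable lborel (\<lambda>x. cmod (?f x) powr ?p)"
    using le_less_trans[OF C ennreal_less_top] by (intro integrableI_nonneg) auto
  have bi: "has_bochner_integral lborel (\<lambda>x. cmod (?f (a + x)) powr ?p) (LINT x|lborel. cmod (?f x) powr ?p)"
    using has_bochner_integral_affine_isometry[OF disjI1[OF refl] has_bochner_integral_integrable[OF int], of a] by simp
  let ?d = "\<lambda>x. (cmod (?f (a + x)) powr ?p - cmod (?f x) powr ?p) / ?p"
  have di: "integrable lborel ?d" using bi int by (auto simp: has_bochner_integral_iff)
  have "(translate_l2 a (of_freq g) - of_freq g) \<bullet> freq_nonlinearity \<sigma> g =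
     (LINT x|lborel. rep_l2 (translate_l2 a (of_freq g) - of_freq g) x \<bullet> rep_l2 (freq_nonlinearity \<sigma> g) x)"
    by (rule inner_l2_rep)
  also have "\<dots> \<le> (LINT x|lborel. ?d x)"
  proof (rule integral_mono_AE[OF square_integrable_inner[OF square_integrable_rep_l2 square_integrable_rep_l2] di])
    show "AE x in lborel. rep_l2 (translate_l2 a (of_freq g) - of_freq g) x \<bullet> rep_l2 (freq_nonlinearity \<sigma> g) x \<le> ?d x"
      using rep_l2_diff[of "translate_l2 a (of_freq g)" "of_freq g"] rep_translate_l2[of a "of_freq g"] rep_freq_nonlinearity[OF assms, of g]
    proof eventually_elim
      case (elim x)
      show ?case unfolding elim using assms by (intro power_nonlinearity_convexity) auto
    qed
  qed
  also have "\<dots> = 0"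
  proof -
    have "(LINT x|lborel. cmod (?f (a + x)) powr ?p - cmod (?f x) powr ?p) = 0"
      using bi int by (subst Bochner_Integration.integral_diff) (auto simp: has_bochner_integral_iff)
    then show ?thesis by simp
  qed
  finally show ?thesis .
qed

text \<open>On the frequency side the quotients have symbols converging pointwise to
  \<open>grad_symbol \<delta>\<close>, and |exp(is) - 1| \<le> |s| bounds them all by
  \<open>norm \<delta>\<close>.\<close>

lemma translation_difference_quotient:
  "(\<lambda>n. real (Suc n) *\<^sub>R (translate_l2 (inverse (real (Suc n)) *\<^sub>R \<delta>) (of_freq g) - of_freq g))
     \<longlonglongrightarrow> ifourier (mult_l2 (grad_symbol \<delta>) g)"
proof -
  define m where "m n \<xi> = complex_of_real (real (Suc n)) * (exp (\<i> * complex_of_real ((inverse (real (Suc n)) *\<^sub>R \<delta>) \<bullet> \<xi>)) - 1) * inv_bracket \<xi>" for n \<xi>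
  have mm: "m n \<in> borel_measurable lborel" for n unfolding m_def by measurable
  have mb: "cmod (m n \<xi>) \<le> norm \<delta>" for n \<xi>
  proof -
    let ?s = "(inverse (real (Suc n)) *\<^sub>R \<delta>) \<bullet> \<xi>"
    have "cmod (exp (\<i> * complex_of_real ?s) - 1) \<le> \<bar>?s\<bar>"
      using iexp_approx1[of ?s 0] by simp
    then have "real (Suc n) * cmod (exp (\<i> * complex_of_real ?s) - 1) \<le> real (Suc n) * \<bar>?s\<bar>" by (rule mult_left_mono) simp
    also have "\<dots> = \<bar>\<delta> \<bullet> \<xi>\<bar>" by (simp add: abs_mult)
    also have "\<dots> \<le> norm \<delta> * norm \<xi>" by (rule Cauchy_Schwarz_ineq2)
    also have "\<dots> \<le> norm \<delta> * bracket \<xi>" by (intro mult_left_mono norm_le_bracket) simp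
    finally have "real (Suc n) * cmod (exp (\<i> * complex_of_real ?s) - 1) \<le> norm \<delta> * bracket \<xi>" .
    then have "real (Suc n) * cmod (exp (\<i> * complex_of_real ?s) - 1) / bracket \<xi> \<le> norm \<delta>"
      using bracket_pos[of \<xi>] by (subst pos_divide_le_eq) auto
    then show ?thesis unfolding m_def norm_mult norm_inv_bracket norm_of_real by simp
  qed
  have bm: "bounded_symbol (m n)" for n using mm mb by (rule bounded_symbolI)
  have lim: "(\<lambda>n. m n \<xi>) \<longlonglongrightarrow> grad_symbol \<delta> \<xi>" for \<xi>
  proof -
    let ?z = "\<i> * complex_of_real (\<delta> \<bullet> \<xi>)"
    have "((\<lambda>h. exp (h * ?z)) has_field_derivative ?z) (at 0)"
      by (auto intro!: derivative_eq_intros)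
    then have "(\<lambda>h. (exp (h * ?z) - 1) / h) \<midarrow>0\<rightarrow> ?z" by (simp add: DERIV_def)
    moreover have "filterlim (\<lambda>n. complex_of_real (inverse (real (Suc n)))) (at 0) sequentially"
    proof -
      have "(\<lambda>n. complex_of_real (inverse (real (Suc n)))) \<longlonglongrightarrow> complex_of_real 0"
        by (intro tendsto_of_real LIMSEQ_inverse_real_of_nat)
      then show ?thesis by (simp add: filterlim_at del: of_nat_Suc)
    qed
    ultimately have "(\<lambda>n. (exp (complex_of_real (inverse (real (Suc n))) * ?z) - 1) / complex_of_real (inverse (real (Suc n)))) \<longlonglongrightarrow> ?z"
      by (rule filterlim_compose)
    then have "(\<lambda>n. (exp (complex_of_real (inverse (real (Suc n))) * ?z) - 1) / complex_of_real (inverse (real (Suc n))) * inv_bracket \<xi>) \<longlonglongrightarrow> ?z * inv_bracket \<xi>"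
      by (intro tendsto_intros)
    moreover have "(exp (complex_of_real (inverse (real (Suc n))) * ?z) - 1) / complex_of_real (inverse (real (Suc n))) * inv_bracket \<xi> = m n \<xi>" for n
      by (simp add: m_def divide_inverse mult_ac)
    ultimately show ?thesis by (simp add: grad_symbol_def)
  qed
  have eq: "real (Suc n) *\<^sub>R (translate_l2 (inverse (real (Suc n)) *\<^sub>R \<delta>) (of_freq g) - of_freq g) = ifourier (mult_l2 (m n) g)" for n
  proof -
    let ?a = "inverse (real (Suc n)) *\<^sub>R \<delta>"
    let ?e = "\<lambda>\<xi>. exp (\<i> * complex_of_real (?a \<bullet> \<xi>))"
    have "fourier (real (Suc n) *\<^sub>R (translate_l2 ?a (of_freq g) - of_freq g)) =
       real (Suc n) *\<^sub>R (mult_l2 ?e (mult_l2 inv_bracket g) - mult_l2 inv_bracket g)"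
      by (simp add: fourier_scaleR fourier_translate linear_diff[OF bounded_linear.linear[OF bounded_linear_fourier]]
          of_freq_def fourier_ifourier)
    also have "\<dots> = mult_l2 (m n) g"
    proof (rule l2_eqI)
      show "AE x in lborel. rep_l2 (real (Suc n) *\<^sub>R (mult_l2 ?e (mult_l2 inv_bracket g) - mult_l2 inv_bracket g)) x = rep_l2 (mult_l2 (m n) g) x"
        using rep_mult_l2[OF bm, of n g] rep_l2_scaleR[of "real (Suc n)" "mult_l2 ?e (mult_l2 inv_bracket g) - mult_l2 inv_bracket g"]
          rep_l2_diff[of "mult_l2 ?e (mult_l2 inv_bracket g)" "mult_l2 inv_bracket g"]
          rep_mult_l2[OF bounded_symbol_phase, of ?a "mult_l2 inv_bracket g"] rep_mult_l2[OF bounded_symbol_inv_bracket, of g]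
      proof eventually_elim
        case (elim x)
        show ?case unfolding elim m_def
          by (simp only: left_diff_distrib right_diff_distrib mult.assoc mult_1_left)
      qed
    qed
    finally show ?thesis by (metis ifourier_fourier)
  qed
  show ?thesis unfolding eq
    by (intro bounded_linear.tendsto[OF bounded_linear_ifourier] mult_l2_tendsto[OF mm bounded_symbol_grad mb lim])
qed

lemma gradient_orthogonal_nonlinearity:
  assumes "\<sigma> > 1/4"
  shows "ifourier (mult_l2 (grad_symbol \<delta>) g) \<bullet> freq_nonlinearity \<sigma> g = 0"
proof -
  have le: "ifourier (mult_l2 (grad_symbol \<delta>) g) \<bullet> freq_nonlinearity \<sigma> g \<le> 0" for \<delta>
  proof (rule tendsto_upperbound)
    show "(\<lambda>n. (real (Suc n) *\<^sub>R (translate_l2 (inverse (real (Suc n)) *\<^sub>R \<delta>) (of_freq g) - of_freq g)) \<bullet> freq_nonlinearity \<sigma> g)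
      \<longlonglongrightarrow> ifourier (mult_l2 (grad_symbol \<delta>) g) \<bullet> freq_nonlinearity \<sigma> g"
      by (intro tendsto_inner tendsto_const translation_difference_quotient)
    show "\<forall>\<^sub>F n in sequentially. (real (Suc n) *\<^sub>R (translate_l2 (inverse (real (Suc n)) *\<^sub>R \<delta>) (of_freq g) - of_freq g)) \<bullet> freq_nonlinearity \<sigma> g \<le> 0"
      using translation_pairing_nonpos[OF assms]
      by (intro always_eventually allI) (simp only: inner_scaleR_left mult_nonneg_nonpos of_nat_0_le_iff)
  qed simp
  have "mult_l2 (grad_symbol (- \<delta>)) g = - mult_l2 (grad_symbol \<delta>) g"
  proof (rule l2_eqI)
    show "AE x in lborel. rep_l2 (mult_l2 (grad_symbol (- \<delta>)) g) x = rep_l2 (- mult_l2 (grad_symbol \<delta>) g) x"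
      using rep_mult_l2[OF bounded_symbol_grad, of "- \<delta>" g] rep_mult_l2[OF bounded_symbol_grad, of \<delta> g] rep_l2_uminus[of "mult_l2 (grad_symbol \<delta>) g"]
      by eventually_elim (simp add: grad_symbol_def)
  qed
  then have "ifourier (mult_l2 (grad_symbol (- \<delta>)) g) = - ifourier (mult_l2 (grad_symbol \<delta>) g)"
    by (simp add: linear_neg[OF bounded_linear.linear[OF bounded_linear_ifourier]])
  with le[of \<delta>] le[of "- \<delta>"] show ?thesis by simp
qed

section \<open>The equation in the frequency variable\<close>

definition from_freq :: "l2 \<Rightarrow> h1" where
  "from_freq g = h1_of_l2 (of_freq g)"

lemma fourier_of_freq: "fourier (of_freq g) = mult_l2 inv_bracket g"
  by (simp add: of_freq_def fourier_ifourier)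

lemma bounded_symbol_norm_inv_bracket: "bounded_symbol (\<lambda>\<xi>. complex_of_real (norm \<xi>) * inv_bracket \<xi>)"
proof (rule bounded_symbolI[where C=1])
  show "(\<lambda>\<xi>. complex_of_real (norm \<xi>) * inv_bracket \<xi>) \<in> borel_measurable lborel" by measurable
  show "cmod (complex_of_real (norm \<xi>) * inv_bracket \<xi>) \<le> 1" for \<xi>
    using norm_le_bracket[of \<xi>] bracket_pos[of \<xi>] by (simp add: norm_mult norm_inv_bracket)
qed

lemma weighted_of_freq:
  shows "square_integrable (\<lambda>\<xi>. complex_of_real (norm \<xi>) * rep_l2 (mult_l2 inv_bracket g) \<xi>)"
    and "l2_of (\<lambda>\<xi>. complex_of_real (norm \<xi>) * rep_l2 (mult_l2 inv_bracket g) \<xi>) =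
      mult_l2 (\<lambda>\<xi>. complex_of_real (norm \<xi>) * inv_bracket \<xi>) g"
proof -
  have sq: "square_integrable (\<lambda>\<xi>. complex_of_real (norm \<xi>) * inv_bracket \<xi> * rep_l2 g \<xi>)"
    by (intro square_integrable_symbol bounded_symbol_norm_inv_bracket square_integrable_rep_l2)
  have ae: "AE \<xi> in lborel. complex_of_real (norm \<xi>) * rep_l2 (mult_l2 inv_bracket g) \<xi> = complex_of_real (norm \<xi>) * inv_bracket \<xi> * rep_l2 g \<xi>"
    using rep_mult_l2[OF bounded_symbol_inv_bracket, of g] by eventually_elim simp
  show s: "square_integrable (\<lambda>\<xi>. complex_of_real (norm \<xi>) * rep_l2 (mult_l2 inv_bracket g) \<xi>)"
    by (rule square_integrable_cong_AE[OF sq weighted_measurable ae])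
  show "l2_of (\<lambda>\<xi>. complex_of_real (norm \<xi>) * rep_l2 (mult_l2 inv_bracket g) \<xi>) =
      mult_l2 (\<lambda>\<xi>. complex_of_real (norm \<xi>) * inv_bracket \<xi>) g"
    unfolding mult_l2_def by (rule l2_of_eqI[OF _ sq]) (use s ae in \<open>simp_all add: mult_l2_def\<close>)
qed

lemma l2_of_h1_from_freq: "l2_of_h1 (from_freq g) = of_freq g"
proof -
  have "of_freq g \<in> h1_set"
    unfolding h1_set_def using weighted_of_freq(1)[of g] by (auto simp: has_fourier_eq fourier_of_freq)
  then show ?thesis by (simp add: from_freq_def h1_of_l2_inverse)
qed

lemma norm_mult_l2_sq:
  assumes "bounded_symbol m"
  shows "(norm (mult_l2 m g))\<^sup>2 = g \<bullet> mult_l2 (\<lambda>\<xi>. cnj (m \<xi>) * m \<xi>) g"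
  by (simp add: power2_norm_eq_inner inner_mult_l2 mult_l2_mult_l2 bounded_symbol_cnj assms)

text \<open>The two parts of the norm carry the weights \<open>1 / (bracket \<xi>)\<^sup>2\<close>
  and \<open>(norm \<xi>)\<^sup>2 / (bracket \<xi>)\<^sup>2\<close>, which add up to 1.\<close>

lemma norm_from_freq: "norm (from_freq g) = norm g"
proof -
  let ?n = "\<lambda>\<xi>. complex_of_real (norm \<xi>) * inv_bracket \<xi>"
  have one: "cnj (inv_bracket \<xi>) * inv_bracket \<xi> + cnj (?n \<xi>) * ?n \<xi> = 1" for \<xi>
  proof -
    have "(1 / bracket \<xi>) * (1 / bracket \<xi>) + (norm \<xi> * (1 / bracket \<xi>)) * (norm \<xi> * (1 / bracket \<xi>)) = (1 + (norm \<xi>)\<^sup>2) / (bracket \<xi>)\<^sup>2"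
      by (simp add: power2_eq_square add_divide_distrib)
    also have "\<dots> = 1" using bracket_pos[of \<xi>] by (simp flip: bracket_sq)
    finally have "complex_of_real ((1 / bracket \<xi>) * (1 / bracket \<xi>) + (norm \<xi> * (1 / bracket \<xi>)) * (norm \<xi> * (1 / bracket \<xi>))) = 1"
      by (simp only: of_real_1)
    then show ?thesis unfolding inv_bracket_def
      by (simp only: complex_cnj_mult complex_cnj_complex_of_real of_real_add of_real_mult)
  qed
  note b = bounded_symbol_inv_bracket bounded_symbol_norm_inv_bracket
  have "(norm (of_freq g))\<^sup>2 + (norm (abs_grad (of_freq g)))\<^sup>2 = (norm (mult_l2 inv_bracket g))\<^sup>2 + (norm (mult_l2 ?n g))\<^sup>2"
    by (simp add: abs_grad_def fourier_of_freq weighted_of_freq(2)) (simp add: of_freq_def norm_ifourier)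
  also have "\<dots> = g \<bullet> mult_l2 (\<lambda>\<xi>. cnj (inv_bracket \<xi>) * inv_bracket \<xi> + cnj (?n \<xi>) * ?n \<xi>) g"
    unfolding norm_mult_l2_sq[OF b(1)] norm_mult_l2_sq[OF b(2)]
    by (subst mult_l2_symbol_add) (intro bounded_symbol_mult bounded_symbol_cnj b, intro bounded_symbol_mult bounded_symbol_cnj b, simp only: inner_add_right)
  also have "\<dots> = (norm g)\<^sup>2" unfolding one by (simp add: mult_l2_1 power2_norm_eq_inner)
  finally show ?thesis by (simp add: norm_h1.rep_eq l2_of_h1_from_freq)
qed

lemma linear_from_freq: "linear from_freq"
proof (rule linearI)
  show "from_freq (g + h) = from_freq g + from_freq h" for g h
    by (simp add: l2_of_h1_from_freq plus_h1.rep_eq linear_add[OF bounded_linear.linear[OF bounded_linear_of_freq]] flip: l2_of_h1_inject)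
  show "from_freq (c *\<^sub>R g) = c *\<^sub>R from_freq g" for c g
    by (simp add: l2_of_h1_from_freq scaleR_h1.rep_eq linear_scale[OF bounded_linear.linear[OF bounded_linear_of_freq]] flip: l2_of_h1_inject)
qed

lemma norm_from_freq_diff: "norm (from_freq g - from_freq h) = norm (g - h)"
  by (simp add: norm_from_freq flip: linear_diff[OF linear_from_freq])

lemma from_freq_inject: "from_freq g = from_freq h \<longleftrightarrow> g = h"
  using norm_from_freq_diff[of g h] by auto

lemma of_freq_inject: "of_freq g = of_freq h \<longleftrightarrow> g = h"
  by (metis from_freq_inject from_freq_def)

text \<open>The preimage is the bracket times the transform; the two summands of
  \<open>(bracket \<xi>)\<^sup>2\<close> are controlled by the transform being in L^2 and by
  membership in \<open>h1_set\<close>.\<close>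

lemma from_freq_surj: "\<exists>g. u = from_freq g"
proof -
  have "l2_of_h1 u \<in> h1_set" by (rule l2_of_h1)
  then obtain g' where g': "has_fourier (l2_of_h1 u) g'" "square_integrable (\<lambda>\<xi>. complex_of_real (norm \<xi>) * rep_l2 g' \<xi>)"
    unfolding h1_set_def by blast
  have sq: "square_integrable (\<lambda>\<xi>. complex_of_real (bracket \<xi>) * rep_l2 g' \<xi>)"
    unfolding square_integrable_def
  proof
    have "(cmod (complex_of_real (bracket \<xi>) * rep_l2 g' \<xi>))\<^sup>2 = (cmod (rep_l2 g' \<xi>))\<^sup>2 + (cmod (complex_of_real (norm \<xi>) * rep_l2 g' \<xi>))\<^sup>2" for \<xi>
      by (simp add: norm_mult power_mult_distrib bracket_sq algebra_simps)
    then show "integrable lborel (\<lambda>\<xi>. (cmod (complex_of_real (bracket \<xi>) * rep_l2 g' \<xi>))\<^sup>2)"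
      using g'(2) square_integrable_rep_l2[of g'] unfolding square_integrable_def by (simp only:) auto
    have [measurable]: "rep_l2 g' \<in> borel_measurable borel" using rep_l2_measurable[of g'] by simp
    show "(\<lambda>\<xi>. complex_of_real (bracket \<xi>) * rep_l2 g' \<xi>) \<in> borel_measurable lborel" by measurable
  qed
  let ?g = "l2_of (\<lambda>\<xi>. complex_of_real (bracket \<xi>) * rep_l2 g' \<xi>)"
  have "mult_l2 inv_bracket ?g = g'"
  proof (rule l2_eqI)
    show "AE \<xi> in lborel. rep_l2 (mult_l2 inv_bracket ?g) \<xi> = rep_l2 g' \<xi>"
      using rep_mult_l2[OF bounded_symbol_inv_bracket, of ?g] rep_l2_of[OF sq]
    proof eventually_elim
      case (elim \<xi>)
      show ?case unfolding elim using bracket_pos[of \<xi>] by (simp add: inv_bracket_def)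
    qed
  qed
  then have "of_freq ?g = l2_of_h1 u" using g'(1) by (simp add: of_freq_def has_fourier_inverse)
  then have "u = from_freq ?g" by (simp add: l2_of_h1_from_freq flip: l2_of_h1_inject)
  then show ?thesis by blast
qed

lemma nonlinearity_from_freq: "nonlinearity \<sigma> (from_freq g) = freq_nonlinearity \<sigma> g"
  by (simp add: nonlinearity_def freq_nonlinearity_def power_nonlinearity_def l2_of_h1_from_freq)

lemma freq_nonlinearity_0: "freq_nonlinearity \<sigma> 0 = 0"
proof -
  have "AE x in lborel. power_nonlinearity \<sigma> (rep_l2 (of_freq 0) x) = 0"
    using rep_l2_0 by eventually_elim (simp add: power_nonlinearity_def linear_0[OF bounded_linear.linear[OF bounded_linear_of_freq]])
  moreover have "(\<lambda>x. power_nonlinearity \<sigma> (rep_l2 (of_freq 0) x)) \<in> borel_measurable lborel"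
  proof -
    have [measurable]: "rep_l2 (of_freq 0) \<in> borel_measurable borel" using rep_l2_measurable[of "of_freq 0"] by simp
    show ?thesis by measurable
  qed
  ultimately have "freq_nonlinearity \<sigma> 0 = l2_of (\<lambda>_. 0)"
    unfolding freq_nonlinearity_def by (intro l2_of_eqI square_integrable_0 square_integrable_cong_AE[OF square_integrable_0])
  then show ?thesis by (simp add: l2_of_def square_integrable_0 zero_l2_def)
qed

section \<open>Symbols of the equation and of its energy\<close>

definition phase :: "real \<Rightarrow> real \<Rightarrow> real^2 \<Rightarrow> complex" where
  "phase \<epsilon> t \<xi> = exp (- \<i> * complex_of_real (t * (norm \<xi>)\<^sup>2 / (1 + \<epsilon>\<^sup>2 * (norm \<xi>)\<^sup>2)))"

definition forcing_symbol :: "real \<Rightarrow> real^2 \<Rightarrow> real^2 \<Rightarrow> complex" where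
  "forcing_symbol \<epsilon> \<delta> \<xi> = P_symbol \<epsilon> (-1) \<xi> * (1 + \<i> * (\<i> * complex_of_real (\<delta> \<bullet> \<xi>)))"

text \<open>The factor \<open>\<i>\<close> is the one in front of the Duhamel integral, and the
  bracket comes from the change to the frequency variable.\<close>

definition field_symbol :: "real \<Rightarrow> real^2 \<Rightarrow> real^2 \<Rightarrow> complex" where
  "field_symbol \<epsilon> \<delta> \<xi> = \<i> * complex_of_real (bracket \<xi>) * forcing_symbol \<epsilon> \<delta> \<xi>"

text \<open>
  Symbol of the square root of the conserved energy \<open>\<parallel>u\<parallel>\<^sup>2 + \<epsilon>\<^sup>2\<parallel>\<nabla>u\<parallel>\<^sup>2\<close> in the variable \<open>(1 + |\<xi>|\<^sup>2)\<^sup>1\<^sup>/\<^sup>2\<close> times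
  the transform of \<open>u\<close>.
\<close>

definition energy_symbol :: "real \<Rightarrow> real^2 \<Rightarrow> complex" where
  "energy_symbol \<epsilon> \<xi> = complex_of_real (sqrt (1 + \<epsilon>\<^sup>2 * (norm \<xi>)\<^sup>2) / bracket \<xi>)"

definition freq_field :: "real \<Rightarrow> real \<Rightarrow> real^2 \<Rightarrow> l2 \<Rightarrow> l2" where
  "freq_field \<epsilon> \<sigma> \<delta> g = mult_l2 (field_symbol \<epsilon> \<delta>) (fourier (freq_nonlinearity \<sigma> g))"

lemma propagator_eq: "propagator \<epsilon> t f = ifourier (mult_l2 (phase \<epsilon> t) (fourier f))"
  unfolding propagator_def fourier_multiplier_eq phase_def ..

lemma forcing_eq: "forcing \<epsilon> \<delta> f = ifourier (mult_l2 (forcing_symbol \<epsilon> \<delta>) (fourier f))"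
  unfolding forcing_def fourier_multiplier_eq forcing_symbol_def ..

lemma norm_phase: "cmod (phase \<epsilon> t \<xi>) = 1"
  unfolding phase_def norm_exp_eq_Re by simp

lemma phase_measurable: "phase \<epsilon> t \<in> borel_measurable lborel"
  unfolding phase_def by measurable

lemma bounded_symbol_phase_group: "bounded_symbol (phase \<epsilon> t)"
  by (rule bounded_symbolI[where C=1, OF phase_measurable]) (simp add: norm_phase)

lemma phase_add: "phase \<epsilon> (s + t) \<xi> = phase \<epsilon> s \<xi> * phase \<epsilon> t \<xi>"
  by (simp add: phase_def add_divide_distrib distrib_right algebra_simps flip: exp_add)

lemma cnj_phase_mult: "cnj (phase \<epsilon> t \<xi>) * phase \<epsilon> t \<xi> = 1"
  using complex_norm_square[of "phase \<epsilon> t \<xi>"] by (simp add: norm_phase mult.commute)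

lemma P_symbol_inverse: "P_symbol \<epsilon> (-1) \<xi> = complex_of_real (1 / (1 + \<epsilon>\<^sup>2 * (norm \<xi>)\<^sup>2))"
proof -
  have "1 + \<epsilon>\<^sup>2 * (norm \<xi>)\<^sup>2 > 0" by (simp add: add_pos_nonneg)
  then show ?thesis by (simp add: P_symbol_def powr_minus_divide)
qed

lemma energy_weight_bounds:
  fixes \<epsilon> :: real and \<xi> :: "real^2"
  shows "min 1 (\<epsilon>\<^sup>2) * (bracket \<xi>)\<^sup>2 \<le> 1 + \<epsilon>\<^sup>2 * (norm \<xi>)\<^sup>2"
    and "1 + \<epsilon>\<^sup>2 * (norm \<xi>)\<^sup>2 \<le> max 1 (\<epsilon>\<^sup>2) * (bracket \<xi>)\<^sup>2"
proof -
  have "min 1 (\<epsilon>\<^sup>2) * (norm \<xi>)\<^sup>2 \<le> \<epsilon>\<^sup>2 * (norm \<xi>)\<^sup>2" "\<epsilon>\<^sup>2 * (norm \<xi>)\<^sup>2 \<le> max 1 (\<epsilon>\<^sup>2) * (norm \<xi>)\<^sup>2"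
    by (intro mult_right_mono; simp)+
  then show "min 1 (\<epsilon>\<^sup>2) * (bracket \<xi>)\<^sup>2 \<le> 1 + \<epsilon>\<^sup>2 * (norm \<xi>)\<^sup>2" "1 + \<epsilon>\<^sup>2 * (norm \<xi>)\<^sup>2 \<le> max 1 (\<epsilon>\<^sup>2) * (bracket \<xi>)\<^sup>2"
    unfolding bracket_sq distrib_left by (simp_all add: add_mono)
qed

lemma forcing_symbol_measurable: "forcing_symbol \<epsilon> \<delta> \<in> borel_measurable borel"
  unfolding forcing_symbol_def P_symbol_inverse by measurable

text \<open>One bracket comes from the change of variable and one from
  \<open>\<delta> \<bullet> \<xi>\<close>; the quadratic decay of
  \<open>P_symbol \<epsilon> (-1)\<close> pays for both.\<close>

lemma bounded_symbol_field:
  assumes "\<epsilon> > 0"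
  shows "bounded_symbol (field_symbol \<epsilon> \<delta>)"
proof (rule bounded_symbolI[where C="(1 + norm \<delta>) / min 1 (\<epsilon>\<^sup>2)"])
  have [measurable]: "forcing_symbol \<epsilon> \<delta> \<in> borel_measurable borel" by (rule forcing_symbol_measurable)
  show "field_symbol \<epsilon> \<delta> \<in> borel_measurable lborel" unfolding field_symbol_def by measurable
  fix \<xi> :: "real^2"
  have c: "min 1 (\<epsilon>\<^sup>2) > 0" using assms by simp
  have p: "1 + \<epsilon>\<^sup>2 * (norm \<xi>)\<^sup>2 > 0" by (simp add: add_pos_nonneg)
  have "cmod (1 + \<i> * (\<i> * complex_of_real (\<delta> \<bullet> \<xi>))) \<le> cmod 1 + cmod (\<i> * (\<i> * complex_of_real (\<delta> \<bullet> \<xi>)))"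
    by (rule norm_triangle_ineq)
  also have "\<dots> = 1 + \<bar>\<delta> \<bullet> \<xi>\<bar>" by (simp only: norm_mult norm_ii norm_of_real norm_one mult_1)
  also have "\<bar>\<delta> \<bullet> \<xi>\<bar> \<le> norm \<delta> * norm \<xi>" by (rule Cauchy_Schwarz_ineq2)
  also have "norm \<delta> * norm \<xi> \<le> norm \<delta> * bracket \<xi>" by (intro mult_left_mono norm_le_bracket) simp
  also have "1 + norm \<delta> * bracket \<xi> \<le> (1 + norm \<delta>) * bracket \<xi>" using bracket_ge_1[of \<xi>] by (simp add: algebra_simps)
  finally have a: "cmod (1 + \<i> * (\<i> * complex_of_real (\<delta> \<bullet> \<xi>))) \<le> (1 + norm \<delta>) * bracket \<xi>" by simp
  have "cmod (field_symbol \<epsilon> \<delta> \<xi>) = bracket \<xi> * (1 / (1 + \<epsilon>\<^sup>2 * (norm \<xi>)\<^sup>2)) * cmod (1 + \<i> * (\<i> * complex_of_real (\<delta> \<bullet> \<xi>)))"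
    unfolding field_symbol_def forcing_symbol_def P_symbol_inverse norm_mult norm_of_real norm_ii
    using bracket_pos[of \<xi>] p by (simp add: abs_of_pos)
  also have "\<dots> \<le> bracket \<xi> * (1 / (1 + \<epsilon>\<^sup>2 * (norm \<xi>)\<^sup>2)) * ((1 + norm \<delta>) * bracket \<xi>)"
    using bracket_pos[of \<xi>] p by (intro mult_left_mono a) (auto simp: less_imp_le)
  also have "\<dots> = (1 + norm \<delta>) * ((bracket \<xi>)\<^sup>2 / (1 + \<epsilon>\<^sup>2 * (norm \<xi>)\<^sup>2))"
    by (simp add: power2_eq_square)
  also have "(bracket \<xi>)\<^sup>2 / (1 + \<epsilon>\<^sup>2 * (norm \<xi>)\<^sup>2) \<le> 1 / min 1 (\<epsilon>\<^sup>2)"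
    using energy_weight_bounds(1)[of \<epsilon> \<xi>] c p by (simp add: divide_le_eq le_divide_eq mult.commute)
  finally show "cmod (field_symbol \<epsilon> \<delta> \<xi>) \<le> (1 + norm \<delta>) / min 1 (\<epsilon>\<^sup>2)"
    by (simp add: mult_left_mono)
qed

lemma forcing_symbol_eq: "forcing_symbol \<epsilon> \<delta> \<xi> = - \<i> * (inv_bracket \<xi> * field_symbol \<epsilon> \<delta> \<xi>)"
  using bracket_pos[of \<xi>] by (simp add: field_symbol_def inv_bracket_def)

lemma bounded_symbol_forcing:
  assumes "\<epsilon> > 0"
  shows "bounded_symbol (forcing_symbol \<epsilon> \<delta>)"
proof -
  have "bounded_symbol (\<lambda>\<xi>. - \<i> * (inv_bracket \<xi> * field_symbol \<epsilon> \<delta> \<xi>))"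
    by (intro bounded_symbol_mult bounded_symbol_const bounded_symbol_inv_bracket bounded_symbol_field assms)
  then show ?thesis by (simp only: forcing_symbol_eq[symmetric])
qed

lemma energy_symbol_sq_bounds:
  shows "min 1 (\<epsilon>\<^sup>2) \<le> (cmod (energy_symbol \<epsilon> \<xi>))\<^sup>2" and "(cmod (energy_symbol \<epsilon> \<xi>))\<^sup>2 \<le> max 1 (\<epsilon>\<^sup>2)"
proof -
  have "(cmod (energy_symbol \<epsilon> \<xi>))\<^sup>2 = (1 + \<epsilon>\<^sup>2 * (norm \<xi>)\<^sup>2) / (bracket \<xi>)\<^sup>2"
    by (simp add: energy_symbol_def norm_divide power_divide add_nonneg_nonneg)
  then show "min 1 (\<epsilon>\<^sup>2) \<le> (cmod (energy_symbol \<epsilon> \<xi>))\<^sup>2" "(cmod (energy_symbol \<epsilon> \<xi>))\<^sup>2 \<le> max 1 (\<epsilon>\<^sup>2)"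
    using energy_weight_bounds[of \<epsilon> \<xi>] bracket_pos[of \<xi>] by (simp_all only: le_divide_eq divide_le_eq) auto
qed

lemma energy_symbol_measurable: "energy_symbol \<epsilon> \<in> borel_measurable lborel"
  unfolding energy_symbol_def by measurable

lemma bounded_symbol_energy: "bounded_symbol (energy_symbol \<epsilon>)"
proof (rule bounded_symbolI[OF energy_symbol_measurable])
  show "cmod (energy_symbol \<epsilon> \<xi>) \<le> sqrt (max 1 (\<epsilon>\<^sup>2))" for \<xi>
    using energy_symbol_sq_bounds(2) by (rule real_le_rsqrt)
qed

lemma cnj_energy_symbol: "cnj (energy_symbol \<epsilon> \<xi>) = energy_symbol \<epsilon> \<xi>"
  by (simp add: energy_symbol_def)

lemma energy_eq_norm:
  "g \<bullet> mult_l2 (\<lambda>\<xi>. energy_symbol \<epsilon> \<xi> * energy_symbol \<epsilon> \<xi>) g = (norm (mult_l2 (energy_symbol \<epsilon>) g))\<^sup>2"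
  by (simp add: norm_mult_l2_sq[OF bounded_symbol_energy] cnj_energy_symbol)

text \<open>The squared energy symbol cancels \<open>P_symbol \<epsilon> (-1)\<close>, so the
  pairing reduces to that of the nonlinearity with \<open>-\<i>\<close> times u plus
  \<open>\<delta> \<bullet> \<nabla>\<close> of u, where u is \<open>of_freq g\<close>. The first
  vanishes pointwise since the nonlinearity is a real multiple of u, the second by
  \<open>gradient_orthogonal_nonlinearity\<close>.\<close>

lemma freq_field_energy:
  assumes "\<epsilon> > 0" "\<sigma> > 1/4"
  shows "freq_field \<epsilon> \<sigma> \<delta> g \<bullet> mult_l2 (\<lambda>\<xi>. energy_symbol \<epsilon> \<xi> * energy_symbol \<epsilon> \<xi>) g = 0"
proof -
  let ?N = "freq_nonlinearity \<sigma> g"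
  let ?w = "\<lambda>\<xi>. energy_symbol \<epsilon> \<xi> * energy_symbol \<epsilon> \<xi>"
  note b = bounded_symbol_mult bounded_symbol_const bounded_symbol_inv_bracket bounded_symbol_grad
    bounded_symbol_energy bounded_symbol_cnj[OF bounded_symbol_field[OF assms(1)]]
  have sym: "cnj (field_symbol \<epsilon> \<delta> \<xi>) * ?w \<xi> = - \<i> * inv_bracket \<xi> + grad_symbol \<delta> \<xi>" for \<xi>
  proof -
    have p: "1 + \<epsilon>\<^sup>2 * (norm \<xi>)\<^sup>2 > 0" by (simp add: add_pos_nonneg)
    have "sqrt (1 + \<epsilon>\<^sup>2 * (norm \<xi>)\<^sup>2) / bracket \<xi> * (sqrt (1 + \<epsilon>\<^sup>2 * (norm \<xi>)\<^sup>2) / bracket \<xi>) = (1 + \<epsilon>\<^sup>2 * (norm \<xi>)\<^sup>2) / (bracket \<xi> * bracket \<xi>)"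
      using p by simp
    then have w: "?w \<xi> = complex_of_real ((1 + \<epsilon>\<^sup>2 * (norm \<xi>)\<^sup>2) / (bracket \<xi> * bracket \<xi>))"
      unfolding energy_symbol_def of_real_mult[symmetric] by simp
    have "bracket \<xi> * (1 / (1 + \<epsilon>\<^sup>2 * (norm \<xi>)\<^sup>2)) * ((1 + \<epsilon>\<^sup>2 * (norm \<xi>)\<^sup>2) / (bracket \<xi> * bracket \<xi>)) = 1 / bracket \<xi>"
      using p bracket_pos[of \<xi>] by simp
    then have c: "complex_of_real (bracket \<xi>) * complex_of_real (1 / (1 + \<epsilon>\<^sup>2 * (norm \<xi>)\<^sup>2)) * ?w \<xi> = inv_bracket \<xi>"
      unfolding w inv_bracket_def of_real_mult[symmetric] by (simp only:)
    have "cnj (field_symbol \<epsilon> \<delta> \<xi>) * ?w \<xi> =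
        (- \<i> + \<i> * complex_of_real (\<delta> \<bullet> \<xi>)) * (complex_of_real (bracket \<xi>) * complex_of_real (1 / (1 + \<epsilon>\<^sup>2 * (norm \<xi>)\<^sup>2)) * ?w \<xi>)"
      unfolding field_symbol_def forcing_symbol_def P_symbol_inverse
      by (simp add: algebra_simps del: of_real_divide)
    then show ?thesis unfolding c by (simp add: grad_symbol_def algebra_simps)
  qed
  have "freq_field \<epsilon> \<sigma> \<delta> g \<bullet> mult_l2 ?w g = fourier ?N \<bullet> mult_l2 (\<lambda>\<xi>. cnj (field_symbol \<epsilon> \<delta> \<xi>) * ?w \<xi>) g"
    unfolding freq_field_def inner_mult_l2[OF bounded_symbol_field[OF assms(1)]]
    by (subst mult_l2_mult_l2) (intro b, intro b, rule refl)
  also have "\<dots> = fourier ?N \<bullet> (mult_l2 (\<lambda>\<xi>. - \<i> * inv_bracket \<xi>) g + mult_l2 (grad_symbol \<delta>) g)"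
    unfolding sym by (subst mult_l2_symbol_add) (intro b, intro b, rule refl)
  also have "mult_l2 (\<lambda>\<xi>. - \<i> * inv_bracket \<xi>) g = mult_l2 (\<lambda>_. - \<i>) (mult_l2 inv_bracket g)"
    by (subst mult_l2_mult_l2) (intro b, intro b, rule refl)
  also have "\<dots> = fourier (mult_l2 (\<lambda>_. - \<i>) (of_freq g))" by (simp add: fourier_mult_const fourier_of_freq)
  also have "mult_l2 (grad_symbol \<delta>) g = fourier (ifourier (mult_l2 (grad_symbol \<delta>) g))" by (simp add: fourier_ifourier)
  also have "fourier ?N \<bullet> (fourier (mult_l2 (\<lambda>_. - \<i>) (of_freq g)) + \<dots>) = ?N \<bullet> mult_l2 (\<lambda>_. - \<i>) (of_freq g) + ?N \<bullet> ifourier (mult_l2 (grad_symbol \<delta>) g)"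
    by (simp only: inner_add_right inner_fourier_fourier)
  also have "?N \<bullet> ifourier (mult_l2 (grad_symbol \<delta>) g) = 0"
    using gradient_orthogonal_nonlinearity[OF assms(2)] by (simp add: inner_commute)
  also have "?N \<bullet> mult_l2 (\<lambda>_. - \<i>) (of_freq g) = 0"
    unfolding inner_l2_rep
  proof (rule integral_eq_zero_AE)
    show "AE x in lborel. rep_l2 ?N x \<bullet> rep_l2 (mult_l2 (\<lambda>_. - \<i>) (of_freq g)) x = 0"
      using rep_freq_nonlinearity[OF assms(2), of g] rep_mult_l2[OF bounded_symbol_const, of "- \<i>" "of_freq g"]
    proof eventually_elim
      case (elim x)
      show ?case unfolding elim by (simp add: power_nonlinearity_def inner_complex_def)
    qed
  qed
  finally show ?thesis by simp
qed

lemma conservative_flow_frequency: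
  assumes "\<epsilon> > 0" "\<sigma> > 1/4"
  shows "conservative_flow (\<lambda>t. mult_l2 (phase \<epsilon> t)) (freq_field \<epsilon> \<sigma> \<delta>)
    (mult_l2 (\<lambda>\<xi>. energy_symbol \<epsilon> \<xi> * energy_symbol \<epsilon> \<xi>)) (min 1 (\<epsilon>\<^sup>2)) (max 1 (\<epsilon>\<^sup>2))"
proof (rule conservative_flow.intro)
  let ?w = "\<lambda>\<xi>. energy_symbol \<epsilon> \<xi> * energy_symbol \<epsilon> \<xi>"
  have bw: "bounded_symbol ?w" by (intro bounded_symbol_mult bounded_symbol_energy)
  note bp = bounded_symbol_phase_group
  show "bounded_linear (mult_l2 (phase \<epsilon> t))" for t by (intro bounded_linear_mult_l2 bp)
  show "norm (mult_l2 (phase \<epsilon> t) x) = norm x" for t x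
    by (intro norm_mult_l2_isometry phase_measurable norm_phase)
  have "phase \<epsilon> 0 = (\<lambda>_. 1)" by (simp add: phase_def fun_eq_iff)
  then show "mult_l2 (phase \<epsilon> 0) x = x" for x by (simp add: mult_l2_1)
  show "mult_l2 (phase \<epsilon> (s + t)) x = mult_l2 (phase \<epsilon> s) (mult_l2 (phase \<epsilon> t) x)" for s t x
    by (simp add: mult_l2_mult_l2 bp flip: phase_add)
  show "continuous_on UNIV (\<lambda>t. mult_l2 (phase \<epsilon> t) x)" for x
  proof (rule continuous_on_sequentiallyI)
    fix u and a :: real assume u: "u \<longlonglongrightarrow> a"
    show "(\<lambda>n. mult_l2 (phase \<epsilon> (u n)) x) \<longlonglongrightarrow> mult_l2 (phase \<epsilon> a) x"
    proof (rule mult_l2_tendsto[where C=1])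
      show "(\<lambda>n. phase \<epsilon> (u n) \<xi>) \<longlonglongrightarrow> phase \<epsilon> a \<xi>" for \<xi>
      proof -
        have "1 + \<epsilon>\<^sup>2 * (norm \<xi>)\<^sup>2 \<noteq> 0" using add_pos_nonneg[of 1 "\<epsilon>\<^sup>2 * (norm \<xi>)\<^sup>2"] by simp
        then show ?thesis unfolding phase_def by (intro tendsto_intros u)
      qed
    qed (auto simp: phase_measurable[simplified] bp norm_phase)
  qed
  show "\<exists>L. \<forall>x y. norm x \<le> M \<longrightarrow> norm y \<le> M \<longrightarrow> norm (freq_field \<epsilon> \<sigma> \<delta> x - freq_field \<epsilon> \<sigma> \<delta> y) \<le> L * norm (x - y)" for M
  proof -
    obtain L where L: "\<And>x y. norm x \<le> M \<Longrightarrow> norm y \<le> M \<Longrightarrow> norm (freq_nonlinearity \<sigma> x - freq_nonlinearity \<sigma> y) \<le> L * norm (x - y)"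
      using freq_nonlinearity_lipschitz[OF assms(2), of M] by blast
    obtain C where C: "\<And>\<xi>. cmod (field_symbol \<epsilon> \<delta> \<xi>) \<le> C"
      using bounded_symbol_field[OF assms(1)] unfolding bounded_symbol_def by blast
    have C0: "C \<ge> 0" using C[of 0] norm_ge_zero[of "field_symbol \<epsilon> \<delta> 0"] by linarith
    have "norm (freq_field \<epsilon> \<sigma> \<delta> x - freq_field \<epsilon> \<sigma> \<delta> y) \<le> (C * L) * norm (x - y)" if "norm x \<le> M" "norm y \<le> M" for x y
    proof -
      have "freq_field \<epsilon> \<sigma> \<delta> x - freq_field \<epsilon> \<sigma> \<delta> y = mult_l2 (field_symbol \<epsilon> \<delta>) (fourier (freq_nonlinearity \<sigma> x - freq_nonlinearity \<sigma> y))"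
        unfolding freq_field_def
        by (simp add: linear_diff[OF bounded_linear.linear[OF bounded_linear_fourier]]
            linear_diff[OF bounded_linear.linear[OF bounded_linear_mult_l2[OF bounded_symbol_field[OF assms(1)]]]])
      then have "norm (freq_field \<epsilon> \<sigma> \<delta> x - freq_field \<epsilon> \<sigma> \<delta> y) \<le> C * norm (fourier (freq_nonlinearity \<sigma> x - freq_nonlinearity \<sigma> y))"
        using norm_mult_l2_le[OF bounded_symbol_measurable[OF bounded_symbol_field[OF assms(1)]] C] by simp
      also have "\<dots> \<le> C * (L * norm (x - y))"
        unfolding norm_fourier using C0 by (intro mult_left_mono L that)
      finally show ?thesis by (simp add: mult.assoc)
    qed
    then show ?thesis by blast
  qed
  show "freq_field \<epsilon> \<sigma> \<delta> 0 = 0"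
    by (simp add: freq_field_def freq_nonlinearity_0 linear_0[OF bounded_linear.linear[OF bounded_linear_fourier]]
      linear_0[OF bounded_linear.linear[OF bounded_linear_mult_l2[OF bounded_symbol_field[OF assms(1)]]]])
  show "bounded_linear (mult_l2 ?w)" by (intro bounded_linear_mult_l2 bw)
  show "mult_l2 ?w x \<bullet> y = x \<bullet> mult_l2 ?w y" for x y
    by (simp add: inner_mult_l2[OF bw] cnj_energy_symbol)
  show "mult_l2 (phase \<epsilon> t) x \<bullet> mult_l2 ?w (mult_l2 (phase \<epsilon> t) y) = x \<bullet> mult_l2 ?w y" for t x y
  proof -
    have "mult_l2 (phase \<epsilon> t) x \<bullet> mult_l2 ?w (mult_l2 (phase \<epsilon> t) y) =
       x \<bullet> mult_l2 (\<lambda>\<xi>. cnj (phase \<epsilon> t \<xi>) * (?w \<xi> * phase \<epsilon> t \<xi>)) y"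
      by (simp add: inner_mult_l2[OF bp] mult_l2_mult_l2 bw bp bounded_symbol_mult bounded_symbol_cnj)
    also have "(\<lambda>\<xi>. cnj (phase \<epsilon> t \<xi>) * (?w \<xi> * phase \<epsilon> t \<xi>)) = ?w"
    proof
      fix \<xi>
      have "cnj (phase \<epsilon> t \<xi>) * (?w \<xi> * phase \<epsilon> t \<xi>) = (cnj (phase \<epsilon> t \<xi>) * phase \<epsilon> t \<xi>) * ?w \<xi>" by (simp only: mult_ac)
      then show "cnj (phase \<epsilon> t \<xi>) * (?w \<xi> * phase \<epsilon> t \<xi>) = ?w \<xi>" by (simp only: cnj_phase_mult mult_1)
    qed
    finally show ?thesis .
  qed
  show pos: "min 1 (\<epsilon>\<^sup>2) > 0" using assms(1) by simp
  show "min 1 (\<epsilon>\<^sup>2) * (norm x)\<^sup>2 \<le> x \<bullet> mult_l2 ?w x" for x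
  proof -
    have "norm x \<le> 1 / sqrt (min 1 (\<epsilon>\<^sup>2)) * norm (mult_l2 (energy_symbol \<epsilon>) x)"
    proof (rule norm_l2_le)
      show "AE \<xi> in lborel. cmod (rep_l2 x \<xi>) \<le> 1 / sqrt (min 1 (\<epsilon>\<^sup>2)) * cmod (rep_l2 (mult_l2 (energy_symbol \<epsilon>) x) \<xi>)"
        using rep_mult_l2[OF bounded_symbol_energy, of \<epsilon> x]
      proof eventually_elim
        case (elim \<xi>)
        have "sqrt (min 1 (\<epsilon>\<^sup>2)) \<le> cmod (energy_symbol \<epsilon> \<xi>)"
          using real_sqrt_le_mono[OF energy_symbol_sq_bounds(1)[of \<epsilon> \<xi>]] by (simp only: real_sqrt_abs abs_norm_cancel)
        then have "sqrt (min 1 (\<epsilon>\<^sup>2)) * cmod (rep_l2 x \<xi>) \<le> cmod (energy_symbol \<epsilon> \<xi>) * cmod (rep_l2 x \<xi>)"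
          by (rule mult_right_mono) simp
        then show ?case unfolding elim norm_mult using pos by (simp add: field_simps)
      qed
    qed (use pos in simp)
    then have "sqrt (min 1 (\<epsilon>\<^sup>2)) * norm x \<le> norm (mult_l2 (energy_symbol \<epsilon>) x)" using pos by (simp add: field_simps)
    then have "(sqrt (min 1 (\<epsilon>\<^sup>2)) * norm x)\<^sup>2 \<le> (norm (mult_l2 (energy_symbol \<epsilon>) x))\<^sup>2" by (intro power_mono) (use pos in auto)
    then show ?thesis using pos unfolding energy_eq_norm by (simp add: power_mult_distrib)
  qed
  show "x \<bullet> mult_l2 ?w x \<le> max 1 (\<epsilon>\<^sup>2) * (norm x)\<^sup>2" for x
  proof -
    have "norm (mult_l2 (energy_symbol \<epsilon>) x) \<le> sqrt (max 1 (\<epsilon>\<^sup>2)) * norm x"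
      by (intro norm_mult_l2_le energy_symbol_measurable real_le_rsqrt energy_symbol_sq_bounds)
    then have "(norm (mult_l2 (energy_symbol \<epsilon>) x))\<^sup>2 \<le> (sqrt (max 1 (\<epsilon>\<^sup>2)) * norm x)\<^sup>2" by (intro power_mono) auto
    also have "\<dots> = max 1 (\<epsilon>\<^sup>2) * (norm x)\<^sup>2" by (simp add: power_mult_distrib)
    finally show ?thesis unfolding energy_eq_norm .
  qed
  show "freq_field \<epsilon> \<sigma> \<delta> x \<bullet> mult_l2 ?w x = 0" for x by (rule freq_field_energy[OF assms])
qed

lemma scaleC_l2_eq: "scaleC_l2 c f = mult_l2 (\<lambda>_. c) f"
proof -
  have "scaleC_l2 c (abs_l2 (rep_l2 f)) = abs_l2 (\<lambda>x. c * rep_l2 f x)"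
    using square_integrable_rep_l2[of f] by (intro scaleC_l2.abs_eq) (simp add: l2_eq_def)
  then show ?thesis
    by (simp add: mult_l2_def l2_of_def square_integrable_cmult square_integrable_rep_l2 Quotient3_abs_rep[OF Quotient3_l2])
qed

lemma of_freq_propagator: "of_freq (mult_l2 (phase \<epsilon> t) g) = propagator \<epsilon> t (of_freq g)"
  unfolding propagator_eq fourier_of_freq unfolding of_freq_def
  by (simp add: mult_l2_mult_l2 bounded_symbol_inv_bracket bounded_symbol_phase_group mult.commute)

text \<open>Matches the abstract Duhamel integrand with the concrete one; complex linearity of the
  transform brings the \<open>\<i>\<close> to the front.\<close>

lemma of_freq_field:
  assumes "\<epsilon> > 0"
  shows "of_freq (mult_l2 (phase \<epsilon> t) (freq_field \<epsilon> \<sigma> \<delta> g)) =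
    scaleC_l2 \<i> (propagator \<epsilon> t (forcing \<epsilon> \<delta> (freq_nonlinearity \<sigma> g)))"
proof -
  note b = bounded_symbol_inv_bracket bounded_symbol_field[OF assms] bounded_symbol_forcing[OF assms] bounded_symbol_const
  have "of_freq (freq_field \<epsilon> \<sigma> \<delta> g) = ifourier (mult_l2 (\<lambda>\<xi>. inv_bracket \<xi> * field_symbol \<epsilon> \<delta> \<xi>) (fourier (freq_nonlinearity \<sigma> g)))"
    by (simp add: of_freq_def freq_field_def mult_l2_mult_l2 b)
  also have "(\<lambda>\<xi>. inv_bracket \<xi> * field_symbol \<epsilon> \<delta> \<xi>) = (\<lambda>\<xi>. \<i> * forcing_symbol \<epsilon> \<delta> \<xi>)"
    by (simp add: forcing_symbol_eq fun_eq_iff)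
  also have "mult_l2 (\<lambda>\<xi>. \<i> * forcing_symbol \<epsilon> \<delta> \<xi>) (fourier (freq_nonlinearity \<sigma> g)) =
      mult_l2 (\<lambda>_. \<i>) (fourier (forcing \<epsilon> \<delta> (freq_nonlinearity \<sigma> g)))"
    by (simp add: forcing_eq fourier_ifourier mult_l2_mult_l2 b)
  finally have eq: "of_freq (freq_field \<epsilon> \<sigma> \<delta> g) = ifourier (mult_l2 (\<lambda>_. \<i>) (fourier (forcing \<epsilon> \<delta> (freq_nonlinearity \<sigma> g))))" .
  have ic: "ifourier (mult_l2 (\<lambda>_. c) f) = mult_l2 (\<lambda>_. c) (ifourier f)" for c f
    by (metis fourier_ifourier fourier_mult_const ifourier_fourier)
  show ?thesis
    unfolding of_freq_propagator eq propagator_eq scaleC_l2_eq fourier_ifourier ic[symmetric]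
    by (simp add: mult_l2_mult_l2 bounded_symbol_const bounded_symbol_phase_group mult.commute)
qed

section \<open>Transfer to solutions in H^1\<close>

context
  fixes \<epsilon> \<sigma> :: real and \<delta> :: "real^2"
  assumes \<epsilon>: "\<epsilon> > 0" and \<sigma>: "\<sigma> > 1/4"
begin

interpretation flow: conservative_flow "\<lambda>t. mult_l2 (phase \<epsilon> t)" "freq_field \<epsilon> \<sigma> \<delta>"
    "mult_l2 (\<lambda>\<xi>. energy_symbol \<epsilon> \<xi> * energy_symbol \<epsilon> \<xi>)" "min 1 (\<epsilon>\<^sup>2)" "max 1 (\<epsilon>\<^sup>2)"
  by (rule conservative_flow_frequency[OF \<epsilon> \<sigma>])

text \<open>\<open>global_solution\<close> integrates in L^2, the flow in a copy of
  \<open>H\<^sup>1\<close>. Passing to L^2 is the bounded map \<open>of_freq\<close>. Conversely the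
  stronger integral exists by continuity, and uniqueness of the weaker one with injectivity of
  \<open>of_freq\<close> identifies its value.\<close>

lemma global_solution_from_freq:
  "global_solution \<epsilon> \<sigma> \<delta> (from_freq x) (\<lambda>t. from_freq (g t)) \<longleftrightarrow> flow.mild_solution x g"
proof -
  let ?F = "\<lambda>t s. mult_l2 (phase \<epsilon> (t - s)) (freq_field \<epsilon> \<sigma> \<delta> (g s))"
  let ?P = "\<lambda>t s. propagator \<epsilon> (t - s) (forcing \<epsilon> \<delta> (nonlinearity \<sigma> (from_freq (g s))))"
  have cont: "continuous_on UNIV (\<lambda>t. from_freq (g t)) \<longleftrightarrow> continuous_on UNIV g"
    by (simp add: continuous_on_iff dist_norm norm_from_freq_diff)
  have F: "of_freq (?F t s) = scaleC_l2 \<i> (?P t s)" for t s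
    by (simp add: of_freq_field[OF \<epsilon>] nonlinearity_from_freq)
  have lin: "bounded_linear (scaleC_l2 c)" for c
    using bounded_linear_mult_l2[OF bounded_symbol_const, of c] by (simp add: scaleC_l2_eq[abs_def])
  have inv: "scaleC_l2 (- \<i>) (scaleC_l2 \<i> f) = f" "scaleC_l2 \<i> (scaleC_l2 (- \<i>) f) = f" for f
    by (simp_all add: scaleC_l2_eq mult_l2_mult_l2 bounded_symbol_const mult_l2_1)
  have "(\<exists>I. has_oriented_integral (?P t) I 0 t \<and> of_freq (g t) = propagator \<epsilon> t (of_freq x) + scaleC_l2 \<i> I) \<longleftrightarrow>
      has_oriented_integral (?F t) (g t - mult_l2 (phase \<epsilon> t) x) 0 t"
    if gc: "continuous_on UNIV g" for t
  proof
    have of_diff: "of_freq (g t - mult_l2 (phase \<epsilon> t) x) = of_freq (g t) - propagator \<epsilon> t (of_freq x)"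
      by (simp add: linear_diff[OF bounded_linear.linear[OF bounded_linear_of_freq]] of_freq_propagator)
    {
      assume "has_oriented_integral (?F t) (g t - mult_l2 (phase \<epsilon> t) x) 0 t"
      from has_oriented_integral_linear[OF this bounded_linear_of_freq]
      have "has_oriented_integral (\<lambda>s. scaleC_l2 \<i> (?P t s)) (of_freq (g t) - propagator \<epsilon> t (of_freq x)) 0 t"
        unfolding F of_diff .
      from has_oriented_integral_linear[OF this lin[of "- \<i>"]]
      have "has_oriented_integral (?P t) (scaleC_l2 (- \<i>) (of_freq (g t) - propagator \<epsilon> t (of_freq x))) 0 t"
        unfolding inv .
      then show "\<exists>I. has_oriented_integral (?P t) I 0 t \<and> of_freq (g t) = propagator \<epsilon> t (of_freq x) + scaleC_l2 \<i> I"
        by (intro exI[of _ "scaleC_l2 (- \<i>) (of_freq (g t) - propagator \<epsilon> t (of_freq x))"]) (simp add: inv)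
    }
    assume "\<exists>I. has_oriented_integral (?P t) I 0 t \<and> of_freq (g t) = propagator \<epsilon> t (of_freq x) + scaleC_l2 \<i> I"
    then obtain I where I: "has_oriented_integral (?P t) I 0 t" "of_freq (g t) = propagator \<epsilon> t (of_freq x) + scaleC_l2 \<i> I"
      by blast
    obtain J where J: "has_oriented_integral (?F t) J 0 t" using flow.duhamel_integral_exists[OF gc] by blast
    have "has_oriented_integral (\<lambda>s. scaleC_l2 \<i> (?P t s)) (of_freq J) 0 t"
      using has_oriented_integral_linear[OF J bounded_linear_of_freq] unfolding F .
    then have "of_freq J = scaleC_l2 \<i> I"
      using has_oriented_integral_linear[OF I(1) lin[of \<i>]] by (rule has_oriented_integral_unique)
    then have "of_freq J = of_freq (g t - mult_l2 (phase \<epsilon> t) x)" unfolding of_diff I(2) by simp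
    then show "has_oriented_integral (?F t) (g t - mult_l2 (phase \<epsilon> t) x) 0 t" using J by (simp add: of_freq_inject)
  qed
  then show ?thesis
    unfolding global_solution_def flow.mild_solution_def cont l2_of_h1_from_freq by blast
qed

lemma global_solution_iff:
  "global_solution \<epsilon> \<sigma> \<delta> u0 u \<longleftrightarrow> (\<exists>x g. u0 = from_freq x \<and> u = (\<lambda>t. from_freq (g t)) \<and> flow.mild_solution x g)"
proof
  assume u: "global_solution \<epsilon> \<sigma> \<delta> u0 u"
  obtain x where x: "u0 = from_freq x" using from_freq_surj by blast
  have "\<forall>t. \<exists>y. u t = from_freq y" using from_freq_surj by blast
  from choice[OF this] obtain g where "\<forall>t. u t = from_freq (g t)" by blast
  then have "u = (\<lambda>t. from_freq (g t))" by blast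
  with u x show "\<exists>x g. u0 = from_freq x \<and> u = (\<lambda>t. from_freq (g t)) \<and> flow.mild_solution x g"
    using global_solution_from_freq by blast
qed (auto simp: global_solution_from_freq)

lemma global_solution_ex1: "\<exists>!u. global_solution \<epsilon> \<sigma> \<delta> u0 u"
proof -
  obtain x where x: "u0 = from_freq x" using from_freq_surj by blast
  obtain g where g: "flow.mild_solution x g" using flow.mild_solution_exists by blast
  show ?thesis
  proof (rule ex1I)
    show "global_solution \<epsilon> \<sigma> \<delta> u0 (\<lambda>t. from_freq (g t))" unfolding x by (simp add: global_solution_from_freq g)
    fix u assume "global_solution \<epsilon> \<sigma> \<delta> u0 u"
    then obtain y h where h: "u0 = from_freq y" "u = (\<lambda>t. from_freq (h t))" "flow.mild_solution y h"
      unfolding global_solution_iff by blast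
    then have "y = x" using x by (simp add: from_freq_inject)
    then have "h = g" using h(3) g flow.mild_solution_unique by blast
    then show "u = (\<lambda>t. from_freq (g t))" using h(2) by simp
  qed
qed

lemma global_solution_bound:
  assumes "global_solution \<epsilon> \<sigma> \<delta> u0 u"
  shows "norm (u t) \<le> sqrt (max 1 (\<epsilon>\<^sup>2) / min 1 (\<epsilon>\<^sup>2)) * norm u0"
proof -
  obtain x g where g: "u0 = from_freq x" "u = (\<lambda>t. from_freq (g t))" "flow.mild_solution x g"
    using assms unfolding global_solution_iff by blast
  show ?thesis using flow.mild_solution_bound[OF g(3), of t] by (simp add: g norm_from_freq)
qed

lemma global_solution_dependence:
  "\<exists>k. \<forall>u0 v0 u v t. norm u0 \<le> r \<longrightarrow> norm v0 \<le> r \<longrightarrow> global_solution \<epsilon> \<sigma> \<delta> u0 u \<longrightarrow> global_solution \<epsilon> \<sigma> \<delta> v0 v \<longrightarrow>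
     norm (u t - v t) \<le> 2 * norm (u0 - v0) * exp (k * \<bar>t\<bar>)"
proof -
  obtain k where k: "\<And>x y g h t. norm x \<le> r \<Longrightarrow> norm y \<le> r \<Longrightarrow> flow.mild_solution x g \<Longrightarrow> flow.mild_solution y h \<Longrightarrow>
     norm (g t - h t) \<le> 2 * norm (x - y) * exp (k * \<bar>t\<bar>)"
    using flow.mild_solution_dependence[of r] by blast
  show ?thesis
  proof (intro exI[of _ k] allI impI)
    fix u0 v0 u v t
    assume *: "norm u0 \<le> r" "norm v0 \<le> r" "global_solution \<epsilon> \<sigma> \<delta> u0 u" "global_solution \<epsilon> \<sigma> \<delta> v0 v"
    obtain x g where g: "u0 = from_freq x" "u = (\<lambda>t. from_freq (g t))" "flow.mild_solution x g"
      using *(3) unfolding global_solution_iff by blast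
    obtain y h where h: "v0 = from_freq y" "v = (\<lambda>t. from_freq (h t))" "flow.mild_solution y h"
      using *(4) unfolding global_solution_iff by blast
    show "norm (u t - v t) \<le> 2 * norm (u0 - v0) * exp (k * \<bar>t\<bar>)"
      using k[OF _ _ g(3) h(3), of t] *(1,2) by (simp add: g h norm_from_freq norm_from_freq_diff)
  qed
qed

lemma global_solution_solution_map: "global_solution \<epsilon> \<sigma> \<delta> u0 (solution_map \<epsilon> \<sigma> \<delta> u0)"
  unfolding solution_map_def by (rule theI'[OF global_solution_ex1])

text \<open>The ball of radius \<open>norm u0 + 1\<close> contains all data within distance 1, so a
  single rate \<open>k\<close> serves all of them.\<close>

lemma solution_map_uniform_limit:
  "uniform_limit {a..b} (solution_map \<epsilon> \<sigma> \<delta>) (solution_map \<epsilon> \<sigma> \<delta> u0) (at u0)"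
proof (rule uniform_limitI)
  fix e :: real assume "e > 0"
  obtain k where k: "\<And>u0' v0 u v t. norm u0' \<le> norm u0 + 1 \<Longrightarrow> norm v0 \<le> norm u0 + 1 \<Longrightarrow> global_solution \<epsilon> \<sigma> \<delta> u0' u \<Longrightarrow>
      global_solution \<epsilon> \<sigma> \<delta> v0 v \<Longrightarrow> norm (u t - v t) \<le> 2 * norm (u0' - v0) * exp (k * \<bar>t\<bar>)"
    using global_solution_dependence[of "norm u0 + 1"] by blast
  \<comment> \<open>Bounds \<open>exp (k * \<bar>t\<bar>)\<close> on the whole interval, whatever
    the sign of \<open>k\<close>.\<close>
  let ?E = "exp (\<bar>k\<bar> * (\<bar>a\<bar> + \<bar>b\<bar>))"
  have "\<forall>\<^sub>F v in at u0. dist v u0 < min 1 (e / (2 * ?E))"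
    using \<open>e > 0\<close> by (auto simp: eventually_at intro!: exI[of _ "min 1 (e / (2 * ?E))"])
  then show "\<forall>\<^sub>F v in at u0. \<forall>t\<in>{a..b}. dist (solution_map \<epsilon> \<sigma> \<delta> v t) (solution_map \<epsilon> \<sigma> \<delta> u0 t) < e"
  proof eventually_elim
    case (elim v)
    then have v: "norm (v - u0) < 1" "norm (v - u0) < e / (2 * ?E)" by (auto simp: dist_norm)
    have "norm v \<le> norm u0 + 1" using v(1) norm_triangle_ineq2[of v u0] by simp
    show ?case
    proof
      fix t assume t: "t \<in> {a..b}"
      have "k * \<bar>t\<bar> \<le> \<bar>k\<bar> * (\<bar>a\<bar> + \<bar>b\<bar>)" using t by (intro mult_mono) auto
      then have "2 * norm (v - u0) * exp (k * \<bar>t\<bar>) \<le> 2 * norm (v - u0) * ?E" by (intro mult_left_mono) auto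
      moreover have "norm (solution_map \<epsilon> \<sigma> \<delta> v t - solution_map \<epsilon> \<sigma> \<delta> u0 t) \<le> 2 * norm (v - u0) * exp (k * \<bar>t\<bar>)"
        by (rule k[OF \<open>norm v \<le> norm u0 + 1\<close> _ global_solution_solution_map global_solution_solution_map]) simp
      moreover have "2 * norm (v - u0) * ?E < e" using v(2) by (simp add: field_simps)
      ultimately show "dist (solution_map \<epsilon> \<sigma> \<delta> v t) (solution_map \<epsilon> \<sigma> \<delta> u0 t) < e" by (simp add: dist_norm)
    qed
  qed
qed

end

theorem theorem4p1:
  shows "\<exists>C :: real \<Rightarrow> real \<Rightarrow> real. \<forall>(\<epsilon>::real) (\<sigma>::real) (\<delta>::real^2). \<epsilon> > 0 \<longrightarrow> \<sigma> > 1/4 \<longrightarrow>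
      (\<forall>u\<^sub>0. \<exists>!u. global_solution \<epsilon> \<sigma> \<delta> u\<^sub>0 u) \<and>
      (\<forall>a b u\<^sub>0. a \<le> 0 \<longrightarrow> 0 \<le> b \<longrightarrow>
         uniform_limit {a..b} (solution_map \<epsilon> \<sigma> \<delta>) (solution_map \<epsilon> \<sigma> \<delta> u\<^sub>0) (at u\<^sub>0)) \<and>
      (\<forall>u\<^sub>0 u t. global_solution \<epsilon> \<sigma> \<delta> u\<^sub>0 u \<longrightarrow> norm (u t) \<le> C \<epsilon> (norm u\<^sub>0))"
  \<comment> \<open>The witness is the root of the ratio of the two constants comparing the energy
    with the norm; \<sigma> and \<delta> do not enter.\<close>
  by (intro exI[of _ "\<lambda>\<epsilon> r. sqrt (max 1 (\<epsilon>\<^sup>2) / min 1 (\<epsilon>\<^sup>2)) * r"] allI impI conjI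
      global_solution_ex1 solution_map_uniform_limit global_solution_bound)

end
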